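(* Let $A$ be a finite set of integers with $|A|\geqslant 2$, normalized so that $\min A=0$, $\gcd(A)=1$ and $\max A=n$. If $|2A|=3|A|-3$, then at least one of the following holds: \begin{enumerate} \item $A$ is a bi-arithmetic progression; \item $2A$ contains an interval of integers of length $2|A|-1$ (i.e. $2|A|-1$ consecutive integers); \item $|A|=6$ and $A$ is a Freiman isomorphic image of $K_6=\{(0,0),(0,1),(0,2),(1,0),(1,1),(2,0)\}\subseteq\mathbb{Z}^2$; \item $|A|=\frac12(n+2)$ and $A$ equals either a set of the form $T_{k,n}$, or a set of the form $n-T_{k,n}=\{n-t: t\in T_{k,n}\}$, or a set of the form $S_{u,n}$, where $T_{k,n}=\{0,2,\ldots,2k\}\cup B\cup\{n\}$ for some integer $k\in[0,\frac12 n-2]$ and some $B$ which is left dense, anti-symmetric and additively minimal in $[2k,n-1]$; and $S_{u,n}=\{0\}\cup C\cup D\cup\{n\}$ for some integer $u\in[4,n-6]$, some $C$ which is right dense, anti-symmetric and additively minimal in $[1,u]$, and some $D$ which is left dense, anti-symmetric and additively minimal in $[u+2,n-1]$. \end{enumerate}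
   Context: For sets $X,Y$ of integers, $X+Y=\{x+y:x\in X,y\in Y\}$ and $2X=X+X$; $b\pm X=\{b\pm x:x\in X\}$. For integers $a\le b$, $[a,b]$ denotes the set of integers $x$ with $a\le x\le b$ (empty if $a>b$), and $X(a,b)=|X\cap[a,b]|$. A bijection $\varphi:X\to Y$ between subsets of abelian semigroups is a Freiman isomorphism (of order 2) if for all $a,b,c,d\in X$: $a+b=c+d$ iff $\varphi(a)+\varphi(b)=\varphi(c)+\varphi(d)$. A finite set $B\subseteq\mathbb{Z}$ is a bi-arithmetic progression if it is a Freiman isomorphic image of $\{(0,0),(0,1),\ldots,(0,n_0)\}\cup\{(1,0),(1,1),\ldots,(1,n_1)\}\subseteq\mathbb{Z}^2$ for some $n_0,n_1\ge0$ with $n_0+n_1+2=|B|$ (equivalently, $B=I_0\cup I_1$ with $I_0,I_1$ arithmetic progressions of the same difference such that $2I_0$, $I_0+I_1$, $2I_1$ are pairwise disjoint). For $B\subseteq[u,v]$: $B$ is half dense in $[u,v]$ if $B(u,v)=\frac12(v-u+1)$; $B$ is anti-symmetric in $[u,v]$ if $B\cap(u+v-B)=\emptyset$ and $B\cup(u+v-B)=[u,v]$; a half dense $B$ is left dense in $[u,v]$ if $B(u,x)>\frac12(x-u+1)$ for all $x\in[u,v-1]$, and right dense in $[u,v]$ if $B(x,v)>\frac12(v-x+1)$ for all $x\in[u+1,v]$. A left dense anti-symmetric $B$ in $[u,v]$ is additively minimal in $[u,v]$ if $2(B\cup\{v+1\})=[2u,u+v-1]\cup(v+1+(B\cup\{v+1\}))$;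 a right dense anti-symmetric $B$ in $[u,v]$ is additively minimal in $[u,v]$ if $2(B\cup\{u-1\})=[u+v+1,2v]\cup(u-1+(B\cup\{u-1\}))$. *)

theory Defs
  imports Complex_Main "HOL-Library.Set_Algebras" "HOL-Library.Product_Plus"
begin

(* Sumsets X + Y are those of HOL-Library.Set_Algebras, and the translate b + X is written
   b +o X. Conditions involving a factor 1/2 are stated with the denominator cleared. *)

definition reflect :: "int \<Rightarrow> int set \<Rightarrow> int set" where
  "reflect b X = (\<lambda>x. b - x) ` X"

definition count_in :: "int set \<Rightarrow> int \<Rightarrow> int \<Rightarrow> nat" where
  "count_in X a b = card (X \<inter> {a..b})"

definition freiman_iso ::
  "('a::ab_semigroup_add \<Rightarrow> 'b::ab_semigroup_add) \<Rightarrow> 'a set \<Rightarrow> 'b set \<Rightarrow> bool" where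
  "freiman_iso \<phi> X Y \<longleftrightarrow> bij_betw \<phi> X Y \<and>
     (\<forall>a\<in>X. \<forall>b\<in>X. \<forall>c\<in>X. \<forall>d\<in>X. a + b = c + d \<longleftrightarrow> \<phi> a + \<phi> b = \<phi> c + \<phi> d)"

definition freiman_image ::
  "'a::ab_semigroup_add set \<Rightarrow> 'b::ab_semigroup_add set \<Rightarrow> bool" where
  "freiman_image X Y \<longleftrightarrow> (\<exists>\<phi>. freiman_iso \<phi> X Y)"

definition two_rows :: "nat \<Rightarrow> nat \<Rightarrow> (int \<times> int) set" where
  "two_rows n0 n1 = {0} \<times> {0..int n0} \<union> {1} \<times> {0..int n1}"

definition bi_arith_prog :: "int set \<Rightarrow> bool" where
  "bi_arith_prog B \<longleftrightarrow> finite B \<and>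
     (\<exists>n0 n1. n0 + n1 + 2 = card B \<and> freiman_image (two_rows n0 n1) B)"

definition K6 :: "(int \<times> int) set" where
  "K6 = {(0,0), (0,1), (0,2), (1,0), (1,1), (2,0)}"

definition half_dense :: "int set \<Rightarrow> int \<Rightarrow> int \<Rightarrow> bool" where
  "half_dense B u v \<longleftrightarrow> B \<subseteq> {u..v} \<and> 2 * int (count_in B u v) = v - u + 1"

definition anti_symmetric :: "int set \<Rightarrow> int \<Rightarrow> int \<Rightarrow> bool" where
  "anti_symmetric B u v \<longleftrightarrow> B \<subseteq> {u..v} \<and>
     B \<inter> reflect (u + v) B = {} \<and> B \<union> reflect (u + v) B = {u..v}"

definition left_dense :: "int set \<Rightarrow> int \<Rightarrow> int \<Rightarrow> bool" where
  "left_dense B u v \<longleftrightarrow> half_dense B u v \<and>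
     (\<forall>x\<in>{u..v - 1}. 2 * int (count_in B u x) > x - u + 1)"

definition right_dense :: "int set \<Rightarrow> int \<Rightarrow> int \<Rightarrow> bool" where
  "right_dense B u v \<longleftrightarrow> half_dense B u v \<and>
     (\<forall>x\<in>{u + 1..v}. 2 * int (count_in B x v) > v - x + 1)"

definition left_additively_minimal :: "int set \<Rightarrow> int \<Rightarrow> int \<Rightarrow> bool" where
  "left_additively_minimal B u v \<longleftrightarrow> left_dense B u v \<and> anti_symmetric B u v \<and>
     (B \<union> {v + 1}) + (B \<union> {v + 1}) = {2 * u..u + v - 1} \<union> ((v + 1) +o (B \<union> {v + 1}))"

definition right_additively_minimal :: "int set \<Rightarrow> int \<Rightarrow> int \<Rightarrow> bool" where
  "right_additively_minimal B u v \<longleftrightarrow> right_dense B u v \<and> anti_symmetric B u v \<and>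
     (B \<union> {u - 1}) + (B \<union> {u - 1}) = {u + v + 1..2 * v} \<union> ((u - 1) +o (B \<union> {u - 1}))"

definition T_form :: "int \<Rightarrow> int \<Rightarrow> int set \<Rightarrow> bool" where
  "T_form k n X \<longleftrightarrow> 0 \<le> k \<and> 2 * k \<le> n - 4 \<and>
     (\<exists>B. left_additively_minimal B (2 * k) (n - 1) \<and>
          X = (\<lambda>i. 2 * i) ` {0..k} \<union> B \<union> {n})"

definition S_form :: "int \<Rightarrow> int \<Rightarrow> int set \<Rightarrow> bool" where
  "S_form u n X \<longleftrightarrow> 4 \<le> u \<and> u \<le> n - 6 \<and>
     (\<exists>C D. right_additively_minimal C 1 u \<and> left_additively_minimal D (u + 2) (n - 1) \<and>
            X = {0} \<union> C \<union> D \<union> {n})"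

end

theory Submission
  imports Defs
begin

text \<open>
  Reduce the sumset modulo \<open>n = max A\<close>. Every class of \<open>A\<close> is hit
    by two sums, so \<open>|2A| = n + |A| - M + m\<close>,
  where \<open>M\<close> counts the classes missed by \<open>2A\<close> and \<open>m\<close> the classes outside \<open>A\<close> that are hit twice.

  If \<open>n \<ge> 2|A| - 1\<close>, the residues of \<open>A\<close> form a set \<open>K\<close> in \<open>\<int>/n\<int>\<close> with \<open>|2K| \<le> 2|K| - 1 \<le> n - 2\<close>.
  By Hamidoune's isoperimetric method, \<open>K\<close> is an arithmetic progression, and then \<open>m = 0\<close> makes \<open>A\<close> a union
  of two integer progressions; or \<open>K\<close> nearly fills a few cosets of a subgroup, and then adding up
  \<open>|2A|\<close> class by class leaves only bi-arithmetic progressions and \<open>K\<^sub>6\<close>.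

  For smaller \<open>n\<close> let \<open>f(x) = 2|A \<inter> [0,x]| - (x + 1)\<close>. Pairing \<open>i\<close> with \<open>x - i\<close> or \<open>x + n - i\<close> shows that
  \<open>x \<notin> 2A\<close> forces \<open>f(x) \<le> 0\<close> and \<open>x + n \<notin> 2A\<close> forces \<open>f(x) \<ge> f(n) - 1\<close>, and that \<open>A\<close> is anti-symmetric on
  \<open>[0,x]\<close> or \<open>[x,n]\<close> in the case of equality. If \<open>n \<le> 2|A| - 3\<close>, either all gaps of \<open>2A\<close> below \<open>n\<close> precede those
  above, which gives the long interval, or \<open>f\<close> descends in between, which is so costly that \<open>A\<close> is a
  bi-arithmetic progression. If \<open>n = 2|A| - 2\<close>, then \<open>M = m + 1\<close>. Two missed classes make \<open>K\<close> periodic.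
  If \<open>x\<^sub>0\<close> is the only one, then apart from bi-arithmetic progressions and \<open>T\<^sub>0\<^sub>,\<^sub>n\<close> (and its reflection), \<open>x\<^sub>0\<close> cuts
  \<open>A\<close> into two pieces that, seen from the ends, are symmetric numerical semigroups with Frobenius
  numbers \<open>x\<^sub>0\<close> and \<open>n - x\<^sub>0\<close>. Such a semigroup contains 2 and consists of even numbers, or it is additively
  minimal. For \<open>T\<^sub>0\<^sub>,\<^sub>n\<close> all of \<open>n - A\<close> is a symmetric semigroup, with Frobenius number \<open>n + 1\<close>.
\<close>

section \<open>Critical sets in finite abelian groups\<close>

text \<open>With |2A| = 3|A| - 3 the counting formula reads M - m = n + 3 - 2|A|, which fixes the
  three ranges of n: M - m is at least 2, equal to 1, or at most 0. Two missed classes are the room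
  that a Vosper-type theorem needs. That theorem is stated for subgroups of an arbitrary abelian
  group because its induction passes to the subgroup spanned by an atom. Its periodic alternative is
  weak: K lacks fewer than |H| elements of a union of H-cosets. The class-by-class count therefore
  also needs |2T| \<ge> 2|T| - 1 for the set T of occupied classes, and this comes from taking the
  modulus as small as possible. In the other ranges everything depends on the two thresholds 0 and
  f(n) - 1, where f(n) = 2|A| - n - 1. For n \<le> 2|A| - 3 they are apart, so no class is missed
  and m = f(n) - 2. For n = 2|A| - 2 they coincide, so a missed class x has f(x) = 0 and makes A
  anti-symmetric on both sides of x at once.\<close>

definition is_subgroup :: "'a::ab_group_add set \<Rightarrow> bool" where
  "is_subgroup H \<longleftrightarrow> 0 \<in> H \<and> (\<forall>x\<in>H. \<forall>y\<in>H. x - y \<in> H)"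

lemma is_subgroupD:
  assumes "is_subgroup H"
  shows "0 \<in> H" "x \<in> H \<Longrightarrow> y \<in> H \<Longrightarrow> x - y \<in> H" "x \<in> H \<Longrightarrow> - x \<in> H"
    "x \<in> H \<Longrightarrow> y \<in> H \<Longrightarrow> x + y \<in> H"
proof -
  show 0: "0 \<in> H" and d: "x \<in> H \<Longrightarrow> y \<in> H \<Longrightarrow> x - y \<in> H" for x y
    using assms by (auto simp: is_subgroup_def)
  show m: "x \<in> H \<Longrightarrow> - x \<in> H" for x using d[OF 0] by simp
  show "x \<in> H \<Longrightarrow> y \<in> H \<Longrightarrow> x + y \<in> H" using d[OF _ m] by simp
qed

lemma card_translate: "card ((+) (g::'a::ab_group_add) ` M) = card M"
  by (intro card_image) (auto simp: inj_on_def)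

lemma translate_eq_if_subset:
  fixes g :: "'a::ab_group_add"
  assumes "finite F" "(+) g ` F \<subseteq> F"
  shows "(+) g ` F = F"
  by (intro card_subset_eq assms card_translate)

lemma translate_sum: "(+) (g::'a::ab_group_add) ` M + X = (+) g ` (M + X)"
proof -
  have "(\<exists>a\<in>(+) g ` M. \<exists>b\<in>X. c = a + b) \<longleftrightarrow> (\<exists>a\<in>M. \<exists>b\<in>X. c = g + (a + b))" for c
    by (simp add: add.assoc)
  then show ?thesis by (auto simp: set_plus_def)
qed

lemma translate_translate: "(+) (g::'a::ab_group_add) ` (+) h ` M = (+) (g + h) ` M"
  by (auto simp: image_image add.assoc)

lemma stabilizer_subgroup:
  assumes "is_subgroup G"
  shows "is_subgroup {g \<in> G. (+) g ` F = F}"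
proof -
  have "(+) (x - y) ` F = F" if "(+) x ` F = F" "(+) y ` F = F" for x y
  proof -
    have "(+) (x - y) ` F = (+) (x - y) ` (+) y ` F" by (simp only: that(2))
    also have "\<dots> = F" using that(1) by (simp only: translate_translate diff_add_cancel)
    finally show ?thesis .
  qed
  then show ?thesis
    using is_subgroupD[OF assms] by (auto simp: is_subgroup_def)
qed

text \<open>Finiteness turns \<open>F + X \<subseteq> F\<close> into invariance under translation by
  each element of \<open>X\<close>. The stabilizer of \<open>F\<close> is then a subgroup containing
  the generating set \<open>X\<close>, hence all of \<open>G\<close>.\<close>

lemma sum_closed_eq_group:
  fixes G X F :: "'a::ab_group_add set"
  assumes G: "is_subgroup G" "finite G" and X: "X \<subseteq> G"
    and gen: "\<And>H. is_subgroup H \<Longrightarrow> X \<subseteq> H \<Longrightarrow> G \<subseteq> H"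
    and F: "F \<subseteq> G" "F \<noteq> {}" "F + X \<subseteq> F"
  shows "F = G"
proof -
  let ?H = "{g \<in> G. (+) g ` F = F}"
  have "finite F" using F G finite_subset by blast
  have "X \<subseteq> ?H"
  proof
    fix x assume x: "x \<in> X"
    have "(+) x ` F \<subseteq> F" using F(3) x by (auto simp: set_plus_def add.commute)
    then show "x \<in> ?H" using translate_eq_if_subset[OF \<open>finite F\<close>] x X by auto
  qed
  then have GH: "G \<subseteq> ?H" using gen stabilizer_subgroup[OF G(1)] by blast
  obtain f where f: "f \<in> F" using F by blast
  have "g \<in> F" if g: "g \<in> G" for g
  proof -
    have "g - f \<in> G" using g f F is_subgroupD[OF G(1)] by blast
    then have "(+) (g - f) ` F = F" using GH by blast
    then have "(g - f) + f \<in> F" using f by blast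
    then show ?thesis by simp
  qed
  then show ?thesis using F by blast
qed

lemma sum_subset_subgroup:
  assumes "is_subgroup G" "X \<subseteq> G" "Y \<subseteq> G"
  shows "X + Y \<subseteq> G"
proof
  fix z assume "z \<in> X + Y"
  then obtain x y where "x \<in> X" "y \<in> Y" "z = x + y" by (auto simp: set_plus_def)
  then show "z \<in> G" using is_subgroupD(4)[OF assms(1)] assms(2,3) by blast
qed

lemma subset_sum_zero: "0 \<in> Y \<Longrightarrow> X \<subseteq> X + (Y::'a::ab_group_add set)"
  by (metis add.right_neutral set_plus_intro subsetI)

definition span_group :: "'a::ab_group_add set \<Rightarrow> 'a set" where
  "span_group M = \<Inter>{H. is_subgroup H \<and> M \<subseteq> H}"

lemma span_group:
  shows "is_subgroup (span_group M)" "M \<subseteq> span_group M"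
    "\<And>H. is_subgroup H \<Longrightarrow> M \<subseteq> H \<Longrightarrow> span_group M \<subseteq> H"
  by (auto simp: span_group_def is_subgroup_def)

text \<open>Adding a subset \<open>M\<close> of the subgroup never leaves a coset of
  \<open>S\<close>, so \<open>X\<close> and \<open>X + M\<close> split over the same family
  \<open>Cs\<close>, the cosets that \<open>X\<close> meets.\<close>

lemma coset_decomposition:
  fixes S X M :: "'a::ab_group_add set"
  assumes S: "is_subgroup S" "finite S" and X: "finite X" and M: "M \<subseteq> S" "0 \<in> M"
  defines "Cs \<equiv> (\<lambda>x. (+) x ` S) ` X"
  shows "finite Cs" "card X = (\<Sum>C\<in>Cs. card (X \<inter> C))" 
    "card (X + M) = (\<Sum>C\<in>Cs. card ((X \<inter> C) + M))"
    "\<And>C x. C \<in> Cs \<Longrightarrow> x \<in> C \<Longrightarrow> C = (+) x ` S"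
proof -
  note s = is_subgroupD[OF S(1)]
  show fC: "finite Cs" using X by (simp add: Cs_def)
  show eq: "C = (+) x ` S" if C: "C \<in> Cs" and x: "x \<in> C" for C x
  proof -
    from C obtain y where y: "C = (+) y ` S" by (auto simp: Cs_def)
    then obtain t where t: "x = y + t" "t \<in> S" using x by blast
    have "y + u \<in> (+) x ` S" if "u \<in> S" for u
      using s(2)[OF that t(2)] t(1) by (intro image_eqI[of _ _ "u - t"]) auto
    moreover have "x + u \<in> (+) y ` S" if "u \<in> S" for u
      using s(4)[OF t(2) that] t(1) by (intro image_eqI[of _ _ "t + u"]) (auto simp: add.assoc)
    ultimately show ?thesis using y by auto
  qed
  have disj: "C \<inter> D = {}" if "C \<in> Cs" "D \<in> Cs" "C \<noteq> D" for C D
    using that(3) eq[OF that(1)] eq[OF that(2)] by (metis disjoint_iff)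
  have fin: "finite C" if "C \<in> Cs" for C using that S by (auto simp: Cs_def)
  have XM: "(X \<inter> C) + M \<subseteq> C" if "C \<in> Cs" for C
  proof
    fix z assume "z \<in> (X \<inter> C) + M"
    then obtain x m where "x \<in> C" "m \<in> M" "z = x + m" by (auto simp: set_plus_def)
    then show "z \<in> C" using eq[OF that, of x] M(1) by auto
  qed
  have self: "x \<in> (+) x ` S" for x using s(1) by (metis add.right_neutral image_eqI)
  have "X = (\<Union>C\<in>Cs. X \<inter> C)" using self by (auto simp: Cs_def)
  moreover have "card (\<Union>C\<in>Cs. X \<inter> C) = (\<Sum>C\<in>Cs. card (X \<inter> C))"
    using X disj by (intro card_UN_disjoint fC) auto
  ultimately show "card X = (\<Sum>C\<in>Cs. card (X \<inter> C))" by simp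
  have "X + M = (\<Union>C\<in>Cs. (X \<inter> C) + M)"
    using self by (fastforce simp: Cs_def set_plus_def)
  moreover have "card (\<Union>C\<in>Cs. (X \<inter> C) + M) = (\<Sum>C\<in>Cs. card ((X \<inter> C) + M))"
  proof (intro card_UN_disjoint fC ballI impI)
    show "finite ((X \<inter> C) + M)" if "C \<in> Cs" for C using XM[OF that] fin[OF that] finite_subset
      by blast
    show "((X \<inter> C) + M) \<inter> ((X \<inter> D) + M) = {}" if "C \<in> Cs" "D \<in> Cs" "C \<noteq> D" for C D
      using XM disj that by blast
  qed
  ultimately show "card (X + M) = (\<Sum>C\<in>Cs. card ((X \<inter> C) + M))" by simp
qed

text \<open>Hamidoune's 2-atom: among all F with |F| \<ge> 2 and |F + X| \<le> |G| - 2,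
  \<open>M\<close> minimises |F + X| - |F|, and it is smallest among the minimisers; it is
  translated to contain 0. The conditions are written additively to avoid truncated subtraction.
  \<open>small\<close> says that the minimum is at most |X| - 1.\<close>

locale two_atom =
  fixes G X M :: "'a::ab_group_add set"
  assumes G: "is_subgroup G" "finite G"
    and X: "X \<subseteq> G" "0 \<in> X"
    and gen: "\<And>H. is_subgroup H \<Longrightarrow> X \<subseteq> H \<Longrightarrow> G \<subseteq> H"
    and M: "M \<subseteq> G" "0 \<in> M" "2 \<le> card M" "card (M + X) + 2 \<le> card G"
    and min: "\<And>F. F \<subseteq> G \<Longrightarrow> 2 \<le> card F \<Longrightarrow> card (F + X) + 2 \<le> card G
      \<Longrightarrow> card (M + X) + card F \<le> card (F + X) + card M"
    and min_card: "\<And>F. F \<subseteq> G \<Longrightarrow> 2 \<le> card F \<Longrightarrow> card (F + X) + 2 \<le> card G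
      \<Longrightarrow> card (M + X) + card F = card (F + X) + card M \<Longrightarrow> card M \<le> card F"
    and small: "card (M + X) + 1 \<le> card M + card X"
begin

lemma fin: "F \<subseteq> G \<Longrightarrow> finite F" using G finite_subset by blast

lemma sums: "F \<subseteq> G \<Longrightarrow> F' \<subseteq> G \<Longrightarrow> F + F' \<subseteq> G"
  using sum_subset_subgroup[OF G(1)] .

lemma translate_sub: "g \<in> G \<Longrightarrow> F \<subseteq> G \<Longrightarrow> (+) g ` F \<subseteq> G"
  using is_subgroupD(4)[OF G(1)] by blast

text \<open>Duality: the negated complement F of \<open>M + X\<close> competes with
  \<open>M\<close>, because F + X avoids the negatives of \<open>M\<close>. Its excess |F + X| - |F|
  is no larger than that of \<open>M\<close>, so minimality of size gives |M| \<le> |F|.\<close>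

lemma card_le_complement: "card M + card (M + X) \<le> card G"
proof -
  define N where "N = G - (M + X)"
  define F where "F = uminus ` N"
  have MX: "M + X \<subseteq> G" using sums M X by blast
  have N: "card N = card G - card (M + X)" "N \<subseteq> G"
    using MX fin by (auto simp: N_def card_Diff_subset)
  have cF: "card F = card N" unfolding F_def by (intro card_image) (auto simp: inj_on_def)
  have FG: "F \<subseteq> G" using N is_subgroupD(3)[OF G(1)] by (auto simp: F_def)
  have "uminus ` (F + X) \<subseteq> G - M"
  proof
    fix z assume "z \<in> uminus ` (F + X)"
    then obtain v x where z: "v \<in> N" "x \<in> X" "z = v - x"
      by (auto simp: F_def set_plus_def)
    have "z \<in> G" using z N X is_subgroupD(2)[OF G(1)] by blast
    moreover have "z \<notin> M"
    proof
      assume "z \<in> M"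
      then have "z + x \<in> M + X" using z by blast
      then show False using z by (simp add: N_def)
    qed
    ultimately show "z \<in> G - M" by blast
  qed
  then have "card (uminus ` (F + X)) \<le> card G - card M"
    using card_mono[of "G - M"] G M(1) fin by (metis card_Diff_subset finite_Diff)
  moreover have "card (uminus ` (F + X)) = card (F + X)"
    by (intro card_image) (auto simp: inj_on_def)
  ultimately have FX: "card (F + X) \<le> card G - card M" by simp
  have mG: "card M \<le> card G" using M(1) G card_mono by blast
  have 1: "card (F + X) + 2 \<le> card G" using FX M mG by linarith
  have 2: "2 \<le> card F" using cF N M by linarith
  have "card (M + X) + card F = card (F + X) + card M"
    using min[OF FG 2 1] FX cF N M mG by linarith
  then show ?thesis using min_card[OF FG 2 1] cF N M by linarith
qed

text \<open>The function |F + X| - |F| is submodular. If \<open>M\<close> and a different translate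
  share two points, their intersection is smaller than an atom and lies strictly above the minimum,
  so their union lies strictly below it. The union must then be too large to compete, which
  \<open>card_le_complement\<close> forbids.\<close>

lemma translate_meets:
  assumes g: "g \<in> G" and two: "2 \<le> card (M \<inter> (+) g ` M)"
  shows "(+) g ` M = M"
proof (rule ccontr)
  assume neq: "(+) g ` M \<noteq> M"
  let ?N = "(+) g ` M"
  let ?I = "M \<inter> ?N" and ?U = "M \<union> ?N"
  have N: "?N \<subseteq> G" using translate_sub g M by blast
  note f = fin[OF M(1)] fin[OF N]
  have "\<not> M \<subseteq> ?N" using neq card_subset_eq[OF f(2), of M] card_translate[of g M] by auto
  then have "?I \<subset> M" by blast
  then have cI: "card ?I < card M" using f psubset_card_mono by blast
  have "?I + X \<subseteq> (M + X) \<inter> (?N + X)" by (auto simp: set_plus_def)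
  moreover have U: "?U + X = (M + X) \<union> (?N + X)" by (auto simp: set_plus_def)
  have fX: "finite (M + X)" "finite (?N + X)" using fin sums M N X by blast+
  have cN: "card (?N + X) = card (M + X)" by (simp add: translate_sum card_translate)
  have IX: "card (?I + X) \<le> card ((M + X) \<inter> (?N + X))"
    using calculation fX by (simp add: card_mono)
  have sumX: "card (?I + X) + card (?U + X) \<le> 2 * card (M + X)"
    using IX card_Un_Int[OF fX] cN U by simp
  have sumM: "card ?I + card ?U = 2 * card M"
    using card_Un_Int[OF f] by (simp add: card_translate)
  have IG: "?I \<subseteq> G" using M by blast
  have IX2: "card (?I + X) + 2 \<le> card G"
    using IX card_mono[OF fX(1), of "(M + X) \<inter> (?N + X)"] M(4) by simp
  have "card (M + X) + card ?I < card (?I + X) + card M"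
    using min[OF IG two IX2] min_card[OF IG two IX2] cI by linarith
  then have UX: "card (?U + X) + card M < card (M + X) + card ?U" using sumX sumM by linarith
  have UG: "?U \<subseteq> G" using M N by blast
  have "2 \<le> card ?U" using card_mono[of ?U M] f M(3) by fastforce
  then have "card G < card (?U + X) + 2" using min[OF UG] UX by force
  then have "card G \<le> card (M + X) + card ?U - card M" using UX by linarith
  moreover have "card ?U = 2 * card M - card ?I" using sumM by linarith
  ultimately have "card G + card ?I \<le> card (M + X) + card M" using cI two by linarith
  then show False using card_le_complement two by linarith
qed

text \<open>Let S be the stabilizer of \<open>M\<close>; it has at least two elements and lies in
  \<open>M\<close>. For a in \<open>M\<close> the coset a + S lies both in \<open>M\<close> and in a
  + M, so these share two points and a itself stabilizes \<open>M\<close>.\<close>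

lemma subgroup_if_periodic:
  assumes "g \<in> G" "g \<noteq> 0" "(+) g ` M = M"
  shows "is_subgroup M"
proof -
  define S where "S = {g \<in> G. (+) g ` M = M}"
  have S: "is_subgroup S" unfolding S_def by (rule stabilizer_subgroup[OF G(1)])
  have "{0, g} \<subseteq> S" using assms is_subgroupD(1)[OF S] by (auto simp: S_def)
  moreover have "finite S" using G by (simp add: S_def)
  ultimately have cS: "2 \<le> card S" using assms card_mono[of S "{0, g}"] by simp
  have SM: "a + s \<in> M" if "a \<in> M" "s \<in> S" for a s
    using that by (auto simp: S_def add.commute)
  have "M \<subseteq> S"
  proof
    fix a assume a: "a \<in> M"
    have "0 + s \<in> M" if "s \<in> S" for s using SM[OF M(2) that] .
    then have "(+) a ` S \<subseteq> M \<inter> (+) a ` M" using SM[OF a] by auto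
    then have "card ((+) a ` S) \<le> card (M \<inter> (+) a ` M)"
      using fin[OF M(1)] by (intro card_mono) auto
    then have "(+) a ` M = M" using translate_meets[of a] cS a M by (auto simp: card_translate)
    then show "a \<in> S" using a M by (auto simp: S_def)
  qed
  moreover have "S \<subseteq> M" using SM[OF M(2)] by auto
  ultimately show ?thesis using S by simp
qed

end

lemma two_atom_exists:
  fixes G X :: "'a::ab_group_add set"
  assumes G: "is_subgroup G" "finite G"
    and X: "X \<subseteq> G" "0 \<in> X"
    and gen: "\<And>H. is_subgroup H \<Longrightarrow> X \<subseteq> H \<Longrightarrow> G \<subseteq> H"
    and F: "F \<subseteq> G" "2 \<le> card F" "card (F + X) + 2 \<le> card G" "card (F + X) + 1 \<le> card F + card X"
  obtains M where "two_atom G X M"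
proof -
  define P where "P F \<longleftrightarrow> F \<subseteq> G \<and> 2 \<le> card F \<and> card (F + X) + 2 \<le> card G" for F
  define \<kappa> where "\<kappa> F = card (F + X) - card F" for F
  have le: "card F \<le> card (F + X)" "card F \<le> card G" if "P F" for F
    using that finite_subset[OF sum_subset_subgroup[OF G(1) _ X(1)] G(2)] G(2)
    by (auto simp: P_def intro!: card_mono subset_sum_zero[OF X(2)])
  \<comment> \<open>A lexicographic minimum in one number: sizes never exceed \<open>card G\<close>,
    so this weight minimises \<kappa> before it minimises the size.\<close>
  obtain M where M: "P M" "\<And>F. P F \<Longrightarrow> \<kappa> M * (card G + 1) + card M \<le> \<kappa> F * (card G + 1) + card F"
    using ex_has_least_nat[of P F "\<lambda>F. \<kappa> F * (card G + 1) + card F"] F by (auto simp: P_def)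
  have k1: "\<kappa> M \<le> \<kappa> F" if "P F" for F
  proof (rule ccontr)
    assume "\<not> \<kappa> M \<le> \<kappa> F"
    then have "(\<kappa> F + 1) * (card G + 1) \<le> \<kappa> M * (card G + 1)" by (intro mult_right_mono) auto
    then show False using M(2)[OF that] le(2)[OF that] by (simp add: algebra_simps)
  qed
  have k2: "card M \<le> card F" if "P F" "\<kappa> F = \<kappa> M" for F using M(2)[OF that(1)] that(2) by simp
  obtain m where m: "m \<in> M" using M(1) by (cases "M = {}") (auto simp: P_def)
  define N where "N = (+) (- m) ` M"
  have N: "card N = card M" "card (N + X) = card (M + X)" "0 \<in> N"
    unfolding N_def by (simp_all only: card_translate translate_sum)
      (use m in \<open>auto intro!: image_eqI[of _ _ m]\<close>)
  have "N \<subseteq> G" using m M(1) is_subgroupD[OF G(1)] by (auto simp: N_def P_def subset_iff)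
  then have PN: "P N" using M(1) N by (simp add: P_def)
  have kN: "\<kappa> N = \<kappa> M" using N by (simp add: \<kappa>_def)
  have PF: "P F" using F by (simp add: P_def)
  have "two_atom G X N"
  proof
    show "card (N + X) + 1 \<le> card N + card X"
      using k1[OF PF] F(4) kN le(1)[OF PN] le(1)[OF PF] by (simp add: \<kappa>_def)
    fix F' assume "F' \<subseteq> G" "2 \<le> card F'" "card (F' + X) + 2 \<le> card G"
    then have PF': "P F'" by (simp add: P_def)
    show *: "card (N + X) + card F' \<le> card (F' + X) + card N"
      using k1[OF PF'] kN le(1)[OF PN] le(1)[OF PF'] by (simp add: \<kappa>_def)
    assume "card (N + X) + card F' = card (F' + X) + card N"
    then have "\<kappa> F' = \<kappa> M" using kN le(1)[OF PN] le(1)[OF PF'] by (simp add: \<kappa>_def)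
    then show "card N \<le> card F'" using k2[OF PF'] N by simp
  qed (use G X gen PN N in \<open>auto simp: P_def\<close>)
  then show ?thesis by (rule that)
qed

text \<open>The case of a two-element atom. At most one \<open>x1\<close> in X has x1 + r outside X,
  so at most one chain with step r ends. If r generates G, then X is the chain leading back from
  \<open>x1\<close>; otherwise X is a union of full cosets of the span of r and at most one partial
  coset.\<close>

lemma almost_periodic:
  fixes G X :: "'a::ab_group_add set"
  assumes G: "is_subgroup G" "finite G" and X: "X \<subseteq> G" "X \<noteq> {}" "X \<noteq> G"
    and r: "r \<in> G" "r \<noteq> 0" and two: "card (X + {0, r}) \<le> card X + 1"
  shows "(\<exists>a. X = (\<lambda>i. ((+) (- r) ^^ i) a) ` {..<card X}) \<or>
    (\<exists>H. is_subgroup H \<and> H \<subseteq> G \<and> 2 \<le> card H \<and> H \<noteq> G \<and> card (X + H) + 1 \<le> card X + card H)"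
proof -
  note g = is_subgroupD[OF G(1)]
  define S where "S = span_group {r}"
  have S: "is_subgroup S" "r \<in> S" "S \<subseteq> G"
    using span_group[of "{r}"] span_group(3)[OF G(1), of "{r}"] r by (auto simp: S_def)
  have fin: "finite X" "finite S" using X S G finite_subset by blast+
  have gen: "Y = S" if "Y \<subseteq> S" "Y \<noteq> {}" "\<And>y. y \<in> Y \<Longrightarrow> y + r \<in> Y" for Y
    using sum_closed_eq_group[OF S(1) fin(2), of "{r}" Y] span_group(3)[of _ "{r}"] that S
    by (auto simp: S_def set_plus_def)
  have closed: "x + s \<in> X" if C: "x \<in> X" "s \<in> S" "\<And>y. y \<in> X \<Longrightarrow> y - x \<in> S \<Longrightarrow> y + r \<in> X" for x s
  proof -
    define Y where "Y = {s \<in> S. x + s \<in> X}"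
    have "0 \<in> Y" using C is_subgroupD[OF S(1)] by (simp add: Y_def)
    moreover have "y + r \<in> Y" if "y \<in> Y" for y
      using that C(3)[of "x + y"] is_subgroupD(4)[OF S(1), of y r] S(2)
        by (auto simp: Y_def add.assoc)
    ultimately have "Y = S" by (intro gen) (auto simp: Y_def)
    then show ?thesis using C(2) by (auto simp: Y_def)
  qed
  have "card {0, r} \<le> card S" using S is_subgroupD[OF S(1)] fin by (intro card_mono) auto
  then have cS: "2 \<le> card S" using r by simp
  have self: "X \<subseteq> X + S" using subset_sum_zero is_subgroupD[OF S(1)] by blast
  show ?thesis
  proof (cases "\<forall>x\<in>X. x + r \<in> X")
    case True
    have XS: "X + S = X" using closed True self by (auto simp: set_plus_def)
    have "S \<noteq> G"
    proof
      assume "S = G"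
      obtain x where x: "x \<in> X" using X by blast
      have "y \<in> X" if "y \<in> G" for y
      proof -
        have "y - x \<in> S" using that x X g \<open>S = G\<close> by blast
        then have "x + (y - x) \<in> X + S" using x by blast
        then show ?thesis by (simp add: XS)
      qed
      then show False using X by blast
    qed
    then show ?thesis using XS S cS by (intro disjI2 exI[of _ S]) auto
  next
    case False
    then obtain x1 where x1: "x1 \<in> X" "x1 + r \<notin> X" by blast
    have step: "x + r \<in> X" if "x \<in> X" "x \<noteq> x1" for x
    proof (rule ccontr)
      assume "x + r \<notin> X"
      then have "insert (x + r) (insert (x1 + r) X) \<subseteq> X + {0, r}"
        using that x1 by (force simp: set_plus_def)
      moreover have "finite (X + {0, r})" using fin by (simp add: finite_set_plus)
      ultimately have "card (insert (x + r) (insert (x1 + r) X)) \<le> card X + 1"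
        using two card_mono by (metis order_trans)
      moreover have "card (insert (x + r) (insert (x1 + r) X)) = card X + 2"
        using fin x1 \<open>x + r \<notin> X\<close> that by simp
      ultimately show False by simp
    qed
    show ?thesis
    proof (cases "S = G")
      case True
      have e: "x1 + s \<in> (\<lambda>i. ((+) (- r) ^^ i) x1) ` UNIV" if "s \<in> S" for s
      proof -
        define Y where "Y = {s \<in> S. \<exists>i. x1 + s = ((+) (- r) ^^ i) x1}"
        have sr: "is_subgroup H \<Longrightarrow> {- r} \<subseteq> H \<Longrightarrow> S \<subseteq> H" for H
          using span_group(3)[of H "{r}"] is_subgroupD(3)[of H "- r"] by (auto simp: S_def)
        have "\<exists>i. x1 + 0 = ((+) (- r) ^^ i) x1" by (intro exI[of _ 0]) simp
        then have "0 \<in> Y" using is_subgroupD[OF S(1)] by (auto simp: Y_def)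
        moreover have "y + - r \<in> Y" if "y \<in> Y" for y
        proof -
          obtain i where i: "x1 + y = ((+) (- r) ^^ i) x1" using \<open>y \<in> Y\<close> by (auto simp: Y_def)
          have "x1 + (y + - r) = ((+) (- r) ^^ Suc i) x1" using i by (simp add: algebra_simps)
          moreover have "y + - r \<in> S"
            using that is_subgroupD(2)[OF S(1), of y r] S(2) by (simp add: Y_def)
          ultimately show ?thesis unfolding Y_def by blast
        qed
        then have "Y + {- r} \<subseteq> Y" by (auto simp: set_plus_def)
        moreover have "Y \<subseteq> S" by (auto simp: Y_def)
        moreover have "{- r} \<subseteq> S" using is_subgroupD(3)[OF S(1) S(2)] by simp
        ultimately have "Y = S"
          using sum_closed_eq_group[OF S(1) fin(2), of "{- r}" Y] sr by blast
        then show ?thesis using that by (auto simp: Y_def)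
      qed
      define b where "b i = ((+) (- r) ^^ i) x1" for i
      have bS: "b (Suc i) = b i - r" for i by (simp add: b_def)
      have cover: "G \<subseteq> range b"
      proof
        fix y assume "y \<in> G"
        then have "y - x1 \<in> S" using x1 X g True by blast
        from e[OF this] show "y \<in> range b" by (auto simp: b_def)
      qed
      have "\<exists>i. b i \<notin> X" using cover X by blast
      define i where "i = (LEAST i. b i \<notin> X)"
      have i: "b i \<notin> X" "\<And>j. j < i \<Longrightarrow> b j \<in> X"
        using LeastI_ex[OF \<open>\<exists>i. b i \<notin> X\<close>] not_less_Least by (auto simp: i_def)
      have "b 0 = x1" by (simp add: b_def)
      \<comment> \<open>The chain runs backwards from \<open>x1\<close> and first leaves X at index
        \<open>i\<close>. The points of X off the chain would be closed under adding r, hence would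
        fill all of G.\<close>
      have "X - b ` {..<i} = {}"
      proof (rule ccontr)
        define Y where "Y = X - b ` {..<i}"
        assume "X - b ` {..<i} \<noteq> {}"
        then obtain y where y: "y \<in> Y" by (auto simp: Y_def)
        have i0: "0 < i" using i(1) x1 \<open>b 0 = x1\<close> by (metis gr0I)
        have cl: "z + r \<in> Y" if "z \<in> Y" for z
        proof -
          have "z \<noteq> x1" using that \<open>b 0 = x1\<close> i0 by (auto simp: Y_def)
          then have "z + r \<in> X" using that step by (auto simp: Y_def)
          moreover have "z + r \<noteq> b j" if "j < i" for j
          proof
            assume "z + r = b j"
            then have z: "z = b (Suc j)" by (simp add: bS algebra_simps)
            show False
            proof (cases "Suc j < i")
              case True then show ?thesis using z \<open>z \<in> Y\<close> by (auto simp: Y_def)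
            next
              case False
              then have "Suc j = i" using that by simp
              then show ?thesis using z i(1) \<open>z \<in> Y\<close> by (auto simp: Y_def)
            qed
          qed
          ultimately show ?thesis by (auto simp: Y_def)
        qed
        have "(+) (- y) ` Y = S"
        proof (rule gen)
          show "(+) (- y) ` Y \<subseteq> S"
            using y X g True by (auto simp: Y_def subset_iff)
          show "(+) (- y) ` Y \<noteq> {}" using y by auto
          show "u + r \<in> (+) (- y) ` Y" if "u \<in> (+) (- y) ` Y" for u
            using that cl by (auto simp: add.assoc intro!: imageI)
        qed
        then have "card Y = card G" using card_translate[of "- y" Y] True by simp
        moreover have "card Y \<le> card X" using fin by (auto simp: Y_def intro: card_mono)
        moreover have "card X < card G" using X G by (intro psubset_card_mono) auto
        ultimately show False by simp
      qed
      then have Xb: "X = b ` {..<i}" using i(2) by auto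
      \<comment> \<open>A repetition would make the sequence periodic from there on, so
        \<open>b i\<close> would equal an earlier term and lie in X.\<close>
      have "inj_on b {..<i}"
      proof (rule inj_onI, rule ccontr)
        fix p q assume pq: "p \<in> {..<i}" "q \<in> {..<i}" "b p = b q" "p \<noteq> q"
        have *: False if "p < q" "q < i" "b p = b q" for p q
        proof -
          have "b (p + l) = b (q + l)" for l by (induction l) (use that bS in auto)
          from this[of "i - q"] have "b (p + (i - q)) = b i" using that by simp
          moreover have "p + (i - q) < i" using that by linarith
          ultimately show False using i(1) i(2)[of "p + (i - q)"] by simp
        qed
        show False using *[of p q] *[of q p] pq by force
      qed
      then have "card X = i" using Xb by (simp add: card_image)
      then show ?thesis using Xb by (auto simp: b_def)
    next
      case False
      have "X + S \<subseteq> X \<union> (+) x1 ` S"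
      proof
        fix z assume "z \<in> X + S"
        then obtain x s where z: "z = x + s" "x \<in> X" "s \<in> S" by (auto simp: set_plus_def)
        show "z \<in> X \<union> (+) x1 ` S"
        proof (cases "x - x1 \<in> S")
          case True
          have "z = x1 + ((x - x1) + s)" using z by simp
          then show ?thesis using is_subgroupD(4)[OF S(1) True z(3)] by blast
        next
          case False
          have "x + s \<in> X"
          proof (rule closed[OF z(2,3)])
            fix y assume y: "y \<in> X" "y - x \<in> S"
            have "y \<noteq> x1" using False y is_subgroupD(3)[OF S(1), of "y - x"] by auto
            then show "y + r \<in> X" using step y by blast
          qed
          then show ?thesis using z by simp
        qed
      qed
      then have "card (X + S) \<le> card (X \<union> (+) x1 ` S)" using fin by (intro card_mono) auto
      also have "\<dots> + 1 \<le> card X + card S"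
      proof -
        have "x1 \<in> X \<inter> (+) x1 ` S"
          using x1 is_subgroupD(1)[OF S(1)] by (metis IntI add.right_neutral image_eqI)
        then have "1 \<le> card (X \<inter> (+) x1 ` S)" using fin
          by (metis One_nat_def Suc_leI card_gt_0_iff empty_iff finite_Int)
        then show ?thesis using card_Un_Int[of X "(+) x1 ` S"] fin by (simp add: card_translate)
      qed
      finally have "card (X + S) + 1 \<le> card X + card S" by simp
      then show ?thesis using S cS False by blast
    qed
  qed
qed

text \<open>Inclusion-exclusion for three of the translates that make up M + X. For an atom with at
  least three elements it yields |M| < |X|, which lets the induction descend from \<open>X\<close>
  to \<open>M\<close>.\<close>

lemma card_three_translates:
  fixes M X :: "'a::ab_group_add set"
  assumes fin: "finite M" "finite X" and X: "3 \<le> card X"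
    and meet: "\<And>x y. x \<in> X \<Longrightarrow> y \<in> X \<Longrightarrow> x \<noteq> y \<Longrightarrow> card ((+) x ` M \<inter> (+) y ` M) \<le> 1"
  shows "3 * card M \<le> card (M + X) + 3"
proof -
  obtain Y where Y: "Y \<subseteq> X" "card Y = 3" using X obtain_subset_with_card_n by metis
  then obtain x y z where xyz: "x \<in> X" "y \<in> X" "z \<in> X" "x \<noteq> y" "y \<noteq> z" "x \<noteq> z"
    by (auto simp: card_3_iff)
  let ?A = "(+) x ` M" and ?B = "(+) y ` M" and ?C = "(+) z ` M"
  have f: "finite ?A" "finite ?B" "finite ?C" using fin by auto
  have "?A \<union> ?B \<union> ?C \<subseteq> M + X"
    using xyz by (auto simp: set_plus_def) (metis add.commute)+
  then have le: "card (?A \<union> ?B \<union> ?C) \<le> card (M + X)"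
    using fin by (intro card_mono finite_set_plus)
  have "card (?A \<union> ?B) + 1 \<ge> 2 * card M"
    using card_Un_Int[OF f(1,2)] meet[OF xyz(1,2,4)] by (simp add: card_translate)
  moreover have "card ((?A \<union> ?B) \<inter> ?C) \<le> card (?A \<inter> ?C) + card (?B \<inter> ?C)"
    by (simp add: Int_Un_distrib2 card_Un_le)
  then have "card ((?A \<union> ?B) \<inter> ?C) \<le> 2"
    using meet[OF xyz(1,3,6)] meet[OF xyz(2,3,5)] by linarith
  ultimately have "card (?A \<union> ?B \<union> ?C) + 3 \<ge> 3 * card M"
    using card_Un_Int[of "?A \<union> ?B" ?C] f by (simp add: card_translate)
  then show ?thesis using le by linarith
qed

text \<open>A finite-group form of Vosper's theorem, proved by Hamidoune's isoperimetric argument: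
  a minimal set \<^term>\<open>M\<close> minimising \<^term>\<open>card (M + X) - card M\<close> meets its translates in at most
  one point unless it is a subgroup, and a set of this kind with at least three elements would,
  by induction, itself be critical.\<close>

theorem critical_set_structure:
  fixes G X F :: "'a::ab_group_add set"
  assumes "is_subgroup G" "finite G" "X \<subseteq> G" "0 \<in> X"
    and "\<And>H. is_subgroup H \<Longrightarrow> X \<subseteq> H \<Longrightarrow> G \<subseteq> H"
    and "F \<subseteq> G" "2 \<le> card F" "card (F + X) + 2 \<le> card G" "card (F + X) + 1 \<le> card F + card X"
  shows "(\<exists>a d. X = (\<lambda>i. ((+) d ^^ i) a) ` {..<card X}) \<or>
    (\<exists>H. is_subgroup H \<and> H \<subseteq> G \<and> 2 \<le> card H \<and> H \<noteq> G \<and> card (X + H) + 1 \<le> card X + card H)"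
  using assms
proof (induction "card X" arbitrary: G X F rule: less_induct)
  case less
  obtain M where "two_atom G X M" using two_atom_exists[OF less.prems] .
  then interpret two_atom G X M .
  note g = is_subgroupD[OF G(1)]
  have fX: "finite X" and fM: "finite M" using fin X M by blast+
  have MX_sub: "X \<subseteq> M + X" using subset_sum_zero[OF M(2), of X] by (simp add: add.commute)
  have XneG: "X \<noteq> G"
    using MX_sub M(4) card_mono[of "M + X" X] finite_subset[OF sums[OF M(1) X(1)] G(2)] by auto
  have card_X: "card X < card G" using X XneG G by (intro psubset_card_mono) auto
  have MneG: "M \<noteq> G"
  proof
    assume "M = G"
    then have "card G \<le> card (M + X)"
      using subset_sum_zero[OF X(2), of M] finite_subset[OF sums[OF M(1) X(1)] G(2)]
      by (metis card_mono)
    then show False using M(4) by simp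
  qed
  show ?case
  proof (cases "\<exists>g\<in>G. g \<noteq> 0 \<and> (+) g ` M = M")
    case True
    then have "is_subgroup M" using subgroup_if_periodic by blast
    moreover have "card (X + M) + 1 \<le> card X + card M" using small by (simp add: add.commute)
    ultimately show ?thesis using M MneG by blast
  next
    case False
    have meet: "card (M \<inter> (+) g ` M) \<le> 1" if "g \<in> G" "g \<noteq> 0" for g
      using translate_meets[OF that(1)] that False by force
    show ?thesis
    proof (cases "card M = 2")
      case True
      then obtain r where r: "M = {0, r}" "r \<noteq> 0"
        using M(2) by (auto simp: card_2_iff)
      have "card (X + {0, r}) \<le> card X + 1" using small True r by (simp add: add.commute)
      then show ?thesis using almost_periodic[OF G X(1) _ XneG, of r] X(2) r M(1) by blast
    next
      case False
      then have M3: "3 \<le> card M" using M(3) by simp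
      show ?thesis
      proof (cases "card X \<le> 2")
        case True
        have "card X \<noteq> 0" using X fX by auto
        show ?thesis
        proof (cases "card X = 1")
          case True
          then obtain x where "X = {x}" by (auto simp: card_1_singleton_iff)
          then have "X = (\<lambda>i. ((+) 0 ^^ i) x) ` {..<card X}" by (simp add: lessThan_Suc)
          then show ?thesis by blast
        next
          case False
          then have "card X = 2" using \<open>card X \<noteq> 0\<close> True by simp
          then obtain x y where xy: "X = {x, y}" "x \<noteq> y" by (auto simp: card_2_iff)
          then have "X = (\<lambda>i. ((+) (y - x) ^^ i) x) ` {..<card X}"
            by (auto simp: lessThan_Suc numeral_2_eq_2)
          then show ?thesis by blast
        qed
      next
        case False
        have "card ((+) x ` M \<inter> (+) y ` M) \<le> 1" if "x \<in> X" "y \<in> X" "x \<noteq> y" for x y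
        proof -
          have "(+) x ` M \<inter> (+) y ` M = (+) x ` (M \<inter> (+) (y - x) ` M)"
            by (subst image_Int) (auto simp: inj_on_def translate_translate simp del: add_uminus_conv_diff)
          moreover have "card (M \<inter> (+) (y - x) ` M) \<le> 1" using that X g(2)[of y x]
            by (intro meet) auto
          ultimately show ?thesis by (simp add: card_translate)
        qed
        then have "3 * card M \<le> card (M + X) + 3"
          using False by (intro card_three_translates fM fX) auto
        then have MltX: "card M < card X" using small M3 by linarith
        define S where "S = span_group M"
        have S: "is_subgroup S" "M \<subseteq> S" "S \<subseteq> G"
          and Sgen: "\<And>H. is_subgroup H \<Longrightarrow> M \<subseteq> H \<Longrightarrow> S \<subseteq> H"
          using span_group(1,2)[of M] span_group(3)[OF G(1) M(1)] span_group(3)[of _ M]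
          by (simp_all add: S_def)
        have fS: "finite S" using S fin by blast
        define Cs where "Cs = (\<lambda>x. (+) x ` S) ` X"
        note cd = coset_decomposition[OF S(1) fS fX S(2) M(2), folded Cs_def]
        \<comment> \<open>\<open>M\<close> is not critical inside its span \<open>S\<close>: by
          induction it would be a progression or nearly periodic there, and either way
          \<open>M\<close> shares two points with a nonzero translate of itself.\<close>
        have no_F: False
          if F: "F \<subseteq> S" "2 \<le> card F" "card (F + M) + 2 \<le> card S"
              "card (F + M) + 1 \<le> card F + card M" for F
        proof -
          from less.hyps[OF MltX S(1) fS S(2) M(2) Sgen F]
          consider a d where "M = (\<lambda>i. ((+) d ^^ i) a) ` {..<card M}"
            | H where "is_subgroup H" "H \<subseteq> S" "2 \<le> card H" "H \<noteq> S"
                "card (M + H) + 1 \<le> card M + card H"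
            by blast
          then show False
          proof cases
            case 1
            have mem: "((+) d ^^ i) a \<in> M" if "i < card M" for i using that by (subst 1) auto
            have m3: "a \<in> M" "d + a \<in> M" "d + (d + a) \<in> M"
              using mem[of 0] mem[of 1] mem[of 2] M3 by (auto simp: numeral_2_eq_2)
            have d0: "d \<noteq> 0"
            proof
              assume "d = 0"
              have "((+) d ^^ i) a = a" for i by (induction i) (auto simp: \<open>d = 0\<close>)
              then have "M \<subseteq> {a}" by (subst 1) auto
              then have "card M \<le> 1" using card_mono[of "{a}" M] by simp
              then show False using M3 by simp
            qed
            have "d \<in> G" using g(2)[of "d + a" a] m3 M by auto
            have "{d + a, d + (d + a)} \<subseteq> M \<inter> (+) d ` M" using m3 by auto
            moreover have "card {d + a, d + (d + a)} = 2" using d0 by simp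
            ultimately have "2 \<le> card (M \<inter> (+) d ` M)"
              using fM by (metis card_mono finite_Int)
            then show False using meet[OF \<open>d \<in> G\<close> d0] by simp
          next
            case 2
            have "\<not> M \<subseteq> H" using Sgen 2 by blast
            then obtain m where m: "m \<in> M" "m \<notin> H" by blast
            have "H \<inter> (+) m ` H = {}"
            proof (rule ccontr)
              assume "H \<inter> (+) m ` H \<noteq> {}"
              then obtain h h' where "h \<in> H" "h' \<in> H" "h = m + h'" by auto
              then have "h - h' = m" by simp
              then show False using is_subgroupD(2)[OF 2(1) \<open>h \<in> H\<close> \<open>h' \<in> H\<close>] m by simp
            qed
            moreover have fH: "finite H" using 2 fS finite_subset by blast
            ultimately have "card (H \<union> (+) m ` H) = 2 * card H"
              using card_Un_disjoint[of H "(+) m ` H"] by (simp add: card_translate)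
            moreover have fMH: "finite (M + H)" using fM fH by (simp add: finite_set_plus)
            moreover have "H \<union> (+) m ` H \<subseteq> M + H"
              using m M(2) by (auto simp: set_plus_def) (metis add.left_neutral)
            ultimately have "2 * card H \<le> card (M + H)" using card_mono by metis
            then have MH: "card H + 1 \<le> card M" using 2(5) by linarith
            obtain h where h: "h \<in> H" "h \<noteq> 0"
            proof -
              have "H \<noteq> {0}" using 2(3) by auto
              then show ?thesis using that is_subgroupD(1)[OF 2(1)] by blast
            qed
            have "M \<union> (+) h ` M \<subseteq> M + H"
              using h is_subgroupD(1)[OF 2(1)]
                by (auto simp: set_plus_def) (metis add.right_neutral, metis add.commute)
            then have "card (M \<union> (+) h ` M) \<le> card (M + H)" using fMH card_mono by blast
            then have "2 \<le> card (M \<inter> (+) h ` M)"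
              using card_Un_Int[of M "(+) h ` M"] fM 2(5) MH by (simp add: card_translate)
            moreover have "h \<in> G" using h 2 S by blast
            ultimately show False using meet[of h] h by simp
          qed
        qed
        \<comment> \<open>The growth of one coset slice of X under adding \<open>M\<close>.
          Criticality bounds the total growth by |M| - 1.\<close>
        define D where "D C = card ((X \<inter> C) + M) - card (X \<inter> C)" for C
        have fXC: "finite ((X \<inter> C) + M)" for C using fX fM by (simp add: finite_set_plus)
        have leD: "card (X \<inter> C) \<le> card ((X \<inter> C) + M)" for C
          using subset_sum_zero[OF M(2)] fXC by (intro card_mono) auto
        have cX: "card ((X \<inter> C) + M) = card (X \<inter> C) + D C" for C using leD by (simp add: D_def)
        have sumD: "(\<Sum>C\<in>Cs. D C) + 1 \<le> card M"
        proof -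
          have "card (X + M) = card X + (\<Sum>C\<in>Cs. D C)"
            unfolding cd(2,3) cX by (simp add: sum.distrib)
          then show ?thesis using small by (simp add: add.commute)
        qed
        have D_le: "D C + 1 \<le> card M" if "C \<in> Cs" for C
          using member_le_sum[OF that, of D] cd(1) sumD by simp
        have inC: "\<exists>x\<in>X \<inter> C. C = (+) x ` S" if "C \<in> Cs" for C
          using that is_subgroupD(1)[OF S(1)] by (auto simp: Cs_def)
        have card_C: "card C = card S" if "C \<in> Cs" for C using that
          by (auto simp: Cs_def card_translate)
        have shift: "\<exists>F. F \<subseteq> S \<and> card F = card (X \<inter> C) \<and> card (F + M) = card ((X \<inter> C) + M) \<and> F \<noteq> {}"
          if C: "C \<in> Cs" for C
        proof -
          obtain x where x: "x \<in> X \<inter> C" "C = (+) x ` S" using inC[OF C] by blast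
          have "(+) (- x) ` (X \<inter> C) \<subseteq> S" using x by auto
          then show ?thesis using x
            by (intro exI[of _ "(+) (- x) ` (X \<inter> C)"])
              (auto simp only: card_translate translate_sum image_is_empty)
        qed
        have full: "card (X \<inter> C) = card S" if C: "C \<in> Cs" "D C = 0" for C
        proof -
          obtain F where F: "F \<subseteq> S" "card F = card (X \<inter> C)" "card (F + M) = card ((X \<inter> C) + M)"
              "F \<noteq> {}"
            using shift[OF C(1)] by blast
          have "F \<subseteq> F + M" using subset_sum_zero[OF M(2)] .
          moreover have "finite F" using F(1) fS by (rule finite_subset)
          then have "finite (F + M)" using fM by (rule finite_set_plus)
          moreover have "card F = card (F + M)" using F(2,3) cX[of C] C(2) by simp
          ultimately have "F = F + M" by (intro card_subset_eq)
          then have "F = S" using sum_closed_eq_group[OF S(1) fS S(2) Sgen F(1) F(4)] by blast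
          then show ?thesis using F by simp
        qed
        have leS: "card (X \<inter> C) \<le> card S" if "C \<in> Cs" for C
          using card_C[OF that] card_mono[of C "X \<inter> C"] that fS by (auto simp: Cs_def)
        have CX: "card (X + S) = card Cs * card S"
        proof -
          note cd' = coset_decomposition[OF S(1) fS fX order.refl is_subgroupD(1)[OF S(1)], folded Cs_def]
          have "card ((X \<inter> C) + S) = card S" if C: "C \<in> Cs" for C
          proof -
            obtain x where x: "x \<in> X \<inter> C" "C = (+) x ` S" using inC[OF C] by blast
            have "(X \<inter> C) + S = C"
            proof
              show "(X \<inter> C) + S \<subseteq> C"
              proof
                fix z assume "z \<in> (X \<inter> C) + S"
                then obtain y s where y: "y \<in> C" "s \<in> S" "z = y + s" by (auto simp: set_plus_def)
                then show "z \<in> C" using cd(4)[OF C, of y] by blast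
              qed
              show "C \<subseteq> (X \<inter> C) + S" using x by (force simp: set_plus_def)
            qed
            then show ?thesis using card_C[OF C] by simp
          qed
          then show ?thesis using cd'(3) by simp
        qed
        have deficit: "card (X + S) + 1 \<le> card X + card S" if d: "(\<Sum>C\<in>Cs. card S - card (X \<inter> C)) + 1 \<le> card S"
        proof -
          have "(\<Sum>C\<in>Cs. card S) = (\<Sum>C\<in>Cs. (card S - card (X \<inter> C)) + card (X \<inter> C))"
            using leS by (intro sum.cong) auto
          also have "\<dots> = (\<Sum>C\<in>Cs. card S - card (X \<inter> C)) + card X" by (simp add: sum.distrib cd(2))
          finally show ?thesis using d CX by simp
        qed
        \<comment> \<open>A slice with two or more points whose sum with \<open>M\<close> missed two
          points of its coset would, moved into \<open>S\<close>, be a set excluded by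
          \<open>no_F\<close>.\<close>
        have alt: "card (X \<inter> C) = 1 \<or> card S \<le> card ((X \<inter> C) + M) + 1" if C: "C \<in> Cs" for C
        proof (rule ccontr)
          assume n: "\<not> ?thesis"
          obtain F where F: "F \<subseteq> S" "card F = card (X \<inter> C)" "card (F + M) = card ((X \<inter> C) + M)"
              "F \<noteq> {}"
            using shift[OF C] by blast
          have "card F \<noteq> 0" using F fS finite_subset card_0_eq by metis
          then show False using no_F[of F] F n D_le[OF C] cX[of C] by simp
        qed
        have "S \<noteq> G"
        proof
          assume "S = G"
          have "2 \<le> card X" using \<open>\<not> card X \<le> 2\<close> by simp
          then show False using no_F[of X] X M(4) small \<open>S = G\<close> by (simp add: add.commute)
        qed
        \<comment> \<open>The aim is that X lacks fewer than |S| points of its S-cosets; then S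
          itself is the subgroup sought.\<close>
        have "(\<Sum>C\<in>Cs. card S - card (X \<inter> C)) + 1 \<le> card S"
        proof (cases "\<exists>C\<in>Cs. card (X \<inter> C) = 1")
          case True
          then obtain C0 where C0: "C0 \<in> Cs" "card (X \<inter> C0) = 1" by blast
          then obtain x where x: "X \<inter> C0 = {x}" by (auto simp: card_1_singleton_iff)
          have "(X \<inter> C0) + M = (+) x ` M" unfolding x by (auto simp: set_plus_def)
          then have "D C0 + 1 = card M" using cX[of C0] C0 by (simp add: card_translate)
          \<comment> \<open>A one-point slice already grows by |M| - 1 and uses up the whole budget,
            so every other coset is full.\<close>
          then have "(\<Sum>C\<in>Cs - {C0}. D C) = 0" using sumD sum.remove[OF cd(1) C0(1), of D] by simp
          then have "D C = 0" if "C \<in> Cs - {C0}" for C using that cd(1) by simp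
          then have "(\<Sum>C\<in>Cs - {C0}. card S - card (X \<inter> C)) = 0" using full by simp
          moreover have "1 \<le> card S" using leS[OF C0(1)] C0 by simp
          ultimately show ?thesis
            using sum.remove[OF cd(1) C0(1), of "\<lambda>C. card S - card (X \<inter> C)"] C0 by simp
        next
          case False
          \<comment> \<open>By \<open>alt\<close> a slice that grows lacks at most D C + 1 points of
            its coset, and this is at most 2 D C because D C is positive.\<close>
          have "card S - card (X \<inter> C) \<le> 2 * D C" if C: "C \<in> Cs" for C
          proof (cases "D C = 0")
            case True then show ?thesis using full[OF C] by simp
          next
            case f: False
            then show ?thesis using alt[OF C] False C cX[of C] by auto
          qed
          then have "(\<Sum>C\<in>Cs. card S - card (X \<inter> C)) \<le> (\<Sum>C\<in>Cs. 2 * D C)" by (rule sum_mono)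
          also have "\<dots> = 2 * (\<Sum>C\<in>Cs. D C)" by (simp add: sum_distrib_left)
          finally have 1: "(\<Sum>C\<in>Cs. card S - card (X \<inter> C)) + 2 \<le> 2 * card M" using sumD by linarith
          \<comment> \<open>Inside \<open>S\<close> the set \<open>M\<close> and a translate of it
            overlap in at most one point, so 2|M| - 1 \<le> |S|. This absorbs the total deficit,
            which is at most 2(|M| - 1).\<close>
          have "M \<noteq> {0}" using M3 by auto
          then obtain m where m: "m \<in> M" "m \<noteq> 0" using M(2) by blast
          have "M \<union> (+) m ` M \<subseteq> S" using m S is_subgroupD(4)[OF S(1)] by blast
          then have "card (M \<union> (+) m ` M) \<le> card S" using fS card_mono by blast
          moreover have "card (M \<inter> (+) m ` M) \<le> 1" using meet m M by blast
          ultimately have "2 * card M \<le> card S + 1"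
            using card_Un_Int[of M "(+) m ` M"] fM by (simp add: card_translate)
          then show ?thesis using 1 by linarith
        qed
        from deficit[OF this] show ?thesis
        proof -
          have "2 \<le> card S" using card_mono[OF fS S(2)] M(3) by simp
          then show ?thesis using \<open>card (X + S) + 1 \<le> card X + card S\<close> S \<open>S \<noteq> G\<close> by blast
        qed
      qed
    qed
  qed
qed

section \<open>Residues of integer sets\<close>

text \<open>The group of rationals modulo 1 contains every \<open>\<int>/N\<int>\<close>, the subgroup generated by \<open>1/N\<close>.\<close>

typedef circle = "{x::rat. 0 \<le> x \<and> x < 1}"
  by (intro exI[of _ 0]) auto

setup_lifting type_definition_circle

lemma frac_frac_add: "frac (frac x + y) = frac (x + y)" "frac (y + frac x) = frac (y + x)"
  "frac (y - frac x) = frac (y - x)" "frac (frac x - y) = frac (x - y)"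
      "frac (- frac x) = frac (- x)"
  for x y :: rat
proof -
  have *: "frac (z + of_int m) = frac z" for z :: rat and m by (simp add: frac_def)
  have e: "frac x = x - of_int \<lfloor>x\<rfloor>" by (simp add: frac_def)
  show "frac (frac x + y) = frac (x + y)" using *[of "x + y" "- \<lfloor>x\<rfloor>"] by (simp add: e algebra_simps)
  show "frac (y + frac x) = frac (y + x)" using *[of "x + y" "- \<lfloor>x\<rfloor>"] by (simp add: e algebra_simps)
  show "frac (y - frac x) = frac (y - x)" using *[of "y - x" "\<lfloor>x\<rfloor>"] by (simp add: e algebra_simps)
  show "frac (frac x - y) = frac (x - y)" using *[of "x - y" "- \<lfloor>x\<rfloor>"] by (simp add: e algebra_simps)
  show "frac (- frac x) = frac (- x)" using *[of "- x" "\<lfloor>x\<rfloor>"] by (simp add: e algebra_simps)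
qed

instantiation circle :: ab_group_add
begin

lift_definition zero_circle :: circle is 0 by simp
lift_definition plus_circle :: "circle \<Rightarrow> circle \<Rightarrow> circle" is "\<lambda>x y. frac (x + y)"
  by (simp add: frac_lt_1)
lift_definition uminus_circle :: "circle \<Rightarrow> circle" is "\<lambda>x. frac (- x)"
  by (simp add: frac_lt_1)
lift_definition minus_circle :: "circle \<Rightarrow> circle \<Rightarrow> circle" is "\<lambda>x y. frac (x - y)"
  by (simp add: frac_lt_1)

instance
  by standard (transfer; simp add: frac_frac_add frac_eq algebra_simps)+

end

lift_definition to_circle :: "int \<Rightarrow> int \<Rightarrow> circle" is "\<lambda>N x. frac (of_int x / of_int N)"
  by (simp add: frac_lt_1)

lemma to_circle_add: "to_circle N (x + y) = to_circle N x + to_circle N y"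
  by transfer (simp add: frac_frac_add add_divide_distrib)

lemma to_circle_diff: "to_circle N (x - y) = to_circle N x - to_circle N y"
  by transfer (simp add: frac_frac_add diff_divide_distrib)

lemma to_circle_eq_0_iff:
  assumes "0 < N"
  shows "to_circle N x = 0 \<longleftrightarrow> N dvd x"
proof -
  have "frac (of_int x / of_int N :: rat) = 0 \<longleftrightarrow> (of_int x / of_int N :: rat) \<in> \<int>"
    by simp
  also have "\<dots> \<longleftrightarrow> N dvd x"
  proof
    assume "(of_int x / of_int N :: rat) \<in> \<int>"
    then obtain m where "(of_int x / of_int N :: rat) = of_int m" by (auto elim: Ints_cases)
    then have "(of_int x :: rat) = of_int (m * N)" using assms by (simp add: field_simps)
    then have "x = m * N" by (simp only: of_int_eq_iff)
    then show "N dvd x" by simp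
  next
    assume "N dvd x"
    then show "(of_int x / of_int N :: rat) \<in> \<int>" using assms by (auto elim!: dvdE)
  qed
  finally show ?thesis by transfer
qed

lemma to_circle_eq_iff:
  assumes "0 < N"
  shows "to_circle N x = to_circle N y \<longleftrightarrow> N dvd x - y"
  using to_circle_eq_0_iff[OF assms, of "x - y"] by (simp add: to_circle_diff)

lemma to_circle_0 [simp]: "to_circle N 0 = 0"
  using to_circle_diff[of N 0 0] by simp

lemma to_circle_funpow: "((+) (to_circle N d) ^^ i) (to_circle N a) = to_circle N (a + int i * d)"
  by (induction i) (simp_all add: to_circle_add[symmetric] algebra_simps)

lemma to_circle_sum: "to_circle N ` (A + B) = to_circle N ` A + to_circle N ` B"
  by (force simp: set_plus_def to_circle_add image_iff)

lemma int_subgroup_cyclic: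
  assumes D: "is_subgroup D" and N: "(N::int) \<in> D" "0 < N"
  obtains h where "0 < h" "h dvd N" "\<And>x. x \<in> D \<longleftrightarrow> h dvd x"
proof -
  note d = is_subgroupD[OF D]
  define P where "P m \<longleftrightarrow> 0 < m \<and> int m \<in> D" for m
  have PN: "P (nat N)" using N by (simp add: P_def)
  define m where "m = (LEAST m. P m)"
  have m: "0 < m" "int m \<in> D" using LeastI[of P, OF PN] by (auto simp: P_def m_def)
  have mult: "int j * int m \<in> D" for j
    by (induction j) (use d m in \<open>auto simp: distrib_right\<close>)
  have mult': "j * int m \<in> D" for j
    using mult[of "nat j"] mult[of "nat (- j)"] d(3)[of "- j * int m"] by (cases "0 \<le> j") auto
  have "x \<in> D \<longleftrightarrow> int m dvd x" for x
  proof
    assume x: "x \<in> D"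
    have "x mod int m = x - (x div int m) * int m" by (simp add: minus_div_mult_eq_mod)
    then have r: "x mod int m \<in> D" using d(2)[OF x mult'] by metis
    have "\<not> P (nat (x mod int m))"
    proof
      assume "P (nat (x mod int m))"
      then have "m \<le> nat (x mod int m)" unfolding m_def by (rule Least_le)
      then show False using pos_mod_bound[of "int m" x] m by linarith
    qed
    moreover have "0 \<le> x mod int m" using m by simp
    ultimately have "x mod int m = 0" using r by (auto simp: P_def)
    then show "int m dvd x" by presburger
  next
    assume "int m dvd x"
    then show "x \<in> D" using mult' by (metis dvd_def mult.commute)
  qed
  then show ?thesis using that[of "int m"] m N by auto
qed

section \<open>Residues of integer sets as subsets of the circle group\<close>

definition residues :: "int \<Rightarrow> int set \<Rightarrow> int set" where
  "residues N A = (\<lambda>a. a mod N) ` A"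

lemma to_circle_mod: "0 < N \<Longrightarrow> to_circle N (x mod N) = to_circle N x"
  by (simp add: to_circle_eq_iff mod_eq_dvd_iff[symmetric])

lemma inj_to_circle: "0 < N \<Longrightarrow> inj_on (to_circle N) {0..<N}"
proof (rule inj_onI)
  fix x y assume N: "0 < N" and xy: "x \<in> {0..<N}" "y \<in> {0..<N}" "to_circle N x = to_circle N y"
  then have "x mod N = y mod N" by (simp only: to_circle_eq_iff mod_eq_dvd_iff)
  then show "x = y" using xy(1,2) by (metis atLeastLessThan_iff mod_pos_pos_trivial)
qed

lemma residues_subset: "0 < N \<Longrightarrow> residues N A \<subseteq> {0..<N}"
  by (auto simp: residues_def)

lemma to_circle_res: "0 < N \<Longrightarrow> to_circle N ` residues N A = to_circle N ` A"
  by (simp add: residues_def image_image to_circle_mod)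

lemma card_to_circle: "0 < N \<Longrightarrow> card (to_circle N ` A) = card (residues N A)"
  using card_image[OF inj_on_subset[OF inj_to_circle residues_subset]] by (metis to_circle_res)

lemma card_residue_classes:
  fixes h N :: int
  assumes h: "0 < h" "h dvd N" "0 < N" and T: "T \<subseteq> {0..<h}"
  shows "int (card {x \<in> {0..<N}. x mod h \<in> T}) = int (card T) * (N div h)"
proof -
  have "bij_betw (\<lambda>(c, j). c + h * j) (T \<times> {0..<N div h}) {x \<in> {0..<N}. x mod h \<in> T}"
  proof (rule bij_betw_byWitness[where f' = "\<lambda>x. (x mod h, x div h)"])
    have cj: "(c + h * j) mod h = c" "(c + h * j) div h = j" "0 \<le> c" "c < h" if "c \<in> T" for c j
      using that T h by (auto simp: subset_iff)
    show "\<forall>a\<in>T \<times> {0..<N div h}. (\<lambda>x. (x mod h, x div h)) ((\<lambda>(c, j). c + h * j) a) = a"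
      using cj by auto
    show "\<forall>a'\<in>{x \<in> {0..<N}. x mod h \<in> T}. (\<lambda>(c, j). c + h * j) (a' mod h, a' div h) = a'"
      by auto
    show "(\<lambda>(c, j). c + h * j) ` (T \<times> {0..<N div h}) \<subseteq> {x \<in> {0..<N}. x mod h \<in> T}"
    proof
      fix x assume "x \<in> (\<lambda>(c, j). c + h * j) ` (T \<times> {0..<N div h})"
      then obtain c j where x: "x = c + h * j" "c \<in> T" "0 \<le> j" "j < N div h" by auto
      have "h * (j + 1) \<le> h * (N div h)" using x h by (intro mult_left_mono) auto
      then have "x < N" using x cj(4)[OF x(2)] h by (simp add: algebra_simps)
      then show "x \<in> {x \<in> {0..<N}. x mod h \<in> T}" using x cj h by auto
    qed
    show "(\<lambda>x. (x mod h, x div h)) ` {x \<in> {0..<N}. x mod h \<in> T} \<subseteq> T \<times> {0..<N div h}"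
    proof -
      have "x div h < N div h" if "x < N" for x
      proof -
        have "h * (x div h) \<le> x" using mult_div_mod_eq[of h x] pos_mod_sign[OF h(1), of x]
          by linarith
        then have "h * (x div h) < h * (N div h)" using that h by simp
        then show ?thesis using mult_less_cancel_left_pos[OF h(1)] by blast
      qed
      then show ?thesis using h by (auto simp: pos_imp_zdiv_nonneg_iff)
    qed
  qed
  from bij_betw_same_card[OF this]
  have "card {x \<in> {0..<N}. x mod h \<in> T} = card (T \<times> {0..<N div h})" by (rule sym)
  then show ?thesis using h by (simp add: card_cartesian_product pos_imp_zdiv_nonneg_iff)
qed

text \<open>\<open>critical_set_structure\<close> with the set of residues in both roles. The
  hypothesis \<open>Gcd A = 1\<close> says that the residues generate the whole group. A proper
  subgroup of order N/h is the set of multiples of h, so near periodicity becomes a count of classes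
  modulo h.\<close>

lemma residue_critical:
  fixes A :: "int set" and N :: int
  assumes A: "finite A" "0 \<in> A" "Gcd A = 1" and N: "0 < N" and two: "2 \<le> card (residues N A)"
    and c1: "int (card (residues N (A + A))) + 2 \<le> N"
    and c2: "card (residues N (A + A)) + 1 \<le> 2 * card (residues N A)"
  obtains (ap) d i0 where "coprime d N" "i0 < card (residues N A)"
      "residues N A = (\<lambda>j. j * d mod N) ` {- int i0..int (card (residues N A)) - 1 - int i0}"
    | (sub) h where "h dvd N" "1 < h" "h < N"
      "int (card (residues h A)) * (N div h) + 1 \<le> int (card (residues N A)) + N div h"
proof -
  let ?\<phi> = "to_circle N"
  define G where "G = range ?\<phi>"
  define X where "X = ?\<phi> ` A"
  have G0: "G = ?\<phi> ` {0..<N}"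
  proof -
    have "?\<phi> x \<in> ?\<phi> ` {0..<N}" for x
      using N by (intro image_eqI[of _ _ "x mod N"]) (auto simp: to_circle_mod)
    then show ?thesis by (auto simp: G_def)
  qed
  have "0 \<in> G" unfolding G_def using to_circle_0[of N] by (metis rangeI)
  moreover have "x - y \<in> G" if xy: "x \<in> G" "y \<in> G" for x y
  proof -
    obtain u v where "x = ?\<phi> u" "y = ?\<phi> v" using xy by (auto simp: G_def)
    then have "x - y = ?\<phi> (u - v)" by (simp add: to_circle_diff)
    then show ?thesis by (simp add: G_def)
  qed
  ultimately have G: "is_subgroup G" "finite G" using G0 by (simp_all add: is_subgroup_def)
  have cG: "card G = nat N" using card_image[OF inj_to_circle[OF N]] by (simp add: G0)
  have X: "X \<subseteq> G" "0 \<in> X" using imageI[OF A(2), of ?\<phi>] by (auto simp: X_def G_def)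
  have cX: "card X = card (residues N A)" using card_to_circle[OF N] by (simp add: X_def)
  have cXX: "card (X + X) = card (residues N (A + A))"
    using card_to_circle[OF N, of "A + A"] by (simp add: X_def to_circle_sum)
  have pre: "is_subgroup {x. ?\<phi> x \<in> H}" if "is_subgroup H" for H
    using is_subgroupD[OF that] by (auto simp: is_subgroup_def to_circle_diff)
  have NH: "?\<phi> N = 0" using N by (simp add: to_circle_eq_0_iff)
  have gen: "G \<subseteq> H" if H: "is_subgroup H" "X \<subseteq> H" for H
  proof -
    obtain h where h: "0 < h" "\<And>x. ?\<phi> x \<in> H \<longleftrightarrow> h dvd x"
      using int_subgroup_cyclic[OF pre[OF H(1)], of N] N NH is_subgroupD(1)[OF H(1)] by auto
    have "h dvd Gcd A" using H(2) h(2) by (intro Gcd_greatest) (auto simp: X_def)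
    then have "h dvd 1" using A by simp
    then have "h dvd x" for x using dvd_trans one_dvd by metis
    then show ?thesis using h(2) by (auto simp: G_def)
  qed
  have "card (X + X) + 2 \<le> card G" "card (X + X) + 1 \<le> card X + card X" "2 \<le> card X"
    using two c1 c2 cG cX cXX by linarith+
  then consider a d where "X = (\<lambda>i. ((+) d ^^ i) a) ` {..<card X}"
    | H where "is_subgroup H" "H \<subseteq> G" "2 \<le> card H" "H \<noteq> G" "card (X + H) + 1 \<le> card X + card H"
    using critical_set_structure[OF G X gen X(1)] by blast
  then show ?thesis
  proof cases
    case 1
    define t where "t = card X"
    have t: "2 \<le> t" using two cX t_def by simp
    have mem: "((+) d ^^ i) a \<in> X" if "i < t" for i using that by (subst 1) (auto simp: t_def)
    obtain a' where a': "a = ?\<phi> a'" using mem[of 0] t X(1) by (auto simp: G_def)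
    obtain b' where b': "d + a = ?\<phi> b'" using mem[of 1] t X(1) by (auto simp: G_def)
    define d' where "d' = b' - a'"
    have d': "d = ?\<phi> d'" using a' b' by (simp add: d'_def to_circle_diff algebra_simps)
    have Xi: "X = (\<lambda>i. ?\<phi> (a' + int i * d')) ` {..<t}"
      using 1 by (simp add: a' d' to_circle_funpow t_def)
    then obtain i0 where i0: "i0 < t" "?\<phi> (a' + int i0 * d') = 0" using X(2) by auto
    \<comment> \<open>Since 0 is a residue of A, indices can be counted from the place
      \<open>i0\<close> where the progression passes through 0, and the initial term
      disappears.\<close>
    have sh: "?\<phi> (a' + int i * d') = ?\<phi> ((int i - int i0) * d')" for i
    proof -
      have "a' + int i * d' = (int i - int i0) * d' + (a' + int i0 * d')"
        by (simp add: algebra_simps)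
      then show ?thesis using i0 by (metis to_circle_add add.right_neutral)
    qed
    have XJ: "X = (\<lambda>j. ?\<phi> (j * d')) ` {- int i0..int t - 1 - int i0}"
    proof
      show "X \<subseteq> (\<lambda>j. ?\<phi> (j * d')) ` {- int i0..int t - 1 - int i0}"
        unfolding Xi sh by (auto intro!: image_eqI[of _ "\<lambda>j. ?\<phi> (j * d')"])
      show "(\<lambda>j. ?\<phi> (j * d')) ` {- int i0..int t - 1 - int i0} \<subseteq> X"
      proof
        fix y assume "y \<in> (\<lambda>j. ?\<phi> (j * d')) ` {- int i0..int t - 1 - int i0}"
        then obtain j where j: "y = ?\<phi> (j * d')" "- int i0 \<le> j" "j \<le> int t - 1 - int i0" by auto
        then have "y = ?\<phi> (a' + int (nat (j + int i0)) * d')" unfolding sh by simp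
        moreover have "nat (j + int i0) < t" using j t by linarith
        ultimately show "y \<in> X" unfolding Xi by blast
      qed
    qed
    define J where "J = (\<lambda>j. j * d') ` {- int i0..int t - 1 - int i0}"
    have "?\<phi> ` residues N A = ?\<phi> ` residues N J"
      using XJ by (simp add: to_circle_res[OF N] X_def J_def image_image)
    then have eq: "residues N A = residues N J"
      using inj_on_image_eq_iff[OF inj_to_circle[OF N] residues_subset[OF N] residues_subset[OF N]]
        by blast
    \<comment> \<open>A common divisor of the difference and N divides every multiple of
      \<open>d'\<close> modulo N, hence every element of A.\<close>
    have "coprime d' N"
    proof (rule coprimeI)
      fix c assume c: "c dvd d'" "c dvd N"
      have "c dvd x" if "x \<in> A" for x
      proof -
        have "x mod N \<in> residues N J" using that eq by (auto simp: residues_def)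
        then obtain j where "x mod N = j * d' mod N" by (auto simp: residues_def J_def)
        then show ?thesis using c by (metis dvd_mod_iff dvd_mult)
      qed
      then have "c dvd Gcd A" by (rule Gcd_greatest)
      then show "is_unit c" using A by simp
    qed
    then show ?thesis using ap[of d' i0] i0 eq cX
      by (simp add: residues_def J_def image_image t_def)
  next
    case 2
    obtain h where h: "0 < h" "h dvd N" "\<And>x. ?\<phi> x \<in> H \<longleftrightarrow> h dvd x"
      using int_subgroup_cyclic[OF pre[OF 2(1)], of N] N NH is_subgroupD(1)[OF 2(1)] by auto
    have HG: "H = ?\<phi> ` {x \<in> {0..<N}. x mod h \<in> {0}}"
    proof -
      have iff: "?\<phi> x \<in> H \<longleftrightarrow> x mod h \<in> {0}" for x
        using h(3)[of x] by (simp add: dvd_eq_mod_eq_0)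
      show ?thesis
      proof (intro equalityI subsetI)
        fix z assume z: "z \<in> H"
        then obtain x where x: "x \<in> {0..<N}" "z = ?\<phi> x" using 2(2) unfolding G0 by blast
        then have "x \<in> {x \<in> {0..<N}. x mod h \<in> {0}}" using z iff[of x] by simp
        then show "z \<in> ?\<phi> ` {x \<in> {0..<N}. x mod h \<in> {0}}" using x(2) by (rule rev_image_eqI)
      next
        fix z assume "z \<in> ?\<phi> ` {x \<in> {0..<N}. x mod h \<in> {0}}"
        then obtain x where "z = ?\<phi> x" "x \<in> {x \<in> {0..<N}. x mod h \<in> {0}}" by (rule imageE)
        then show "z \<in> H" using iff[of x] by simp
      qed
    qed
    have XH: "X + H = ?\<phi> ` {x \<in> {0..<N}. x mod h \<in> residues h A}"
    proof
      show "X + H \<subseteq> ?\<phi> ` {x \<in> {0..<N}. x mod h \<in> residues h A}"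
      proof
        fix z assume "z \<in> X + H"
        then obtain a u where au: "a \<in> A" "u \<in> H" "z = ?\<phi> a + u"
          by (auto simp: X_def set_plus_def)
        obtain y where "u = ?\<phi> y" using au(2) 2(2) by (auto simp: G_def)
        then have z: "a \<in> A" "h dvd y" "z = ?\<phi> a + ?\<phi> y" using au h(3) by auto
        have "z = ?\<phi> ((a + y) mod N)" using z N by (simp add: to_circle_mod to_circle_add)
        moreover have "(a + y) mod N mod h = a mod h" using z(2) h(2)
          by (auto simp: mod_mod_cancel elim!: dvdE)
        ultimately show "z \<in> ?\<phi> ` {x \<in> {0..<N}. x mod h \<in> residues h A}" using z N
          by (auto simp: residues_def)
      qed
      show "?\<phi> ` {x \<in> {0..<N}. x mod h \<in> residues h A} \<subseteq> X + H"
      proof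
        fix z assume "z \<in> ?\<phi> ` {x \<in> {0..<N}. x mod h \<in> residues h A}"
        then obtain x a where x: "z = ?\<phi> x" "a \<in> A" "x mod h = a mod h" by (auto simp: residues_def)
        then have "?\<phi> (x - a) \<in> H" using h(3) by (simp add: mod_eq_dvd_iff)
        then have "?\<phi> a + ?\<phi> (x - a) \<in> X + H" using x by (auto simp: X_def)
        then show "z \<in> X + H" using x by (simp add: to_circle_add[symmetric])
      qed
    qed
    have inj: "inj_on ?\<phi> {x \<in> {0..<N}. x mod h \<in> T}" for T
      by (rule inj_on_subset[OF inj_to_circle[OF N]]) auto
    have cH: "int (card H) = N div h"
      unfolding HG card_image[OF inj] using card_residue_classes[OF h(1,2) N, of "{0}"] h by simp
    have cXH: "int (card (X + H)) = int (card (residues h A)) * (N div h)"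
      unfolding XH card_image[OF inj]
        using card_residue_classes[OF h(1,2) N residues_subset[OF h(1)]] .
    have "h \<noteq> 1" using 2(2,4) h(3) by (auto simp: G_def)
    moreover have "h \<noteq> N" using cH 2(3) h by auto
    moreover have "h \<le> N" using h N by (simp add: zdvd_imp_le)
    ultimately show ?thesis using sub[of h] h 2(5) cH cXH cX by linarith
  qed
qed

section \<open>Arithmetic progressions and Freiman isomorphisms\<close>

lemma card_sum_ge:
  fixes X Y :: "int set"
  assumes "finite X" "finite Y" "X \<noteq> {}" "Y \<noteq> {}"
  shows "card X + card Y \<le> card (X + Y) + 1"
proof -
  let ?P = "(+) (Min X) ` Y" and ?Q = "(+) (Max Y) ` X"
  have "?P \<subseteq> X + Y" using assms Min_in by blast
  moreover have "?Q \<subseteq> X + Y" using assms Max_in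
    by (metis (no_types, lifting) add.commute image_subset_iff set_plus_intro)
  ultimately have "card (?P \<union> ?Q) \<le> card (X + Y)"
    using assms by (intro card_mono finite_set_plus) auto
  moreover have "?P \<inter> ?Q \<subseteq> {Min X + Max Y}"
  proof
    fix z assume "z \<in> ?P \<inter> ?Q"
    then obtain x y where z: "x \<in> X" "y \<in> Y" "z = Min X + y" "z = Max Y + x" by auto
    then have "Min X \<le> x" "y \<le> Max Y" using assms by auto
    then show "z \<in> {Min X + Max Y}" using z by auto
  qed
  then have "card (?P \<inter> ?Q) \<le> 1" using card_mono[of "{Min X + Max Y}"] by fastforce
  ultimately show ?thesis
    using card_Un_Int[of ?P ?Q] assms by (simp add: card_translate)
qed

text \<open>Tying the length to \<open>card X\<close> forbids repetitions: a set of at least two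
  elements is a progression only for nonzero d, while a singleton is one for every d.\<close>

definition is_ap :: "int \<Rightarrow> int set \<Rightarrow> bool" where
  "is_ap d X \<longleftrightarrow> (\<exists>x. X = (\<lambda>i. x + i * d) ` {0..int (card X) - 1})"

lemma sum_ap:
  fixes d :: int
  assumes "0 \<le> a" "0 \<le> b"
  shows "(\<lambda>i. x + i * d) ` {0..a} + (\<lambda>i. y + i * d) ` {0..b} = (\<lambda>i. x + y + i * d) ` {0..a + b}"
proof
  show "(\<lambda>i. x + i * d) ` {0..a} + (\<lambda>i. y + i * d) ` {0..b} \<subseteq> (\<lambda>i. x + y + i * d) ` {0..a + b}"
  proof
    fix z assume "z \<in> (\<lambda>i. x + i * d) ` {0..a} + (\<lambda>i. y + i * d) ` {0..b}"
    then obtain i j where "0 \<le> i" "i \<le> a" "0 \<le> j" "j \<le> b" "z = x + i * d + (y + j * d)"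
      by (auto simp: set_plus_def)
    then show "z \<in> (\<lambda>i. x + y + i * d) ` {0..a + b}"
      by (intro image_eqI[of _ _ "i + j"]) (auto simp: algebra_simps)
  qed
  show "(\<lambda>i. x + y + i * d) ` {0..a + b} \<subseteq> (\<lambda>i. x + i * d) ` {0..a} + (\<lambda>i. y + i * d) ` {0..b}"
  proof
    fix z assume "z \<in> (\<lambda>i. x + y + i * d) ` {0..a + b}"
    then obtain l where l: "0 \<le> l" "l \<le> a + b" "z = x + y + l * d" by auto
    have "z = (x + min l a * d) + (y + (l - min l a) * d)" using l by (simp add: algebra_simps)
    moreover have "x + min l a * d \<in> (\<lambda>i. x + i * d) ` {0..a}" using l assms by auto
    moreover have "y + (l - min l a) * d \<in> (\<lambda>i. y + i * d) ` {0..b}" using l assms by auto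
    ultimately show "z \<in> (\<lambda>i. x + i * d) ` {0..a} + (\<lambda>i. y + i * d) ` {0..b}" by blast
  qed
qed

text \<open>Put back the maximum m of X. The remaining sums form a progression, and equality leaves
  room for one new sum only, namely m + max Y. So m plus the second largest element of Y is an old
  sum, which places m on the progression, directly after its last term.\<close>

lemma is_ap_extend:
  fixes X Y :: "int set"
  assumes fin: "finite X" "finite Y" and c: "3 \<le> card X" "2 \<le> card Y"
    and ap: "is_ap d (X - {Max X})" "is_ap d Y" and d: "0 < d"
    and s: "card (X + Y) + 1 \<le> card X + card Y"
  shows "is_ap d X"
proof -
  define m where "m = Max X"
  define a where "a = int (card X) - 2"
  define b where "b = int (card Y) - 1"
  have mX: "m \<in> X" using fin c unfolding m_def by (intro Max_in) auto
  have ab: "1 \<le> a" "1 \<le> b" using c by (auto simp: a_def b_def)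
  have "int (card (X - {m})) - 1 = a" using c mX fin by (simp add: a_def)
  then obtain x where X': "X - {m} = (\<lambda>i. x + i * d) ` {0..a}"
    using ap(1) by (auto simp: is_ap_def m_def)
  obtain y where Y: "Y = (\<lambda>i. y + i * d) ` {0..b}" using ap(2) by (auto simp: is_ap_def b_def)
  have XY': "(X - {m}) + Y = (\<lambda>i. x + y + i * d) ` {0..a + b}"
    unfolding X' Y using ab by (intro sum_ap) auto
  have "inj_on (\<lambda>i. x + y + i * d) {0..a + b}" using d by (auto simp: inj_on_def)
  then have cXY': "int (card ((X - {m}) + Y)) = a + b + 1" using XY' ab by (simp add: card_image)
  have "x + a * d \<in> X - {m}" unfolding X' using ab by (intro image_eqI[of _ _ a]) auto
  then have top: "x + a * d \<in> X" "x + a * d \<noteq> m" by auto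
  have mx: "x + a * d < m" using Max_ge[OF fin(1) top(1)] top(2) by (simp add: m_def)
  define z where "z = m + (y + b * d)"
  have yb: "y + b * d \<in> Y" "y + (b - 1) * d \<in> Y" using Y ab by auto
  have zXY: "z \<in> X + Y" using mX yb by (auto simp: z_def)
  have z: "z \<notin> (X - {m}) + Y"
  proof
    assume "z \<in> (X - {m}) + Y"
    then obtain i where "i \<le> a + b" "z = x + y + i * d" unfolding XY' by auto
    moreover have "i * d \<le> (a + b) * d" using calculation d by (intro mult_right_mono) auto
    ultimately show False using mx by (simp add: z_def algebra_simps)
  qed
  have sub: "insert z ((X - {m}) + Y) \<subseteq> X + Y" using zXY by (auto simp: set_plus_def)
  have fXY: "finite (X + Y)" using fin by (simp add: finite_set_plus)
  have "int (card (insert z ((X - {m}) + Y))) = a + b + 2"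
    using z cXY' finite_subset[OF sub fXY] by simp
  then have "card (X + Y) \<le> card (insert z ((X - {m}) + Y))" using s by (simp add: a_def b_def)
  then have eq: "insert z ((X - {m}) + Y) = X + Y" using card_seteq[OF fXY sub] by simp
  have "m + (y + (b - 1) * d) \<in> X + Y" using mX yb by blast
  moreover have "m + (y + (b - 1) * d) \<noteq> z" using d by (simp add: z_def algebra_simps)
  ultimately have "m + (y + (b - 1) * d) \<in> (X - {m}) + Y" using eq by blast
  then obtain l where l: "0 \<le> l" "l \<le> a + b" "m + (y + (b - 1) * d) = x + y + l * d" unfolding XY'
    by auto
  then have m: "m = x + (l - b + 1) * d" by (simp add: algebra_simps)
  have "a < l - b + 1" using mx m d mult_less_cancel_right_pos[OF d, of a "l - b + 1"] by simp
  then have m': "m = x + (a + 1) * d" using m l by (simp add: order.antisym)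
  have "X = insert m (X - {m})" using mX by blast
  also have "\<dots> = insert m ((\<lambda>i. x + i * d) ` {0..a})" by (simp only: X')
  also have "\<dots> = (\<lambda>i. x + i * d) ` {0..a + 1}"
  proof -
    have "{0..a + 1} = insert (a + 1) {0..a}" using ab by auto
    then show ?thesis by (simp only: m' image_insert)
  qed
  finally have "X = (\<lambda>i. x + i * d) ` {0..int (card X) - 1}" by (simp add: a_def)
  then show ?thesis unfolding is_ap_def by blast
qed

text \<open>Deleting the maximum of X loses the sum max X + max Y, so equality in |X + Y| \<ge> |X|
  + |Y| - 1 is inherited by the smaller pair.\<close>

lemma sum_equality_aps:
  fixes X Y :: "int set"
  assumes "finite X" "finite Y" "2 \<le> card X" "2 \<le> card Y" "card (X + Y) + 1 \<le> card X + card Y"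
  shows "\<exists>d>0. is_ap d X \<and> is_ap d Y"
  using assms
proof (induction "card X + card Y" arbitrary: X Y rule: less_induct)
  case less
  \<comment> \<open>Stated for arbitrary sets together with its own induction hypothesis, so that it
    also serves with the two summands exchanged.\<close>
  have step: "\<exists>d>0. is_ap d X \<and> is_ap d Y"
    if fin: "finite X" "finite Y" and c: "3 \<le> card X" "2 \<le> card Y"
      and s: "card (X + Y) + 1 \<le> card X + card Y" 
      and IH: "\<And>X' Y' :: int set. card X' + card Y' < card X + card Y \<Longrightarrow> finite X' \<Longrightarrow> finite Y' \<Longrightarrow>
        2 \<le> card X' \<Longrightarrow> 2 \<le> card Y' \<Longrightarrow> card (X' + Y') + 1 \<le> card X' + card Y' \<Longrightarrow>
        \<exists>d>0. is_ap d X' \<and> is_ap d Y'" for X Y :: "int set"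
  proof -
    define m where "m = Max X"
    have ne: "X \<noteq> {}" "Y \<noteq> {}" using c by auto
    have mX: "m \<in> X" using fin ne unfolding m_def by (intro Max_in) auto
    have c': "card (X - {m}) + 1 = card X" using mX fin c by simp
    have "m + Max Y \<notin> (X - {m}) + Y"
    proof
      assume "m + Max Y \<in> (X - {m}) + Y"
      then obtain x y where xy: "x \<in> X - {m}" "y \<in> Y" "m + Max Y = x + y"
        by (auto simp: set_plus_def)
      then have "x < m" "y \<le> Max Y" using fin by (auto simp: m_def order.strict_iff_order)
      then show False using xy by linarith
    qed
    moreover have sub: "insert (m + Max Y) ((X - {m}) + Y) \<subseteq> X + Y"
      using mX Max_in[OF fin(2) ne(2)] by (auto simp: set_plus_def)
    moreover have fXY: "finite (X + Y)" using fin by (simp add: finite_set_plus)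
    ultimately have "card ((X - {m}) + Y) + 1 \<le> card (X + Y)"
      using card_mono[OF fXY sub] finite_subset[OF sub fXY] by simp
    then have "card ((X - {m}) + Y) + 1 \<le> card (X - {m}) + card Y" using s c' by linarith
    then obtain d where "0 < d" "is_ap d (X - {m})" "is_ap d Y"
      using IH[of "X - {m}" Y] c c' fin by auto
    then show ?thesis using is_ap_extend[OF fin c _ _ _ s] by (auto simp: m_def)
  qed
  show ?case
  proof (cases "3 \<le> card X")
    case True
    then show ?thesis using less step[of X Y] by blast
  next
    case False
    then have cX: "card X = 2" using less by simp
    show ?thesis
    proof (cases "3 \<le> card Y")
      case True
      have "card (Y + X) + 1 \<le> card Y + card X" using less by (simp add: add.commute)
      then show ?thesis using True less(1) less.prems step[of Y X] by (simp add: add.commute) blast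
    next
      case False
      then have cY: "card Y = 2" using less by simp
      have pair: "\<exists>x x'. Z = {x, x'} \<and> x < x'" if "card Z = 2" for Z :: "int set"
      proof -
        obtain p q where "Z = {p, q}" "p \<noteq> q" using \<open>card Z = 2\<close> by (auto simp: card_2_iff)
        moreover from this have "Z = {q, p}" "p < q \<or> q < p" by auto
        ultimately show ?thesis by blast
      qed
      obtain x x' where X: "X = {x, x'}" "x < x'" using pair[OF cX] by blast
      obtain y y' where Y: "Y = {y, y'}" "y < y'" using pair[OF cY] by blast
      have "x' - x = y' - y"
      proof (rule ccontr)
        assume "x' - x \<noteq> y' - y"
        then have "card {x + y, x + y', x' + y, x' + y'} = 4" using X Y
          by (auto simp: card_insert_if)
        moreover have "X + Y = {x + y, x + y', x' + y, x' + y'}" unfolding X Y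
          by (auto simp: set_plus_def)
        ultimately show False using less cX cY by simp
      qed
      moreover have "{0..int 2 - 1} = {0, 1}" by auto
      ultimately have "X = (\<lambda>i. x + i * (x' - x)) ` {0..int (card X) - 1}"
        "Y = (\<lambda>i. y + i * (x' - x)) ` {0..int (card Y) - 1}"
        unfolding cX cY
          by (simp_all add: X(1) Y(1)) (metis add_diff_cancel_left' diff_add_cancel add.commute)
      then have "is_ap (x' - x) X" "is_ap (x' - x) Y" unfolding is_ap_def by blast+
      then show ?thesis using X by (intro exI[of _ "x' - x"]) auto
    qed
  qed
qed

text \<open>An affine map sends X + X onto A + A. If A + A is at least as large as X + X, that map
  is injective, and this is the Freiman property.\<close>

lemma freiman_image_affine:
  fixes X :: "(int \<times> int) set" and u p q :: int
  assumes "finite X" and A: "A = (\<lambda>(i, j). u + i * p + j * q) ` X" and c: "card (X + X) \<le> card (A + A)"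
  shows "freiman_image X A"
proof -
  define \<phi> where "\<phi> = (\<lambda>(i, j). u + i * p + j * q)"
  define \<psi> where "\<psi> = (\<lambda>(i, j). 2 * u + i * p + j * q)"
  have add: "\<psi> (a + b) = \<phi> a + \<phi> b" for a b
    by (cases a; cases b) (simp add: \<phi>_def \<psi>_def algebra_simps)
  have "A + A = \<psi> ` (X + X)"
    unfolding A \<phi>_def[symmetric]
  proof (intro equalityI subsetI)
    fix z assume "z \<in> \<phi> ` X + \<phi> ` X"
    then obtain a b where "a \<in> X" "b \<in> X" "z = \<psi> (a + b)" by (auto simp: add elim!: set_plus_elim)
    then show "z \<in> \<psi> ` (X + X)" by (auto intro!: imageI)
  next
    fix z assume "z \<in> \<psi> ` (X + X)"
    then obtain s where s: "s \<in> X + X" "z = \<psi> s" by blast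
    from s(1) obtain a b where "s = a + b" "a \<in> X" "b \<in> X" by (rule set_plus_elim)
    then have "a \<in> X" "b \<in> X" "z = \<phi> a + \<phi> b" using s(2) by (simp_all only: add)
    then show "z \<in> \<phi> ` X + \<phi> ` X" by (auto intro!: imageI)
  qed
  moreover have fX: "finite (X + X)" using assms by (simp add: finite_set_plus)
  ultimately have "inj_on \<psi> (X + X)"
    using c card_image_le[OF fX, of \<psi>] by (intro eq_card_imp_inj_on) auto
  then have iff: "a + b = c + d \<longleftrightarrow> \<phi> a + \<phi> b = \<phi> c + \<phi> d" if "a \<in> X" "b \<in> X" "c \<in> X"
      "d \<in> X" for a b c d
    using that unfolding add[symmetric] inj_on_def by (metis set_plus_intro)
  have "inj_on \<phi> X"
  proof (rule inj_onI)
    fix a c assume "a \<in> X" "c \<in> X" "\<phi> a = \<phi> c"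
    then have "a + a = c + c" using iff by metis
    then show "a = c" by (cases a; cases c) simp
  qed
  then have "freiman_iso \<phi> X A"
    using iff A by (simp add: freiman_iso_def bij_betw_def \<phi>_def)
  then show ?thesis by (auto simp: freiman_image_def)
qed

text \<open>The sumset of two rows has at most (2 n0 + 1) + (n0 + n1 + 1) + (2 n1 + 1) = 3|A| - 3
  points, so the given size of A + A excludes every collision.\<close>

lemma bi_arith_progI:
  fixes A :: "int set" and n0 n1 :: nat
  assumes A: "A = (\<lambda>i. u + i * d) ` {0..int n0} \<union> (\<lambda>i. v + i * d) ` {0..int n1}"
    and c: "card A = n0 + n1 + 2" and s: "card (A + A) = 3 * card A - 3"
  shows "bi_arith_prog A"
proof -
  let ?X = "two_rows n0 n1"
  have "A = (\<lambda>(i, j). u + i * (v - u) + j * d) ` ?X"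
    unfolding A two_rows_def image_Un by (force simp: image_iff)
  moreover have fin: "finite ?X" by (simp add: two_rows_def)
  moreover have "card (?X + ?X) \<le> card (A + A)"
  proof -
    let ?Z = "{0} \<times> {0..2 * int n0} \<union> {1} \<times> {0..int n0 + int n1} \<union> {2} \<times> {0..2 * int n1} :: (int \<times> int) set"
    have "?X + ?X \<subseteq> ?Z" by (auto simp: two_rows_def set_plus_def)
    then have "card (?X + ?X) \<le> card ?Z" by (intro card_mono) auto
    also have "card ?Z \<le> card ({0::int} \<times> {0..2 * int n0}) + card ({1::int} \<times> {0..int n0 + int n1})
        + card ({2::int} \<times> {0..2 * int n1})"
      by (intro order_trans[OF card_Un_le] add_mono order.refl card_Un_le)
    also have "\<dots> = (2 * n0 + 1) + (n0 + n1 + 1) + (2 * n1 + 1)"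
      by (simp add: card_cartesian_product nat_add_distrib nat_mult_distrib)
    also have "\<dots> = card (A + A)" using s c by simp
    finally show ?thesis .
  qed
  ultimately have "freiman_image ?X A" by (intro freiman_image_affine)
  moreover have "finite A" unfolding A by simp
  ultimately show ?thesis using c unfolding bi_arith_prog_def by metis
qed

text \<open>\<open>K6 + K6\<close> lies in the triangle i + j \<le> 4 of the nonnegative quadrant,
  which has 15 points.\<close>

lemma freiman_image_K6I:
  fixes c h :: int
  assumes A: "A = {0, h, 2 * h, c, c + h, 2 * c}" and s: "15 \<le> card (A + A)"
  shows "freiman_image K6 A"
proof (rule freiman_image_affine[where u = 0 and p = c and q = h])
  show "finite K6" by (simp add: K6_def)
  show "A = (\<lambda>(i, j). 0 + i * c + j * h) ` K6" unfolding A K6_def by (auto simp: algebra_simps)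
  have "K6 + K6 \<subseteq> (SIGMA i:{0..4}. {0..4 - i})" by (auto simp: K6_def set_plus_def)
  then have "card (K6 + K6) \<le> card (SIGMA i:{0..4::int}. {0..4 - i})" by (intro card_mono) auto
  also have "\<dots> = 15"
  proof -
    have "{0..4::int} = {0, 1, 2, 3, 4}" by auto
    then show ?thesis by (simp add: card_SigmaI)
  qed
  finally show "card (K6 + K6) \<le> card (A + A)" using s by simp
qed

section \<open>Sets concentrated in few residue classes\<close>

definition residue_class :: "int \<Rightarrow> int set \<Rightarrow> int \<Rightarrow> int set" where
  "residue_class h A c = {a \<in> A. a mod h = c}"

lemma card_eq_sum_classes: "finite A \<Longrightarrow> card A = (\<Sum>c\<in>residues h A. card (residue_class h A c))"
  using sum.image_gen[of A "\<lambda>_. 1::nat" "\<lambda>a. a mod h"] by (simp add: residues_def residue_class_def)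

lemma sum_class_subset: "residue_class h A c + residue_class h B c' \<subseteq> residue_class h (A + B) ((c + c') mod h)"
  by (auto simp: residue_class_def set_plus_def mod_add_eq)

lemma card_class_sum_ge:
  assumes "finite A" "finite B" "c \<in> residues h A" "c' \<in> residues h B"
  shows "card (residue_class h A c) + card (residue_class h B c') \<le> card (residue_class h (A + B) ((c + c') mod h)) + 1"
proof -
  have "finite (residue_class h A c)" "finite (residue_class h B c')" using assms
    by (auto simp: residue_class_def)
  moreover have "residue_class h A c \<noteq> {}" "residue_class h B c' \<noteq> {}" using assms
    by (auto simp: residue_class_def residues_def)
  ultimately have "card (residue_class h A c) + card (residue_class h B c') \<le> card (residue_class h A c + residue_class h B c') + 1"
    by (rule card_sum_ge)
  also have "card (residue_class h A c + residue_class h B c') \<le> card (residue_class h (A + B) ((c + c') mod h))"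
    using sum_class_subset by (intro card_mono) (auto simp: residue_class_def finite_set_plus assms)
  finally show ?thesis by simp
qed

lemma residues_sum: "residues h (A + B) = (\<lambda>(c, c'). (c + c') mod h) ` (residues h A \<times> residues h B)"
proof (intro equalityI subsetI)
  fix z assume "z \<in> residues h (A + B)"
  then obtain a b where ab: "a \<in> A" "b \<in> B" "z = (a + b) mod h"
    by (auto simp: residues_def set_plus_def)
  then have "z = (a mod h + b mod h) mod h" by (simp add: mod_add_eq)
  then show "z \<in> (\<lambda>(c, c'). (c + c') mod h) ` (residues h A \<times> residues h B)" 
    using ab by (intro image_eqI[of _ _ "(a mod h, b mod h)"]) (auto simp: residues_def)
next
  fix z assume "z \<in> (\<lambda>(c, c'). (c + c') mod h) ` (residues h A \<times> residues h B)"
  then obtain a b where ab: "a \<in> A" "b \<in> B" "z = (a mod h + b mod h) mod h"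
    by (auto simp: residues_def)
  then have "z = (a + b) mod h" by (simp add: mod_add_eq)
  then show "z \<in> residues h (A + B)" using ab by (auto simp: residues_def)
qed

lemma mod_add_cancel:
  assumes "x \<in> {0..<h}" "y \<in> {0..<h}" "(x + c) mod h = (y + c) mod h"
  shows "x = (y::int)"
proof -
  have "x mod h = y mod h" using assms(3) by (simp add: mod_eq_dvd_iff)
  then show ?thesis using assms by (metis atLeastLessThan_iff mod_pos_pos_trivial)
qed

text \<open>Rewrites |2A| = 3|A| - 3 as a vanishing sum of terms, each of which is nonnegative where
  it is applied. Here t counts the classes of A, o' the new classes of 2A, m0 and m the empty places
  in class 0 and in the others; eT and eO are surpluses over the lower bounds, and b indicates
  whether one exceptional class is present.\<close>

lemma class_count_identity:
  fixes t o' w m0 m b eT eO k a0 :: int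
  assumes "k = t * w + 1 - m0 - m" "a0 = w + 1 - m0"
    "3 * k - 3 = t * a0 + k - t + eT + (o' * (2 * w - 1 - m) - m * b + eO)"
  shows "eT + eO + (t - 2) * (w - 1 - m0 - m) + (o' - t + 1) * (2 * w - 1 - m) + m * (1 - b) = 0"
  using assms(3) unfolding assms(1,2) by (simp add: algebra_simps)

text \<open>The periodic case, with w = n/h. The classes of A offer |T| w + 1 places in [0, n], and
  \<open>dense\<close> says that at most w - 1 of them are empty.\<close>

locale class_setup =
  fixes A :: "int set" and n h w :: int
  assumes fin: "finite A" and A0: "0 \<in> A" and An: "n \<in> A" and sub: "A \<subseteq> {0..n}" and gcd1: "Gcd A = 1"
    and h: "1 < h" and n: "n = h * w" and w: "2 \<le> w"
    and dense: "int (card (residues h A)) * w + 2 \<le> int (card A) + w"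
    and T2: "2 * card (residues h A) \<le> card (residues h (A + A)) + 1"
    and s: "card (A + A) = 3 * card A - 3"
begin

lemma fin2: "finite (A + A)" using fin by (simp add: finite_set_plus)

lemma s_int: "int (card (A + A)) = 3 * int (card A) - 3"
proof -
  have "0 < n" using n h w by simp
  then have "card {0, n} \<le> card A" using A0 An fin by (intro card_mono) auto
  then show ?thesis using s \<open>0 < n\<close> by simp
qed

definition T where "T = residues h A"

abbreviation a where "a c \<equiv> int (card (residue_class h A c))"
abbreviation S where "S c \<equiv> int (card (residue_class h (A + A) c))"

lemma T: "T \<subseteq> {0..<h}" "0 \<in> T" "finite T"
  using residues_subset[of h A] h A0 fin
    by (auto simp: T_def residues_def intro: image_eqI[of _ _ 0])

lemma T_pos: "c \<in> T \<Longrightarrow> 0 \<le> c" "c \<in> T \<Longrightarrow> c < h" using T by auto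

lemma S_ge: "c \<in> T \<Longrightarrow> c' \<in> T \<Longrightarrow> a c + a c' - 1 \<le> S ((c + c') mod h)"
  using card_class_sum_ge[OF fin fin, of c h c'] by (simp add: T_def)

text \<open>Class 0 contains both endpoints 0 and n and so has w + 1 places; every other class has
  w.\<close>

lemma class_0_subset: "residue_class h A 0 \<subseteq> (\<lambda>j. h * j) ` {0..w}"
proof
  fix x assume x: "x \<in> residue_class h A 0"
  then have "h dvd x" "0 \<le> x" "x \<le> h * w" using sub n by (auto simp: residue_class_def)
  then obtain j where j: "x = h * j" by (auto elim: dvdE)
  then have "0 \<le> j" "j \<le> w" using \<open>0 \<le> x\<close> \<open>x \<le> h * w\<close> h by (auto simp: zero_le_mult_iff)
  then show "x \<in> (\<lambda>j. h * j) ` {0..w}" using j by auto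
qed

lemma class_subset:
  assumes "c \<in> T" "c \<noteq> 0"
  shows "residue_class h A c \<subseteq> (\<lambda>j. c + h * j) ` {0..<w}"
proof
  fix x assume x: "x \<in> residue_class h A c"
  have e: "x = c + h * (x div h)" using x by (auto simp: residue_class_def)
  have "x \<le> h * w" "0 \<le> x" using x sub n by (auto simp: residue_class_def)
  have "0 < c" using T_pos[OF assms(1)] assms(2) by simp
  then have "h * (x div h) < h * w" using e \<open>x \<le> h * w\<close> by linarith
  then have "x div h < w" using h by simp
  moreover have "0 \<le> x div h" using \<open>0 \<le> x\<close> h by (simp add: pos_imp_zdiv_nonneg_iff)
  ultimately show "x \<in> (\<lambda>j. c + h * j) ` {0..<w}" using e by auto
qed

lemma a_le: "c \<in> T \<Longrightarrow> c \<noteq> 0 \<Longrightarrow> a c \<le> w"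
proof -
  assume "c \<in> T" "c \<noteq> 0"
  then have "card (residue_class h A c) \<le> card ((\<lambda>j. c + h * j) ` {0..<w})" using class_subset
    by (intro card_mono) auto
  also have "\<dots> \<le> card {0..<w}" by (rule card_image_le) simp
  finally show "a c \<le> w" using w by simp
qed

lemma a0_le: "a 0 \<le> w + 1"
proof -
  have "card (residue_class h A 0) \<le> card ((\<lambda>j. h * j) ` {0..w})" using class_0_subset
    by (intro card_mono) auto
  also have "\<dots> \<le> card {0..w}" by (rule card_image_le) simp
  finally show ?thesis using w by simp
qed

lemma class_full:
  assumes "c \<in> T" "c \<noteq> 0" "a c = w"
  shows "residue_class h A c = (\<lambda>j. c + h * j) ` {0..<w}"
proof (rule card_subset_eq[OF _ class_subset[OF assms(1,2)]])
  have "card ((\<lambda>j. c + h * j) ` {0..<w}) = card {0..<w}" using h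
    by (intro card_image) (auto simp: inj_on_def)
  then show "card (residue_class h A c) = card ((\<lambda>j. c + h * j) ` {0..<w})" using assms(3) w by simp
qed simp

lemma card_A: "int (card A) = (\<Sum>c\<in>T. a c)"
  using card_eq_sum_classes[OF fin, of h] by (simp add: T_def)

lemma card_AA: "int (card (A + A)) = (\<Sum>c\<in>residues h (A + A). S c)"
  using card_eq_sum_classes[OF fin2, of h] by simp

lemma T_not_one: "card T \<noteq> 1"
proof
  assume "card T = 1"
  then have "T = {0}" using T by (auto simp: card_1_singleton_iff)
  then have "h dvd x" if "x \<in> A" for x using that by (auto simp: T_def residues_def)
  then have "h dvd Gcd A" by (rule Gcd_greatest)
  then show False using gcd1 h by simp
qed

text \<open>The parts X and Y of A give X + X, X + Y and Y + Y in three different classes. Their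
  least possible sizes already add up to 3|A| - 3, so equality holds in each and the equality case
  supplies a common difference.\<close>

lemma bi_arith_prog_if_two_classes:
  assumes "card T = 2"
  shows "bi_arith_prog A"
proof -
  obtain c where c: "T = {0, c}" "c \<noteq> 0"
  proof -
    obtain x y where "T = {x, y}" "x \<noteq> y" using assms by (auto simp: card_2_iff)
    then show ?thesis using T(2) that[of x] that[of y] by (auto simp: insert_commute)
  qed
  let ?X = "residue_class h A 0" and ?Y = "residue_class h A c"
  have A_eq: "A = ?X \<union> ?Y" "?X \<inter> ?Y = {}"
  proof -
    have "x mod h \<in> T" if "x \<in> A" for x using that by (simp add: T_def residues_def)
    then show "A = ?X \<union> ?Y" "?X \<inter> ?Y = {}" using c by (auto simp: residue_class_def)
  qed
  have fXY: "finite ?X" "finite ?Y" using fin by (auto simp: residue_class_def)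
  have ne: "?Y \<noteq> {}" using c by (auto simp: T_def residues_def residue_class_def)
  have n0: "0 < n" using n h w by simp
  have "{0, n} \<subseteq> ?X" using A0 An n by (auto simp: residue_class_def)
  then have p: "2 \<le> card ?X" using card_mono[OF fXY(1), of "{0, n}"] n0 by simp
  have q: "1 \<le> card ?Y" using ne fXY by (simp add: Suc_leI card_gt_0_iff)
  have k: "card A = card ?X + card ?Y" using A_eq fXY card_Un_disjoint by metis
  define s2 where "s2 = (c + c) mod h"
  have cm: "c mod h = c" using T_pos[of c] c by simp
  have "residues h (A + A) \<subseteq> {0, c, s2}"
    unfolding residues_sum T_def[symmetric] c(1) using cm by (auto simp: s2_def)
  moreover have "3 \<le> card (residues h (A + A))" using T2 assms by (simp add: T_def)
  moreover have "card {0, c, s2} \<le> 3" by (simp add: card_insert_if)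
  ultimately have U: "residues h (A + A) = {0, c, s2}" by (intro card_seteq) auto
  have d: "c \<noteq> 0" "s2 \<noteq> 0" "s2 \<noteq> c" using \<open>3 \<le> card (residues h (A + A))\<close> unfolding U
    by (auto simp: card_insert_if split: if_splits)
  have tot: "int (card (A + A)) = S 0 + S c + S s2" using card_AA d unfolding U by simp
  have inc: "?X + ?X \<subseteq> residue_class h (A + A) 0" "?X + ?Y \<subseteq> residue_class h (A + A) c"
      "?Y + ?Y \<subseteq> residue_class h (A + A) s2"
    using sum_class_subset[of h A 0 A 0] sum_class_subset[of h A 0 A c] sum_class_subset[of h A c A c] cm
    by (auto simp: s2_def)
  have fc: "finite (residue_class h (A + A) x)" for x using fin2 by (auto simp: residue_class_def)
  have le: "card (?X + ?X) \<le> card (residue_class h (A + A) 0)"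
      "card (?X + ?Y) \<le> card (residue_class h (A + A) c)"
    "card (?Y + ?Y) \<le> card (residue_class h (A + A) s2)"
    using inc fc card_mono by blast+
  have neX: "?X \<noteq> {}" using p by auto
  have ge: "2 * card ?X \<le> card (?X + ?X) + 1" "card ?X + card ?Y \<le> card (?X + ?Y) + 1"
    "2 * card ?Y \<le> card (?Y + ?Y) + 1"
    using card_sum_ge[of ?X ?X] card_sum_ge[of ?X ?Y] card_sum_ge[of ?Y ?Y] fXY ne neX by auto
  have eq: "card (?X + ?X) + 1 \<le> card ?X + card ?X" "card (?X + ?Y) + 1 \<le> card ?X + card ?Y"
    using tot s_int k le ge by linarith+
  \<comment> \<open>A one-point Y imposes no difference; then d is read off from X + X.\<close>
  obtain d v where d: "is_ap d ?X" "?Y = (\<lambda>i. v + i * d) ` {0..int (card ?Y) - 1}"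
  proof (cases "2 \<le> card ?Y")
    case True
    then show ?thesis using sum_equality_aps[OF fXY p True eq(2)] that by (auto simp: is_ap_def)
  next
    case False
    then have q1: "card ?Y = 1" using q by simp
    then obtain v where "?Y = {v}" by (auto simp: card_1_singleton_iff)
    then have "?Y = (\<lambda>i. v + i * d) ` {0..int (card ?Y) - 1}" for d using q1 by simp
    then show ?thesis using sum_equality_aps[OF fXY(1,1) p p eq(1)] that by blast
  qed
  obtain u where u: "?X = (\<lambda>i. u + i * d) ` {0..int (card ?X) - 1}" using d(1)
    by (auto simp: is_ap_def)
  show ?thesis
  proof (rule bi_arith_progI[of A u d "card ?X - 1" v "card ?Y - 1"])
    show "A = (\<lambda>i. u + i * d) ` {0..int (card ?X - 1)} \<union> (\<lambda>i. v + i * d) ` {0..int (card ?Y - 1)}"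
      using A_eq(1) u d(2) p q by (simp add: of_nat_diff)
    show "card A = card ?X - 1 + (card ?Y - 1) + 2" using k p q by simp
  qed (rule s)
qed

text \<open>Bounding each class of 2A from below and applying \<open>class_count_identity\<close>
  makes all slack vanish. Hence exactly w - 1 places are empty, and all of them turn out to lie in
  one class \<open>c1\<close>, which keeps a single element.\<close>

lemma three_classes:
  assumes t3: "3 \<le> card T"
  obtains c1 where "c1 \<in> T" "c1 \<noteq> 0" "a c1 = 1" "a 0 = w + 1" "\<And>c. c \<in> T \<Longrightarrow> c \<noteq> 0 \<Longrightarrow> c \<noteq> c1 \<Longrightarrow> a c = w"
    "(c1 + c1) mod h \<notin> T" "card (residues h (A + A)) + 1 = 2 * card T"
    "\<And>s. s \<in> T \<Longrightarrow> S s = a 0 + a s - 1"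
    "\<And>s. s \<in> residues h (A + A) - T \<Longrightarrow> S s \<le> w"
proof -
  define U where "U = residues h (A + A)"
  have U_eq: "U = (\<lambda>(c, c'). (c + c') mod h) ` (T \<times> T)" unfolding U_def T_def by (rule residues_sum)
  have mT: "c mod h = c" if "c \<in> T" for c using T_pos[OF that] by simp
  have TU: "T \<subseteq> U"
  proof
    fix c assume "c \<in> T"
    then show "c \<in> U" unfolding U_eq using T(2) mT by (intro image_eqI[of _ _ "(0, c)"]) auto
  qed
  have finU: "finite U" using fin2 by (simp add: U_def residues_def)
  define R where "R = U - T"
  have cR: "card U = card T + card R" using TU finU T(3) card_Un_disjoint[of T R]
    by (simp add: R_def Un_absorb1)
  define \<mu> where "\<mu> c = w - a c" for c
  define m0 where "m0 = w + 1 - a 0"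
  define m where "m = (\<Sum>c\<in>T - {0}. \<mu> c)"
  have mu0: "0 \<le> m0" using a0_le by (simp add: m0_def)
  have mu: "0 \<le> \<mu> c" if "c \<in> T - {0}" for c using a_le that by (simp add: \<mu>_def)
  have mu_le: "\<mu> c \<le> m" if "c \<in> T - {0}" for c
    unfolding m_def using that mu T(3) by (intro member_le_sum) auto
  have m_nonneg: "0 \<le> m" unfolding m_def using mu by (intro sum_nonneg) auto
  have cT0: "int (card (T - {0})) = int (card T) - 1" using T t3 by simp
  have k: "int (card A) = int (card T) * w + 1 - m0 - m"
  proof -
    have "int (card A) = a 0 + (\<Sum>c\<in>T - {0}. a c)" unfolding card_A using T by (simp add: sum.remove)
    also have "(\<Sum>c\<in>T - {0}. a c) = (\<Sum>c\<in>T - {0}. w - \<mu> c)" by (simp add: \<mu>_def)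
    also have "\<dots> = (int (card T) - 1) * w - m" using cT0 by (simp add: sum_subtractf m_def)
    finally show ?thesis by (simp add: m0_def algebra_simps)
  qed
  have mw: "m0 + m \<le> w - 1" using dense k by (simp add: T_def)
  have "card (T - {0}) \<noteq> 0" using cT0 t3 by linarith
  then have "T - {0} \<noteq> {}" by (metis card.empty)
  then have "Max (\<mu> ` (T - {0})) \<in> \<mu> ` (T - {0})" using T(3) by (intro Max_in) auto
  then obtain c1 where c1': "c1 \<in> T - {0}" "\<mu> c1 = Max (\<mu> ` (T - {0}))" by (metis imageE)
  then have c1: "c1 \<in> T - {0}" "\<And>c. c \<in> T - {0} \<Longrightarrow> \<mu> c \<le> \<mu> c1" using T(3) by auto
  define s1 where "s1 = (c1 + c1) mod h"
  have two: "\<mu> c + \<mu> c' \<le> m" if "c \<in> T - {0}" "c' \<in> T - {0}" "c \<noteq> c'" for c c'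
  proof -
    have "(\<Sum>x\<in>{c, c'}. \<mu> x) \<le> m" unfolding m_def using that mu T(3) by (intro sum_mono2) auto
    then show ?thesis using that by simp
  qed
  have R_rep: "\<exists>c\<in>T - {0}. \<exists>c'\<in>T - {0}. s = (c + c') mod h" if "s \<in> R" for s
  proof -
    obtain c c' where cc: "c \<in> T" "c' \<in> T" "s = (c + c') mod h" "s \<notin> T"
      using \<open>s \<in> R\<close> by (auto simp: R_def U_eq)
    then show ?thesis using mT by (cases "c = 0 \<or> c' = 0") auto
  qed
  \<comment> \<open>A new class is a sum of two nonzero classes. Their empty places total at most m
    unless both are \<open>c1\<close>, the class with most empty places; so only s1 = 2 c1 gets the
    weaker bound.\<close>
  have S_R: "2 * w - 1 - m - (if s = s1 then m else 0) \<le> S s" if "s \<in> R" for s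
  proof -
    obtain c c' where cc: "c \<in> T - {0}" "c' \<in> T - {0}" "s = (c + c') mod h" using R_rep[OF \<open>s \<in> R\<close>]
      by blast
    have S: "2 * w - 1 - \<mu> c - \<mu> c' \<le> S s" using S_ge[of c c'] cc by (simp add: \<mu>_def)
    show ?thesis
    proof (cases "c = c1 \<and> c' = c1")
      case True
      then have "s = s1" using cc by (simp add: s1_def)
      then show ?thesis using S True mu_le[OF c1(1)] by simp
    next
      case False
      have "\<mu> c + \<mu> c' \<le> m"
      proof (cases "c = c'")
        case True
        then have "\<mu> c + \<mu> c1 \<le> m" using False cc c1 by (intro two) auto
        then show ?thesis using True c1(2)[OF cc(1)] by simp
      next
        case False then show ?thesis using two cc by blast
      qed
      then show ?thesis using S m_nonneg by (cases "s = s1") simp_all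
    qed
  qed
  have S_T: "a 0 + a s - 1 \<le> S s" if "s \<in> T" for s using S_ge[OF T(2) that] mT[OF that] by simp
  define eT where "eT = (\<Sum>s\<in>T. S s - (a 0 + a s - 1))"
  define eR where "eR = (\<Sum>s\<in>R. S s - (2 * w - 1 - m - (if s = s1 then m else 0)))"
  define b :: int where "b = (if s1 \<in> R then 1 else 0)"
  have finR: "finite R" using finU by (simp add: R_def)
  have nn: "0 \<le> eT" "0 \<le> eR" unfolding eT_def eR_def using S_T S_R by (auto intro!: sum_nonneg)
  have "int (card (A + A)) = (\<Sum>s\<in>T. S s) + (\<Sum>s\<in>R. S s)"
    unfolding card_AA U_def[symmetric] R_def using sum.subset_diff[OF TU finU, of S] by simp
  moreover have "(\<Sum>s\<in>T. S s) = int (card T) * a 0 + int (card A) - int (card T) + eT"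
    unfolding eT_def card_A by (simp add: sum_subtractf sum.distrib)
  moreover have "(\<Sum>s\<in>R. S s) = int (card R) * (2 * w - 1 - m) - m * b + eR"
  proof -
    have "(\<Sum>s\<in>R. if s = s1 then m else 0) = m * b" using finR by (simp add: b_def)
    then show ?thesis unfolding eR_def by (simp add: sum_subtractf sum.distrib algebra_simps)
  qed
  ultimately have "eT + eR + (int (card T) - 2) * (w - 1 - m0 - m)
      + (int (card R) - int (card T) + 1) * (2 * w - 1 - m) + m * (1 - b) = 0"
    using s_int k by (intro class_count_identity[of "int (card A)"]) (auto simp: m0_def)
  moreover have "0 \<le> (int (card T) - 2) * (w - 1 - m0 - m)" using t3 mw by simp
  moreover have cRT: "int (card T) - 1 \<le> int (card R)" using T2 cR by (simp add: U_def T_def)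
  then have "0 \<le> (int (card R) - int (card T) + 1) * (2 * w - 1 - m)" using mw mu0 w by simp
  moreover have "0 \<le> m * (1 - b)" using m_nonneg by (simp add: b_def)
  ultimately have zero: "eT = 0" "eR = 0" "(int (card T) - 2) * (w - 1 - m0 - m) = 0"
      "(int (card R) - int (card T) + 1) * (2 * w - 1 - m) = 0" "m * (1 - b) = 0"
    using nn by linarith+
  have mm: "m0 + m = w - 1" using zero(3) t3 by simp
  have cRT': "int (card R) = int (card T) - 1" using zero(4) mw mu0 w by auto
  have ST: "S s = a 0 + a s - 1" if "s \<in> T" for s
    using zero(1) sum_nonneg_eq_0_iff[OF T(3), of "\<lambda>s. S s - (a 0 + a s - 1)"] S_T that
    unfolding eT_def by fastforce
  have SR: "S s = 2 * w - 1 - m - (if s = s1 then m else 0)" if "s \<in> R" for s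
    using zero(2) sum_nonneg_eq_0_iff[OF finR, of "\<lambda>s. S s - (2 * w - 1 - m - (if s = s1 then m else 0))"]
      S_R that unfolding eR_def by fastforce
  have s1R: "s1 \<in> R" if "m \<noteq> 0" using zero(5) that by (auto simp: b_def split: if_splits)
  have mc1: "\<mu> c1 = m"
  proof (cases "m = 0")
    case True then show ?thesis using mu_le[OF c1(1)] mu[OF c1(1)] by simp
  next
    case False
    have "2 * w - 1 - 2 * \<mu> c1 \<le> S s1" using S_ge[of c1 c1] c1(1) by (simp add: \<mu>_def s1_def)
    then show ?thesis using SR[OF s1R[OF False]] mu_le[OF c1(1)] by simp
  qed
  have mc0: "\<mu> c = 0" if "c \<in> T - {0}" "c \<noteq> c1" for c
    using two[OF that(1) c1(1) that(2)] mc1 mu[OF that(1)] by simp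
  have "T \<noteq> {0, c1}"
  proof
    assume "T = {0, c1}"
    then have "card T \<le> 2" by (simp add: card_insert_if)
    then show False using t3 by simp
  qed
  then obtain c2 where c2: "c2 \<in> T - {0}" "c2 \<noteq> c1" using c1 T by blast
  \<comment> \<open>\<open>c2\<close> is a full class, so 0 + c2 and n + c2 already give 2w sums in
    it, while equality allows exactly 2w - m0.\<close>
  have "m0 = 0"
  proof -
    have full: "residue_class h A c2 = (\<lambda>j. c2 + h * j) ` {0..<w}" using class_full c2 mc0
      by (simp add: \<mu>_def)
    let ?F = "(\<lambda>j. c2 + h * j) ` {0..<2 * w}"
    have "?F \<subseteq> residue_class h (A + A) c2"
    proof
      fix x assume "x \<in> ?F"
      then obtain j where j: "0 \<le> j" "j < 2 * w" "x = c2 + h * j" by auto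
      have "x \<in> A + A"
      proof (cases "j < w")
        case True
        then have "x \<in> residue_class h A c2" using full j by auto
        then have "0 + x \<in> A + A" using A0 by (intro set_plus_intro) (auto simp: residue_class_def)
        then show ?thesis by simp
      next
        case False
        then have "c2 + h * (j - w) \<in> residue_class h A c2" using full j by auto
        then have "n + (c2 + h * (j - w)) \<in> A + A" using An
          by (intro set_plus_intro) (auto simp: residue_class_def)
        then show ?thesis using j n by (simp add: algebra_simps)
      qed
      then show "x \<in> residue_class h (A + A) c2" using j mT c2 by (simp add: residue_class_def)
    qed
    then have "card ?F \<le> card (residue_class h (A + A) c2)" using fin2
      by (intro card_mono) (auto simp: residue_class_def)
    moreover have "card ?F = card {0..<2 * w}" using h by (intro card_image) (auto simp: inj_on_def)
    ultimately have "2 * w \<le> S c2" using w by simp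
    moreover have "S c2 = 2 * w - m0" using ST[of c2] c2 mc0[OF c2] by (simp add: \<mu>_def m0_def)
    ultimately show ?thesis using mu0 by simp
  qed
  then have m: "m = w - 1" using mm by simp
  show ?thesis
  proof (rule that[of c1])
    show "c1 \<in> T" "c1 \<noteq> 0" using c1 by auto
    show "a c1 = 1" using mc1 m by (simp add: \<mu>_def)
    show "a 0 = w + 1" using \<open>m0 = 0\<close> by (simp add: m0_def)
    show "a c = w" if "c \<in> T" "c \<noteq> 0" "c \<noteq> c1" for c using mc0[of c] that by (simp add: \<mu>_def)
    show "(c1 + c1) mod h \<notin> T" using s1R m w by (simp add: s1_def R_def)
    show "card (residues h (A + A)) + 1 = 2 * card T" using cRT' cR t3 by (simp add: U_def)
    show "S s = a 0 + a s - 1" if "s \<in> T" for s using ST[OF that] .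
    show "S s \<le> w" if "s \<in> residues h (A + A) - T" for s using SR[of s] that m w
      by (simp add: R_def U_def)
  qed
qed

text \<open>With three or more classes, let y be the only element in class \<open>c1\<close>. If the
  other classes never sum to \<open>c1\<close>, then removing y leaves a set A' with |2A'| \<le>
  2|A'| - 1, so A is a progression and one point. Otherwise w = 2 and the classes are 0, c, 2c,
  which is the shape of \<open>K6\<close>.\<close>

lemma bi_arith_prog_or_K6:
  shows "bi_arith_prog A \<or> card A = 6 \<and> freiman_image K6 A"
proof -
  have "card T \<noteq> 0" using T by auto
  then consider "card T = 2" | "3 \<le> card T" using T_not_one by linarith
  then show ?thesis
  proof cases
    case 1
    then show ?thesis using bi_arith_prog_if_two_classes by simp
  next
    case t3: 2
    obtain c1 where c1: "c1 \<in> T" "c1 \<noteq> 0" "a c1 = 1" and a0: "a 0 = w + 1"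
      and ac: "\<And>c. c \<in> T \<Longrightarrow> c \<noteq> 0 \<Longrightarrow> c \<noteq> c1 \<Longrightarrow> a c = w"
      and s1: "(c1 + c1) mod h \<notin> T" and cU: "card (residues h (A + A)) + 1 = 2 * card T"
      and ST: "\<And>s. s \<in> T \<Longrightarrow> S s = a 0 + a s - 1"
      and SR: "\<And>s. s \<in> residues h (A + A) - T \<Longrightarrow> S s \<le> w"
      using three_classes[OF t3] by blast
    define T0 where "T0 = T - {c1}"
    have T0: "0 \<in> T0" "T0 \<subseteq> T" "finite T0" using T c1 by (auto simp: T0_def)
    have mT: "c mod h = c" if "c \<in> T" for c using T_pos[OF that] by simp
    have U: "(c + c') mod h \<in> residues h (A + A)" if "c \<in> T" "c' \<in> T" for c c'
      unfolding residues_sum using that by (auto simp: T_def intro!: image_eqI[of _ _ "(c, c')"])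
    \<comment> \<open>Two full classes yield at least 2w - 1 sums, more than the w that a new class
      may contain.\<close>
    have closed: "(c + c') mod h \<in> T" if c: "c \<in> T0" "c' \<in> T0" for c c'
    proof (cases "c = 0 \<or> c' = 0")
      case True
      then show ?thesis using c T0 mT by auto
    next
      case False
      then have "2 * w - 1 \<le> S ((c + c') mod h)" using S_ge[of c c'] ac c by (auto simp: T0_def)
      then show ?thesis using SR[of "(c + c') mod h"] U[of c c'] c T0 w by fastforce
    qed
    obtain y where y: "residue_class h A c1 = {y}" using c1(3) by (auto simp: card_1_singleton_iff)
    have yA: "y \<in> A" "y mod h = c1" using y by (auto simp: residue_class_def)
    show ?thesis
    proof (cases "\<exists>c\<in>T0. \<exists>c'\<in>T0. (c + c') mod h = c1")
      case False
      define A' where "A' = A - {y}"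
      have A': "A = insert y A'" "y \<notin> A'" "finite A'" using yA fin by (auto simp: A'_def)
      have resA': "x mod h \<in> T0" if "x \<in> A'" for x
        using that y by (auto simp: A'_def T0_def T_def residues_def residue_class_def)
      have AA': "x mod h \<in> T0" if x: "x \<in> A' + A'" for x
      proof -
        obtain p q where pq: "p \<in> A'" "q \<in> A'" "x = p + q" using x by (auto simp: set_plus_def)
        then have "x mod h = (p mod h + q mod h) mod h" by (simp add: mod_add_eq)
        then show ?thesis using closed[OF resA' resA', OF pq(1,2)] False resA' pq
          by (auto simp: T0_def)
      qed
      \<comment> \<open>Translation by c maps T0 into itself, hence permutes it, so it cannot also
        carry \<open>c1\<close> into T0.\<close>
      have notT0: "(c1 + c) mod h \<notin> T0" if c: "c \<in> T0" for c
      proof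
        assume m: "(c1 + c) mod h \<in> T0"
        have "(\<lambda>x. (x + c) mod h) ` T0 \<subseteq> T0" using closed c False by (auto simp: T0_def)
        moreover have inj: "inj_on (\<lambda>x. (x + c) mod h) T0"
          using mod_add_cancel[of _ h _ c] T0 T(1) by (intro inj_onI) blast
        ultimately have "(\<lambda>x. (x + c) mod h) ` T0 = T0" using T0(3)
          by (intro card_subset_eq card_image)
        then have "(c1 + c) mod h \<in> (\<lambda>x. (x + c) mod h) ` T0" using m by simp
        then obtain x where x: "(c1 + c) mod h = (x + c) mod h" "x \<in> T0" by (rule imageE)
        have "x = c1" using mod_add_cancel[of x h c1 c] T_pos[of x] T_pos[of c1] x T0(2) c1(1)
          by auto
        then show False using \<open>x \<in> T0\<close> by (simp add: T0_def)
      qed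
      let ?Y = "(+) y ` A'"
      have Yres: "\<exists>c\<in>T0. x mod h = (c1 + c) mod h" if x: "x \<in> ?Y" for x
      proof -
        obtain p where p: "p \<in> A'" "x = y + p" using x by blast
        then have "x mod h = (c1 + p mod h) mod h" unfolding p(2) yA(2)[symmetric]
          by (simp only: mod_add_eq)
        then show ?thesis using resA'[OF p(1)] by blast
      qed
      have d1: "(A' + A') \<inter> ?Y = {}"
      proof (rule ccontr)
        assume "(A' + A') \<inter> ?Y \<noteq> {}"
        then obtain x where "x \<in> A' + A'" "x \<in> ?Y" by blast
        then show False using AA'[of x] Yres[of x] notT0 by auto
      qed
      have yy: "(y + y) mod h = (c1 + c1) mod h" using yA by (metis mod_add_eq)
      have d2: "y + y \<notin> (A' + A') \<union> ?Y"
      proof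
        assume "y + y \<in> (A' + A') \<union> ?Y"
        then show False
        proof
          assume "y + y \<in> A' + A'"
          then show False using AA'[of "y + y"] yy s1 T0(2) by auto
        next
          assume "y + y \<in> ?Y"
          then have "y \<in> A'" by auto
          then show False using A' by simp
        qed
      qed
      have fA': "finite (A' + A')" using A' by (simp add: finite_set_plus)
      have "insert (y + y) ((A' + A') \<union> ?Y) \<subseteq> A + A"
        unfolding A'(1) by (auto simp: set_plus_def)
      then have "card (insert (y + y) ((A' + A') \<union> ?Y)) \<le> card (A + A)" using fin2
        by (intro card_mono)
      moreover have "card (insert (y + y) ((A' + A') \<union> ?Y)) = card (A' + A') + card A' + 1"
        using d1 d2 fA' A'(3) by (simp add: card_Un_disjoint card_translate)
      moreover have cA: "card A = card A' + 1" using A' by simp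
      ultimately have s': "card (A' + A') + 1 \<le> card A' + card A'" using s_int by simp
      have "int (card T) * w + 2 \<le> int (card A) + w" using dense by (simp add: T_def)
      moreover have "3 * w \<le> int (card T) * w" using t3 w by (intro mult_right_mono) auto
      ultimately have "3 \<le> card A" using w by linarith
      then have cA2: "2 \<le> card A'" using cA by simp
      obtain d where "is_ap d A'" using sum_equality_aps[OF A'(3,3) cA2 cA2 s'] by blast
      then obtain u where u: "A' = (\<lambda>i. u + i * d) ` {0..int (card A') - 1}"
        by (auto simp: is_ap_def)
      have "bi_arith_prog A"
      proof (rule bi_arith_progI[of A u d "card A' - 1" y 0])
        show "A = (\<lambda>i. u + i * d) ` {0..int (card A' - 1)} \<union> (\<lambda>i. y + i * d) ` {0..int 0}"
          using A'(1) u cA2 by (simp add: of_nat_diff)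
      qed (use cA cA2 s in auto)
      then show ?thesis by simp
    next
      case True
      then obtain c c' where cc: "c \<in> T0" "c' \<in> T0" "(c + c') mod h = c1" by blast
      have c0: "c \<noteq> 0" "c' \<noteq> 0" using cc mT T0 by (auto simp: T0_def)
      \<comment> \<open>Two full classes sum into \<open>c1\<close>, whose class in 2A has exactly w
        + 1 elements; this leaves only w = 2.\<close>
      have "2 * w - 1 \<le> S c1" using S_ge[of c c'] ac[of c] ac[of c'] cc c0 by (simp add: T0_def)
      then have w2: "w = 2" using ST[OF c1(1)] c1(3) a0 w by simp
      \<comment> \<open>Every new class needs \<open>c1\<close> as a summand, and there are |T| - 1
        new classes, so adding \<open>c1\<close> to any nonzero class gives a new one.\<close>
      have R_eq: "residues h (A + A) - T = (\<lambda>x. (c1 + x) mod h) ` (T - {0})"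
      proof (rule card_seteq)
        show "finite ((\<lambda>x. (c1 + x) mod h) ` (T - {0}))" using T by simp
        show "residues h (A + A) - T \<subseteq> (\<lambda>x. (c1 + x) mod h) ` (T - {0})"
        proof
          fix s assume s: "s \<in> residues h (A + A) - T"
          then obtain p q where pq: "p \<in> T" "q \<in> T" "s = (p + q) mod h"
            unfolding residues_sum T_def by auto
          have "p \<noteq> 0" "q \<noteq> 0" using pq s mT by auto
          moreover have "p = c1 \<or> q = c1" using closed[of p q] pq s by (auto simp: T0_def)
          ultimately show "s \<in> (\<lambda>x. (c1 + x) mod h) ` (T - {0})" using pq
            by (auto simp: add.commute)
        qed
        have "T \<subseteq> residues h (A + A)"
        proof
          fix x assume "x \<in> T"
          then show "x \<in> residues h (A + A)" using U[OF T(2), of x] mT by simp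
        qed
        then have "card (residues h (A + A) - T) = card T - 1" using cU T(3)
          by (simp add: card_Diff_subset)
        moreover have "card ((\<lambda>x. (c1 + x) mod h) ` (T - {0})) \<le> card T - 1"
          using card_image_le[of "T - {0}" "\<lambda>x. (c1 + x) mod h"] T by simp
        ultimately show "card ((\<lambda>x. (c1 + x) mod h) ` (T - {0})) \<le> card (residues h (A + A) - T)"
          by simp
      qed
      \<comment> \<open>Since c1 + e = c + (c' + e) is new, c' + e cannot lie in T0. It must be c1 =
        c + c', so e = c.\<close>
      have uniq: "e = c" if e: "e \<in> T0" "e \<noteq> 0" for e
      proof -
        have "(c1 + e) mod h \<in> residues h (A + A) - T" unfolding R_eq using e T0 by auto
        then have "(c + (c' + e)) mod h \<notin> T"
          unfolding cc(3)[symmetric] by (simp add: mod_simps add.assoc)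
        then have "(c' + e) mod h \<notin> T0" using closed[OF cc(1), of "(c' + e) mod h"]
          by (auto simp: mod_simps)
        then have "(c' + e) mod h = c1" using closed[OF cc(2) e(1)] by (simp add: T0_def)
        then have "(e + c') mod h = (c + c') mod h" using cc(3) by (simp add: add.commute)
        then show ?thesis using mod_add_cancel[of e h c c'] T_pos[of e] T_pos[of c] e cc(1) T0(2)
          by auto
      qed
      have c'c: "c' = c" using uniq[OF cc(2) c0(2)] .
      have Teq: "T = {0, c, c1}" using uniq cc T0 c1 by (auto simp: T0_def)
      have n2: "n = 2 * h" using n w2 by simp
      have fc: "residue_class h A c = {c, c + h}"
      proof -
        have "{0..<2::int} = {0, 1}" by auto
        then show ?thesis using class_full[of c] ac[of c] cc c0 w2 by (auto simp: T0_def)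
      qed
      have f0: "residue_class h A 0 = {0, h, 2 * h}"
      proof -
        have "card ((\<lambda>j. h * j) ` {0..w}) = card {0..w}" using h
          by (intro card_image) (auto simp: inj_on_def)
        then have "residue_class h A 0 = (\<lambda>j. h * j) ` {0..w}" using a0 w class_0_subset
          by (intro card_subset_eq) auto
        moreover have "{0..2::int} = {0, 1, 2}" by auto
        ultimately show ?thesis using w2 by (simp add: mult.commute)
      qed
      \<comment> \<open>In 2A the class \<open>c1\<close> has exactly three elements. They are both
        2c, 2c + h, 2c + 2h and y, y + h, y + 2h.\<close>
      have y2: "y = 2 * c"
      proof -
        have "{c + c, c + (c + h), (c + h) + (c + h)} \<subseteq> residue_class h A c + residue_class h A c"
          unfolding fc by blast
        also have "\<dots> \<subseteq> residue_class h (A + A) c1" using sum_class_subset[of h A c A c] cc(3) c'c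
          by simp
        finally have 1: "{c + c, c + (c + h), (c + h) + (c + h)} \<subseteq> residue_class h (A + A) c1" .
        have "{0 + y, h + y, 2 * h + y} \<subseteq> residue_class h A 0 + residue_class h A c1" unfolding f0 y
          by blast
        also have "\<dots> \<subseteq> residue_class h (A + A) c1"
          using sum_class_subset[of h A 0 A c1] mT[OF c1(1)] by simp
        finally have 2: "{0 + y, h + y, 2 * h + y} \<subseteq> residue_class h (A + A) c1" .
        have fS: "finite (residue_class h (A + A) c1)" using fin2 by (simp add: residue_class_def)
        have "S c1 = 3" using ST[OF c1(1)] c1(3) a0 w2 by simp
        then have "{c + c, c + (c + h), (c + h) + (c + h)} = residue_class h (A + A) c1"
            "{0 + y, h + y, 2 * h + y} = residue_class h (A + A) c1"
          using card_subset_eq[OF fS 1] card_subset_eq[OF fS 2] h by auto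
        then have e: "{c + c, c + (c + h), (c + h) + (c + h)} = {0 + y, h + y, 2 * h + y}" by simp
        then have "c + c \<in> {0 + y, h + y, 2 * h + y}" "0 + y \<in> {c + c, c + (c + h), (c + h) + (c + h)}"
          by blast+
        then show ?thesis using h by auto
      qed
      have Aeq: "A = {0, h, 2 * h, c, c + h, 2 * c}"
      proof -
        have "A = residue_class h A 0 \<union> residue_class h A c \<union> residue_class h A c1"
        proof -
          have "x mod h \<in> T" if "x \<in> A" for x using that by (simp add: T_def residues_def)
          then show ?thesis unfolding Teq by (auto simp: residue_class_def)
        qed
        then show ?thesis unfolding f0 fc y y2 by auto
      qed
      have cd: "c \<noteq> 0" "c1 \<noteq> c" using c0 cc by (auto simp: T0_def)
      have "int (card A) = a 0 + a c + a c1" unfolding card_A Teq using cd c1(2) by simp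
      then have c6: "card A = 6" using a0 ac[of c] cc c0 c1(3) w2 by (simp add: T0_def)
      then show ?thesis using freiman_image_K6I[OF Aeq] s by simp
    qed
  qed
qed

end

section \<open>Sumsets modulo the largest element\<close>

lemma residues_sumI: "c \<in> residues h A \<Longrightarrow> c' \<in> residues h B \<Longrightarrow> (c + c') mod h \<in> residues h (A + B)"
  unfolding residues_sum by (intro image_eqI[of _ _ "(c, c')"]) auto

locale normalized =
  fixes A :: "int set" and n :: int
  assumes fin: "finite A" and A0: "0 \<in> A" and An: "n \<in> A" and sub: "A \<subseteq> {0..n}" and npos: "0 < n"
begin

abbreviation S where "S \<equiv> A + A"

definition missed where "missed = {x \<in> {0..<n}. x \<notin> S \<and> x + n \<notin> S}"

definition doubled where "doubled = {x \<in> {0..<n}. x \<notin> A \<and> x \<in> S \<and> x + n \<in> S}"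

lemma finS: "finite S" using fin by (simp add: finite_set_plus)

lemma S_sub: "S \<subseteq> {0..2 * n}"
proof
  fix z assume "z \<in> S"
  then obtain a b where "a \<in> A" "b \<in> A" "z = a + b" by (auto simp: set_plus_def)
  moreover from this have "a \<in> {0..n}" "b \<in> {0..n}" using sub by auto
  ultimately show "z \<in> {0..2 * n}" by simp
qed

lemma A_S: "x \<in> A \<Longrightarrow> x \<in> S" "x \<in> A \<Longrightarrow> x + n \<in> S"
  using set_plus_intro[OF A0, of x A] set_plus_intro[of x A n A] An by auto

lemma card_res_n: "card (residues n A) + 1 = card A" "residues n A = A - {n}"
proof -
  show eq: "residues n A = A - {n}"
  proof (intro equalityI subsetI)
    fix z assume "z \<in> residues n A"
    then obtain x where x: "x \<in> A" "z = x mod n" by (auto simp: residues_def)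
    show "z \<in> A - {n}"
    proof (cases "x = n")
      case True then show ?thesis using x A0 npos by simp
    next
      case False
      then have "0 \<le> x" "x < n" using x sub by auto
      then show ?thesis using x by simp
    qed
  next
    fix z assume z: "z \<in> A - {n}"
    then have "0 \<le> z" "z < n" using sub by auto
    then have "z = z mod n" by simp
    then show "z \<in> residues n A" unfolding residues_def using z by blast
  qed
  show "card (residues n A) + 1 = card A" unfolding eq using card_Suc_Diff1[OF fin An] by simp
qed

lemma residues_S: "residues n S = {x \<in> {0..<n}. x \<in> S \<or> x + n \<in> S}"
proof (intro equalityI subsetI)
  fix z assume "z \<in> residues n S"
  then obtain x where x: "x \<in> S" "z = x mod n" by (auto simp: residues_def)
  then have "0 \<le> x" "x \<le> 2 * n" using S_sub by auto
  then consider "x < n" | "n \<le> x" "x < 2 * n" | "x = 2 * n" by linarith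
  then show "z \<in> {x \<in> {0..<n}. x \<in> S \<or> x + n \<in> S}"
  proof cases
    case 1 then show ?thesis using x \<open>0 \<le> x\<close> by simp
  next
    case 2
    then have "x mod n = x - n" by (smt (verit) minus_mod_self2 mod_pos_pos_trivial)
    then show ?thesis using x 2 by simp
  next
    case 3 then show ?thesis using x A_S[OF A0] npos by simp
  qed
next
  fix z assume "z \<in> {x \<in> {0..<n}. x \<in> S \<or> x + n \<in> S}"
  then have "z = z mod n" "z = (z + n) mod n" "z \<in> S \<or> z + n \<in> S" by auto
  then show "z \<in> residues n S" unfolding residues_def by blast
qed

lemma finite_classes: "finite (residues n S)" "finite missed" "finite doubled"
    "finite {x \<in> {0..<n}. P x}"
proof -
  show fin: "finite {x \<in> {0..<n}. P x}" for P by (rule finite_subset[of _ "{0..<n}"]) auto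
  show "finite (residues n S)" "finite missed" "finite doubled"
    unfolding residues_S missed_def doubled_def by (rule fin)+
qed

lemma card_res_S: "int (card (residues n S)) + int (card missed) = n"
proof -
  have "{0..<n} = residues n S \<union> missed" "residues n S \<inter> missed = {}"
    by (auto simp: residues_S missed_def)
  then have "card {0..<n} = card (residues n S) + card missed"
    using finite_classes card_Un_disjoint[of "residues n S" missed] by simp
  then show ?thesis using npos by simp
qed

lemma card_S: "int (card S) + int (card missed) = n + int (card A) + int (card doubled)"
proof -
  define P where "P = {x \<in> {0..<n}. x \<in> S}"
  define Q where "Q = {x \<in> {0..<n}. x + n \<in> S}"
  have PQ: "finite P" "finite Q" unfolding P_def Q_def by (rule finite_classes(4))+
  \<comment> \<open>2n is a third representative of class 0, besides 0 and n, and is counted on its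
    own.\<close>
  have S_eq: "S = P \<union> (\<lambda>x. x + n) ` Q \<union> {2 * n}"
  proof (intro equalityI subsetI)
    fix z assume z: "z \<in> S"
    then have "0 \<le> z" "z \<le> 2 * n" using S_sub by auto
    then show "z \<in> P \<union> (\<lambda>x. x + n) ` Q \<union> {2 * n}"
      using z by (auto simp: P_def Q_def intro!: image_eqI[of z _ "z - n"])
  next
    fix z assume "z \<in> P \<union> (\<lambda>x. x + n) ` Q \<union> {2 * n}"
    then show "z \<in> S" using A_S(2)[OF An] by (auto simp: P_def Q_def)
  qed
  have "card S = card P + card Q + 1"
  proof -
    have "card ((\<lambda>x. x + n) ` Q) = card Q" by (intro card_image) (auto simp: inj_on_def)
    moreover have "P \<inter> (\<lambda>x. x + n) ` Q = {}" by (auto simp: P_def Q_def)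
    moreover have "2 * n \<notin> P \<union> (\<lambda>x. x + n) ` Q" using npos by (auto simp: P_def Q_def)
    ultimately show ?thesis using PQ unfolding S_eq by (simp add: card_Un_disjoint)
  qed
  moreover have "card P + card Q = card (P \<union> Q) + card (P \<inter> Q)" using card_Un_Int PQ by blast
  moreover have "P \<union> Q = residues n S" by (auto simp: P_def Q_def residues_S)
  moreover have "P \<inter> Q = (A - {n}) \<union> doubled" "(A - {n}) \<inter> doubled = {}"
    using sub A_S by (auto simp: P_def Q_def doubled_def)
  then have "card (P \<inter> Q) = card (A - {n}) + card doubled"
    using fin finite_classes by (simp add: card_Un_disjoint)
  moreover have "card (A - {n}) + 1 = card A" using card_res_n by simp
  ultimately show ?thesis using card_res_S by simp
qed

text \<open>Without doubled classes, a class outside A contains at most one sum, so congruent sums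
  there are equal integers.\<close>

lemma not_doubled:
  assumes "doubled = {}" "u \<in> S" "v \<in> S" "u mod n = v mod n" "u mod n \<notin> A"
  shows "u = v"
proof -
  let ?x = "u mod n"
  have u: "z = ?x \<or> z = ?x + n" if "z \<in> S" "z mod n = ?x" for z
  proof -
    have z: "0 \<le> z" "z \<le> 2 * n" using S_sub that by auto
    have "z \<noteq> 2 * n" using assms(5) that A0 by auto
    moreover have "z mod n = z - n" if "n \<le> z" "z < 2 * n"
      using that by (smt (verit) minus_mod_self2 mod_pos_pos_trivial)
    moreover have "z mod n = z" if "z < n" using z that by simp
    ultimately show ?thesis using z that by linarith
  qed
  have "0 \<le> ?x" "?x < n" using npos by auto
  then have "\<not> (?x \<in> S \<and> ?x + n \<in> S)" using assms(1,5) by (auto simp: doubled_def)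
  then show ?thesis using u[OF assms(2)] u[OF assms(3)] assms by metis
qed

end

lemma coprime_mult_inj:
  fixes d n :: int
  assumes "coprime d n" "i * d mod n = j * d mod n" "\<bar>i - j\<bar> < n"
  shows "i = j"
proof -
  have "n dvd (i - j) * d" using assms(2) by (simp add: mod_eq_dvd_iff left_diff_distrib)
  then have "n dvd i - j" using assms(1) by (simp add: coprime_commute coprime_dvd_mult_left_iff)
  then show ?thesis using assms(3) zdvd_imp_le[of n "\<bar>i - j\<bar>"] by fastforce
qed

lemma mult_neg_image:
  fixes d n :: int
  shows "(\<lambda>j. j * (- d) mod n) ` {- int j0..int i0} = (\<lambda>j. j * d mod n) ` {- int i0..int j0}"
proof -
  have "{- int i0..int j0} = uminus ` {- int j0..int i0}" by simp
  then show ?thesis by (simp only: image_image mult_minus_left mult_minus_right)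
qed

section \<open>Sets whose residues form a progression\<close>

context normalized
begin

text \<open>For 1 \<le> i < j0 the terms with indices j0 and i have the same sum modulo n as those
  with j0 - 1 and i + 1. The index j0 + i lies beyond the progression, so the class is outside A and
  the sums are equal integers. Consecutive differences are therefore constant from index 1
  on.\<close>

lemma residue_ap_side:
  fixes d :: int and i0 j0 :: nat
  assumes d: "coprime d n" and A: "A = insert n ((\<lambda>j. j * d mod n) ` {- int i0..int j0})"
    and c: "2 * (int i0 + int j0 + 2) \<le> n + 1" and nd: "doubled = {}" and i: "1 \<le> i" "i \<le> int j0"
  shows "i * d mod n = d mod n + (i - 1) * (2 * d mod n - d mod n)"
proof -
  define \<alpha> where "\<alpha> j = j * d mod n" for j
  have mem: "\<alpha> j \<in> A" if "- int i0 \<le> j" "j \<le> int j0" for j using A that by (auto simp: \<alpha>_def)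
  have notin: "\<alpha> j \<notin> A" if j: "int j0 < j" "j \<le> 2 * int j0" for j
  proof
    assume "\<alpha> j \<in> A"
    moreover have "\<alpha> j \<noteq> n" unfolding \<alpha>_def using pos_mod_bound[OF npos, of "j * d"] by linarith
    ultimately obtain l where l: "- int i0 \<le> l" "l \<le> int j0" "\<alpha> j = \<alpha> l" using A
      \<comment> \<open>Indices between -i0 and 2 j0 differ by less than n, so none beyond j0 wraps
        round to an element.\<close>
      by (auto simp: \<alpha>_def)
    then show False using coprime_mult_inj[OF d, of j l] j c by (simp add: \<alpha>_def)
  qed
  have equal: "\<alpha> (int j0) + \<alpha> i = \<alpha> (int j0 - 1) + \<alpha> (i + 1)" if i: "1 \<le> i" "i < int j0" for i
  proof (rule not_doubled[OF nd])
    show "\<alpha> (int j0) + \<alpha> i \<in> S" "\<alpha> (int j0 - 1) + \<alpha> (i + 1) \<in> S"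
      using i by (auto intro!: set_plus_intro mem)
    have "(\<alpha> (int j0) + \<alpha> i) mod n = \<alpha> (int j0 + i)"
      by (simp add: \<alpha>_def mod_add_eq distrib_right)
    moreover have "(\<alpha> (int j0 - 1) + \<alpha> (i + 1)) mod n = \<alpha> (int j0 + i)"
      by (simp add: \<alpha>_def mod_add_eq) (simp add: algebra_simps)
    ultimately show "(\<alpha> (int j0) + \<alpha> i) mod n = (\<alpha> (int j0 - 1) + \<alpha> (i + 1)) mod n"
      "(\<alpha> (int j0) + \<alpha> i) mod n \<notin> A" using notin i by auto
  qed
  have lin: "1 \<le> i \<longrightarrow> i \<le> int j0 \<longrightarrow> \<alpha> i = \<alpha> 1 + (i - 1) * (\<alpha> 2 - \<alpha> 1)"
  proof (cases "1 \<le> i")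
    case True
    then show ?thesis
    proof (induction i rule: int_ge_induct)
      case (step i)
      show ?case
      proof (intro impI)
        assume "i + 1 \<le> int j0"
        then have "\<alpha> i = \<alpha> 1 + (i - 1) * (\<alpha> 2 - \<alpha> 1)" using step by simp
        moreover have "\<alpha> (i + 1) - \<alpha> i = \<alpha> 2 - \<alpha> 1"
          using \<open>i + 1 \<le> int j0\<close> equal[of i] equal[of 1] step.hyps by simp
        ultimately show "\<alpha> (i + 1) = \<alpha> 1 + (i + 1 - 1) * (\<alpha> 2 - \<alpha> 1)" by (simp add: algebra_simps)
      qed
    qed simp
  qed simp
  then show ?thesis using i by (simp add: \<alpha>_def)
qed

text \<open>If D = d mod n is below n/2, then doubling it causes no reduction. Nonnegative indices
  give the multiples of D going up from 0, negative ones the numbers n - iD going down from n: two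
  progressions with the same difference.\<close>

lemma residue_ap_half:
  fixes d :: int and i0 j0 :: nat
  assumes d: "coprime d n" and A: "A = insert n ((\<lambda>j. j * d mod n) ` {- int i0..int j0})"
    and cA: "card A = i0 + j0 + 2"
    and c: "2 * (int i0 + int j0 + 2) \<le> n + 1" and nd: "doubled = {}" and s: "card S = 3 * card A - 3"
    and D: "2 * (d mod n) < n"
  shows "bi_arith_prog A"
proof -
  define D where "D = d mod n"
  have n1: "1 < n" using c by simp
  have D0: "0 < D"
  proof -
    have "\<not> n dvd d" using coprime_common_divisor[OF d, of n] n1 by auto
    then show ?thesis using npos by (simp add: D_def dvd_eq_mod_eq_0 order_less_le)
  qed
  have m2: "2 * d mod n = 2 * D"
    using D D0
      by (metis D_def mod_mult_right_eq mod_pos_pos_trivial mult_nonneg_nonneg order_less_imp_le zero_le_numeral)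
  have neg1: "(- d) mod n = n - D" using D0 npos by (simp add: D_def zmod_zminus1_eq_if)
  have neg2: "2 * (- d) mod n = n - 2 * D"
    using m2 D0 npos zmod_zminus1_eq_if[of "2 * d" n] by simp
  have up: "i * d mod n = i * D" if "0 \<le> i" "i \<le> int j0" for i
    using residue_ap_side[OF d A c nd, of i] that m2 npos
      by (cases "i = 0") (auto simp: D_def[symmetric] algebra_simps)
  have A': "A = insert n ((\<lambda>j. j * (- d) mod n) ` {- int j0..int i0})"
  proof -
    show ?thesis using A mult_neg_image[of d n j0 i0] by simp
  qed
  have down: "(- i) * d mod n = n - i * D" if "1 \<le> i" "i \<le> int i0" for i
  proof -
    have "i * (- d) mod n = (- d) mod n + (i - 1) * (2 * (- d) mod n - (- d) mod n)"
      by (rule residue_ap_side[of "- d" j0 i0 i]) (use d A' c nd that in \<open>auto simp: add_ac\<close>)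
    also have "\<dots> = n - i * D" unfolding neg1 neg2 by (simp add: algebra_simps)
    finally show ?thesis by simp
  qed
  have "A = (\<lambda>i. 0 + i * D) ` {0..int j0} \<union> (\<lambda>i. (n - int i0 * D) + i * D) ` {0..int i0}"
  proof (intro equalityI subsetI)
    fix x assume "x \<in> A"
    then consider "x = n" | j where "0 \<le> j" "j \<le> int j0" "x = j * d mod n"
      | j where "1 \<le> j" "j \<le> int i0" "x = (- j) * d mod n"
    proof -
      assume x: "x \<in> A"
        and 1: "x = n \<Longrightarrow> thesis" and 2: "\<And>j. 0 \<le> j \<Longrightarrow> j \<le> int j0 \<Longrightarrow> x = j * d mod n \<Longrightarrow> thesis"
        and 3: "\<And>j. 1 \<le> j \<Longrightarrow> j \<le> int i0 \<Longrightarrow> x = (- j) * d mod n \<Longrightarrow> thesis"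
      show thesis
      proof (cases "x = n")
        case False
        then obtain j where "- int i0 \<le> j" "j \<le> int j0" "x = j * d mod n" using x A by auto
        then show ?thesis using 2[of j] 3[of "- j"] by (cases "0 \<le> j") auto
      qed (rule 1)
    qed
    then show "x \<in> (\<lambda>i. 0 + i * D) ` {0..int j0} \<union> (\<lambda>i. (n - int i0 * D) + i * D) ` {0..int i0}"
    proof cases
      case 1 then show ?thesis by (intro UnI2 image_eqI[of _ _ "int i0"]) auto
    next
      case 2 then show ?thesis using up by auto
    next
      case 3 then show ?thesis using down[of j]
        by (intro UnI2 image_eqI[of _ _ "int i0 - j"]) (auto simp: algebra_simps)
    qed
  next
    fix x assume "x \<in> (\<lambda>i. 0 + i * D) ` {0..int j0} \<union> (\<lambda>i. (n - int i0 * D) + i * D) ` {0..int i0}"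
    then consider i where "0 \<le> i" "i \<le> int j0" "x = i * D"
      | i where "0 \<le> i" "i \<le> int i0" "x = n - int i0 * D + i * D" by auto
    then show "x \<in> A"
    proof cases
      case 1
      then have "x = i * d mod n" using up by simp
      then show ?thesis using 1 A by auto
    next
      case 2
      show ?thesis
      proof (cases "i = int i0")
        case True then show ?thesis using 2 An by simp
      next
        case False
        then have "x = (- (int i0 - i)) * d mod n" using down[of "int i0 - i"] 2
          by (simp add: algebra_simps)
        then show ?thesis using 2 A by (subst A) (auto intro!: image_eqI[of _ _ "- (int i0 - i)"])
      qed
    qed
  qed
  then show ?thesis by (rule bi_arith_progI) (use cA s in auto)
qed

text \<open>Reversing the progression replaces d by -d, so D < n/2 may be assumed; D = n/2 would
  make n divide 2.\<close>

lemma residue_ap: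
  fixes d :: int and i0 j0 :: nat
  assumes d: "coprime d n" and A: "A = insert n ((\<lambda>j. j * d mod n) ` {- int i0..int j0})"
    and cA: "card A = i0 + j0 + 2"
    and c: "2 * (int i0 + int j0 + 2) \<le> n + 1" and nd: "doubled = {}" and s: "card S = 3 * card A - 3"
  shows "bi_arith_prog A"
proof -
  have n1: "2 < n" using c by simp
  have ne: "2 * (d mod n) \<noteq> n"
  proof
    assume "2 * (d mod n) = n"
    then have "2 * d mod n = 0" by (metis mod_mult_right_eq mod_self)
    then have "n dvd 2 * d" by (simp add: dvd_eq_mod_eq_0)
    then have "n dvd 2" using d by (simp add: coprime_commute coprime_dvd_mult_left_iff)
    then show False using n1 zdvd_imp_le by fastforce
  qed
  show ?thesis
  proof (cases "2 * (d mod n) < n")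
    case True
    then show ?thesis using residue_ap_half[OF d A cA c nd s] by simp
  next
    case False
    have A': "A = insert n ((\<lambda>j. j * (- d) mod n) ` {- int j0..int i0})"
    proof -
      show ?thesis using A mult_neg_image[of d n j0 i0] by simp
    qed
    have "d mod n \<noteq> 0" using False npos by auto
    then have "2 * ((- d) mod n) < n" using False ne by (simp add: zmod_zminus1_eq_if)
    moreover have "coprime (- d) n" using d by simp
    ultimately show ?thesis using residue_ap_half[of "- d" j0 i0] A' cA c nd s
      by (simp add: add.commute)
  qed
qed

text \<open>The least admissible modulus h forces |2T| \<ge> 2|T| - 1 for the classes T. Otherwise T
  is itself critical modulo h: as a progression it has 2|T| - 1 sums after all, and near periodicity
  would yield a smaller modulus.\<close>

lemma periodic_case:
  assumes gcd1: "Gcd A = 1" and nk: "2 * int (card A) \<le> n + 2" and s: "card S = 3 * card A - 3"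
    and h0: "h0 dvd n" "1 < h0" "h0 < n"
      "int (card (residues h0 A)) * (n div h0) + 2 \<le> int (card A) + n div h0"
  shows "bi_arith_prog A \<or> card A = 6 \<and> freiman_image K6 A"
proof -
  define Q where "Q h \<longleftrightarrow> int h dvd n \<and> 1 < int h \<and> int h < n \<and>
      int (card (residues (int h) A)) * (n div int h) + 2 \<le> int (card A) + n div int h" for h
  have Q0: "Q (nat h0)" using h0 by (simp add: Q_def)
  define h where "h = int (LEAST h. Q h)"
  have Qh: "Q (nat h)" using LeastI[of Q, OF Q0] by (simp add: h_def)
  have least: "\<not> Q g" if "int g < h" for g using not_less_Least[of g Q] that by (simp add: h_def)
  have h: "h dvd n" "1 < h" "h < n"
      "int (card (residues h A)) * (n div h) + 2 \<le> int (card A) + n div h"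
    using Qh by (auto simp: Q_def h_def)
  define w where "w = n div h"
  have nw: "n = h * w" using h by (simp add: w_def)
  have w: "2 \<le> w"
  proof -
    have "w \<noteq> 1" "0 < w" using nw h npos by (auto simp: zero_less_mult_iff)
    then show ?thesis by simp
  qed
  define t where "t = card (residues h A)"
  have finT: "finite (residues h A)" using fin by (simp add: residues_def)
  have T0: "0 \<in> residues h A" using imageI[OF A0, of "\<lambda>a. a mod h"] by (simp add: residues_def)
  have t2: "2 \<le> t"
  proof (rule ccontr)
    assume "\<not> 2 \<le> t"
    then have "card (residues h A) \<le> 1" by (simp add: t_def)
    then have "residues h A = {0}" using T0 finT card_le_Suc0_iff_eq[OF finT] by auto
    then have "h dvd x" if "x \<in> A" for x using that by (auto simp: residues_def)
    then have "h dvd Gcd A" by (rule Gcd_greatest)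
    then show False using gcd1 h by simp
  qed
  have ht: "2 * int t - 2 < h"
  proof -
    have "int t * w + 2 \<le> int (card A) + w" using h by (simp add: t_def w_def)
    then have "(2 * int t - 2) * w < h * w" using nk nw by (simp add: algebra_simps)
    then show ?thesis using w by simp
  qed
  have "2 * t \<le> card (residues h (A + A)) + 1"
  proof (rule ccontr)
    assume neg: "\<not> ?thesis"
    have hpos: "0 < h" using h by simp
    consider "int (card (residues h S)) + 2 \<le> h" | "h \<le> int (card (residues h S)) + 1" by linarith
    then show False
    proof cases
      case 1
      have c2: "card (residues h S) + 1 \<le> 2 * card (residues h A)" using neg by (simp add: t_def)
      have two: "2 \<le> card (residues h A)" using t2 by (simp add: t_def)
      consider (ap) d i0 where "coprime d h" "i0 < card (residues h A)"
          "residues h A = (\<lambda>j. j * d mod h) ` {- int i0..int (card (residues h A)) - 1 - int i0}"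
        | (sub) g where "g dvd h" "1 < g" "g < h"
          "int (card (residues g A)) * (h div g) + 1 \<le> int (card (residues h A)) + h div g"
        by (rule residue_critical[OF fin A0 gcd1 hpos two 1 c2])
      then show False
      proof cases
        case (ap d i0)
        have "(\<lambda>j. j * d mod h) ` {- 2 * int i0..2 * (int t - 1 - int i0)} \<subseteq> residues h S"
        proof
          fix z assume "z \<in> (\<lambda>j. j * d mod h) ` {- 2 * int i0..2 * (int t - 1 - int i0)}"
          then obtain j where j: "- 2 * int i0 \<le> j" "j \<le> 2 * (int t - 1 - int i0)" "z = j * d mod h"
            by auto
          define p where "p = j div 2"
          have p: "- int i0 \<le> p" "p \<le> int t - 1 - int i0" "- int i0 \<le> j - p"
              "j - p \<le> int t - 1 - int i0"
            using j by (auto simp: p_def)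
          have mem: "q * d mod h \<in> residues h A" if "- int i0 \<le> q" "q \<le> int t - 1 - int i0" for q
            using ap(3) that by (auto simp: t_def)
          have "(p * d mod h + (j - p) * d mod h) mod h = (p * d + (j - p) * d) mod h"
            by (simp only: mod_add_eq)
          also have "\<dots> = z" unfolding j(3)
            by (rule arg_cong[where f = "\<lambda>x. x mod h"]) (simp add: left_diff_distrib)
          finally show "z \<in> residues h S"
            by (rule back_subst[where P = "\<lambda>x. x \<in> residues h S", OF residues_sumI[OF mem[OF p(1,2)] mem[OF p(3,4)]]])
        qed
        moreover have "inj_on (\<lambda>j. j * d mod h) {- 2 * int i0..2 * (int t - 1 - int i0)}"
        proof (rule inj_onI)
          fix i j assume ij: "i \<in> {- 2 * int i0..2 * (int t - 1 - int i0)}"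
              "j \<in> {- 2 * int i0..2 * (int t - 1 - int i0)}"
            and eq: "i * d mod h = j * d mod h"
          have "\<bar>i - j\<bar> < h" using ij ht by auto
          then show "i = j" by (rule coprime_mult_inj[OF ap(1) eq])
        qed
        then have "card ((\<lambda>j. j * d mod h) ` {- 2 * int i0..2 * (int t - 1 - int i0)}) = nat (2 * int t - 1)"
          by (simp add: card_image algebra_simps)
        moreover have "finite (residues h S)" using finS by (simp add: residues_def)
        ultimately have "nat (2 * int t - 1) \<le> card (residues h S)" by (metis card_mono)
        then show False using neg t2 by linarith
      next
        case (sub g)
        have gpos: "0 < g" using sub by simp
        have eq: "n div g = (h div g) * w" using sub(1) nw
          by (simp add: div_mult_swap mult.commute dvd_div_mult)
        \<comment> \<open>Near periodicity is transitive: scaling the deficit modulo g by w and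
          adding the deficit modulo h gives the condition for g, against the choice of h.\<close>
        have "(int (card (residues g A)) * (h div g) + 1) * w \<le> (int t + h div g) * w"
          using sub(4) w by (intro mult_right_mono) (auto simp: t_def)
        moreover have "int t * w + 2 \<le> int (card A) + w" using h by (simp add: t_def w_def)
        ultimately have "int (card (residues g A)) * (n div g) + 2 \<le> int (card A) + n div g"
          unfolding eq by (simp add: algebra_simps)
        then have "Q (nat g)" using sub gpos h dvd_trans[OF sub(1) h(1)] by (simp add: Q_def)
        then show False using least[of "nat g"] sub gpos by simp
      qed
    next
      case 2
      have resS: "residues h S \<subseteq> {0..<h}" using residues_subset[OF hpos] .
      have "residues h S \<noteq> {0..<h}"
      proof
        assume "residues h S = {0..<h}"
        then have "int (card (residues h S)) = h" using hpos by simp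
        then show False using neg ht by linarith
      qed
      then obtain z where z: "z \<in> {0..<h}" "z \<notin> residues h S" using resS by blast
      \<comment> \<open>Here 2T covers all classes except at most one, yet not all of them. A
        missing z pairs c with z - c, so 2|T| \<le> h, which is incompatible with |2T| \<le> 2|T| -
        2.\<close>
      have disj: "residues h A \<inter> (\<lambda>c. (z - c) mod h) ` residues h A = {}"
      proof (rule ccontr)
        assume "residues h A \<inter> (\<lambda>c. (z - c) mod h) ` residues h A \<noteq> {}"
        then obtain c c' where c: "c \<in> residues h A" "c' \<in> residues h A" "c' = (z - c) mod h"
          by auto
        then have "(c + c') mod h = z mod h" by (simp add: mod_simps)
        then have "(c + c') mod h = z" using z by simp
        then show False using residues_sumI[OF c(1,2)] z(2) by (simp only:)
      qed
      have "inj_on (\<lambda>c. (z - c) mod h) (residues h A)"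
      proof (rule inj_onI)
        fix c c' assume c: "c \<in> residues h A" "c' \<in> residues h A" "(z - c) mod h = (z - c') mod h"
        then have "h dvd (z - c) - (z - c')" by (simp only: mod_eq_dvd_iff)
        then have "c' mod h = c mod h" by (simp add: mod_eq_dvd_iff)
        moreover have "c \<in> {0..<h}" "c' \<in> {0..<h}" using c residues_subset[OF hpos, of A] by blast+
        ultimately show "c = c'" by (metis atLeastLessThan_iff mod_pos_pos_trivial)
      qed
      then have "card ((\<lambda>c. (z - c) mod h) ` residues h A) = t" by (simp add: card_image t_def)
      then have "card (residues h A \<union> (\<lambda>c. (z - c) mod h) ` residues h A) = 2 * t"
        using disj finT by (simp add: card_Un_disjoint t_def)
      moreover have "residues h A \<union> (\<lambda>c. (z - c) mod h) ` residues h A \<subseteq> {0..<h}"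
        using residues_subset[OF hpos, of A] hpos by (auto simp: subset_iff)
      ultimately have "2 * t \<le> card {0..<h}" 
        using card_mono[of "{0..<h}" "residues h A \<union> (\<lambda>c. (z - c) mod h) ` residues h A"] by simp
      then have "2 * int t \<le> h" using hpos by simp
      then show False using neg 2 by linarith
    qed
  qed
  then have "class_setup A n h w"
    using class_setup.intro[OF fin A0 An sub gcd1 h(2) nw w h(4)[folded w_def] _ s]
      by (simp only: t_def)
  then show ?thesis by (rule class_setup.bi_arith_prog_or_K6)
qed

lemma sparse_case:
  assumes gcd1: "Gcd A = 1" and nk: "2 * int (card A) \<le> n + 1" and s: "card S = 3 * card A - 3" and k3: "3 \<le> card A"
  shows "bi_arith_prog A \<or> card A = 6 \<and> freiman_image K6 A"
proof -
  have s': "int (card S) = 3 * int (card A) - 3" using s k3 by simp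
  have cr: "int (card (residues n S)) + int (card doubled) = 2 * int (card A) - 3"
    using card_S card_res_S s' by linarith
  have two: "2 \<le> card (residues n A)" using card_res_n(1) k3 by linarith
  have c1: "int (card (residues n S)) + 2 \<le> n" using cr nk by linarith
  have c2: "card (residues n S) + 1 \<le> 2 * card (residues n A)" using cr card_res_n(1) by linarith
  consider (ap) d i0 where "coprime d n" "i0 < card (residues n A)"
      "residues n A = (\<lambda>j. j * d mod n) ` {- int i0..int (card (residues n A)) - 1 - int i0}"
    | (sub) h where "h dvd n" "1 < h" "h < n"
      "int (card (residues h A)) * (n div h) + 1 \<le> int (card (residues n A)) + n div h"
    by (rule residue_critical[OF fin A0 gcd1 npos two c1 c2])
  then show ?thesis
  proof cases
    case (ap d i0)
    define t where "t = card (residues n A)"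
    define j0 where "j0 = t - 1 - i0"
    have j0: "int j0 = int t - 1 - int i0" using ap(2) by (simp add: j0_def t_def)
    have R: "residues n A = (\<lambda>j. j * d mod n) ` {- int i0..int j0}" using ap(3)
      by (simp add: j0 t_def)
    have A: "A = insert n ((\<lambda>j. j * d mod n) ` {- int i0..int j0})"
      unfolding R[symmetric] card_res_n(2) using An by blast
    have tk: "card A = t + 1" using card_res_n(1) by (simp add: t_def)
    then have cA: "card A = i0 + j0 + 2" using j0 by linarith
    have "(\<lambda>j. j * d mod n) ` {- 2 * int i0..2 * int j0} \<subseteq> residues n S"
    proof
      fix z assume "z \<in> (\<lambda>j. j * d mod n) ` {- 2 * int i0..2 * int j0}"
      then obtain j where j: "- 2 * int i0 \<le> j" "j \<le> 2 * int j0" "z = j * d mod n" by auto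
      define p where "p = j div 2"
      have p: "- int i0 \<le> p" "p \<le> int j0" "- int i0 \<le> j - p" "j - p \<le> int j0" using j
        by (auto simp: p_def)
      have "(p * d mod n + (j - p) * d mod n) mod n = (p * d + (j - p) * d) mod n"
        by (simp only: mod_add_eq)
      also have "\<dots> = z" unfolding j(3)
        by (rule arg_cong[where f = "\<lambda>x. x mod n"]) (simp add: left_diff_distrib)
      finally have eq: "(p * d mod n + (j - p) * d mod n) mod n = z" .
      have mem: "q * d mod n \<in> residues n A" if "- int i0 \<le> q" "q \<le> int j0" for q
        unfolding R using that by auto
      show "z \<in> residues n S"
        by (rule back_subst[where P = "\<lambda>x. x \<in> residues n S", OF residues_sumI[OF mem[OF p(1,2)] mem[OF p(3,4)]] eq])
    qed
    moreover have "inj_on (\<lambda>j. j * d mod n) {- 2 * int i0..2 * int j0}"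
    proof (rule inj_onI)
      fix i j assume ij: "i \<in> {- 2 * int i0..2 * int j0}" "j \<in> {- 2 * int i0..2 * int j0}"
        and eq: "i * d mod n = j * d mod n"
      have "\<bar>i - j\<bar> < n" using ij nk cA by auto
      then show "i = j" by (rule coprime_mult_inj[OF ap(1) eq])
    qed
    then have "card ((\<lambda>j. j * d mod n) ` {- 2 * int i0..2 * int j0}) = nat (2 * int i0 + 2 * int j0 + 1)"
      by (simp add: card_image algebra_simps)
    ultimately have "nat (2 * int i0 + 2 * int j0 + 1) \<le> card (residues n S)"
      using finite_classes(1) by (metis card_mono)
    \<comment> \<open>The progression has 2|A| - 3 distinct residues in its sumset, which is all
      that the count of hit and doubled classes allows.\<close>
    then have "card doubled = 0" using cr cA by linarith
    then have nd: "doubled = {}" using finite_classes by simp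
    have "2 * (int i0 + int j0 + 2) \<le> n + 1" using nk cA by simp
    then show ?thesis using residue_ap[OF ap(1) A cA _ nd s] by blast
  next
    case (sub h)
    then have "int (card (residues h A)) * (n div h) + 2 \<le> int (card A) + n div h"
      using card_res_n(1) by linarith
    then show ?thesis using periodic_case[OF gcd1 _ s sub(1,2,3)] nk by simp
  qed
qed

end

section \<open>Counting by reflection\<close>

text \<open>At most one of i and s - i lies in A when s is not a sum. A slack of one in the
  tightness condition allows for an unpaired midpoint; then exactly one of each pair lies in
  A.\<close>

lemma reflection_pigeonhole:
  fixes A :: "int set"
  assumes s: "s \<notin> A + A" and uv: "u + v = s" "u \<le> v + 1"
  shows "2 * int (card (A \<inter> {u..v})) \<le> v - u + 1"
    and "v - u \<le> 2 * int (card (A \<inter> {u..v})) \<Longrightarrow> i \<in> {u..v} \<Longrightarrow> 2 * i \<noteq> s \<Longrightarrow> i \<in> A \<longleftrightarrow> s - i \<notin> A"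
proof -
  define B where "B = A \<inter> {u..v}"
  define R where "R = (\<lambda>i. s - i) ` B"
  have fin: "finite B" "finite R" by (auto simp: B_def R_def)
  have disj: "B \<inter> R = {}"
  proof (rule ccontr)
    assume "B \<inter> R \<noteq> {}"
    then obtain i j where "i \<in> A" "j \<in> A" "i = s - j" by (auto simp: B_def R_def)
    then have "i + j = s" by simp
    then show False using s set_plus_intro[OF \<open>i \<in> A\<close> \<open>j \<in> A\<close>] by simp
  qed
  have cR: "card R = card B" unfolding R_def by (intro card_image) (auto simp: inj_on_def)
  have BR: "B \<union> R \<subseteq> {u..v}" using uv by (auto simp: B_def R_def)
  have c: "card (B \<union> R) = 2 * card B" using card_Un_disjoint[OF fin disj] cR by simp
  have cuv: "int (card {u..v}) = v - u + 1" using uv by simp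
  show le: "2 * int (card (A \<inter> {u..v})) \<le> v - u + 1"
    using card_mono[OF finite_atLeastAtMost_int BR] c cuv unfolding B_def by linarith
  show "i \<in> A \<longleftrightarrow> s - i \<notin> A" if tight: "v - u \<le> 2 * int (card (A \<inter> {u..v}))" and i: "i \<in> {u..v}"
      "2 * i \<noteq> s"
  proof
    assume "i \<in> A"
    then show "s - i \<notin> A" using s set_plus_intro[of i A "s - i" A] by auto
  next
    assume "s - i \<notin> A"
    show "i \<in> A"
    proof (rule ccontr)
      assume "i \<notin> A"
      have "{i, s - i} \<inter> (B \<union> R) = {}" using \<open>i \<notin> A\<close> \<open>s - i \<notin> A\<close> by (auto simp: B_def R_def)
      moreover have "card {i, s - i} = 2" using i by auto
      ultimately have "card ({i, s - i} \<union> (B \<union> R)) = 2 + 2 * card B"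
        using c fin by (subst card_Un_disjoint) auto
      moreover have "{i, s - i} \<union> (B \<union> R) \<subseteq> {u..v}" using BR i uv by auto
      ultimately have "2 + 2 * card B \<le> card {u..v}" by (metis card_mono finite_atLeastAtMost_int)
      then show False using tight cuv unfolding B_def by linarith
    qed
  qed
qed

text \<open>A walk in x: it is 0 at x = -1 and steps by +1 at elements and by -1 at other
  nonnegative integers.\<close>

definition excess :: "int set \<Rightarrow> int \<Rightarrow> int" where
  "excess A x = 2 * int (card (A \<inter> {0..x})) - (x + 1)"

lemma excess_m1: "excess A (- 1) = 0" by (simp add: excess_def)

lemma excess_step: "0 \<le> x \<Longrightarrow> excess A x = excess A (x - 1) + (if x \<in> A then 1 else - 1)"
proof -
  assume x: "0 \<le> x"
  have "{0..x} = insert x {0..x - 1}" using x by auto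
  then have "A \<inter> {0..x} = (if x \<in> A then insert x (A \<inter> {0..x - 1}) else A \<inter> {0..x - 1})" by auto
  then show ?thesis by (simp add: excess_def)
qed

lemma excess_nonmem: "0 \<le> x \<Longrightarrow> x \<notin> A \<Longrightarrow> excess A x = excess A (x - 1) - 1"
  by (simp add: excess_step)

lemma excess_suc: "- 1 \<le> x \<Longrightarrow> x + 1 \<in> A \<Longrightarrow> excess A (x + 1) = excess A x + 1"
  "- 1 \<le> x \<Longrightarrow> x + 1 \<notin> A \<Longrightarrow> excess A (x + 1) = excess A x - 1"
  using excess_step[of "x + 1" A] by simp_all

lemma excess_diff:
  assumes "0 \<le> u" "u \<le> v + 1"
  shows "2 * int (card (A \<inter> {u..v})) = excess A v - excess A (u - 1) + (v - u + 1)"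
proof -
  have "A \<inter> {0..v} = (A \<inter> {0..u - 1}) \<union> (A \<inter> {u..v})" using assms by auto
  moreover have "card ((A \<inter> {0..u - 1}) \<union> (A \<inter> {u..v})) = card (A \<inter> {0..u - 1}) + card (A \<inter> {u..v})"
    by (rule card_Un_disjoint) auto
  ultimately have "card (A \<inter> {0..v}) = card (A \<inter> {0..u - 1}) + card (A \<inter> {u..v})" by (simp only:)
  then show ?thesis by (simp add: excess_def)
qed

lemma excess_parity: "even (excess A x + x + 1)" by (simp add: excess_def)

lemma excess_lipschitz:
  assumes "- 1 \<le> x" "x \<le> y"
  shows "excess A y \<le> excess A x + (y - x)" "excess A x \<le> excess A y + (y - x)"
proof -
  have "card (A \<inter> {x + 1..y}) \<le> card {x + 1..y}" by (intro card_mono) auto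
  then have "int (card (A \<inter> {x + 1..y})) \<le> y - x" using assms by simp
  then show "excess A y \<le> excess A x + (y - x)" "excess A x \<le> excess A y + (y - x)"
    using excess_diff[of "x + 1" y A] assms by auto
qed

lemma excess_run:
  assumes "- 1 \<le> x" "x \<le> y"
  shows "(\<And>z. x < z \<Longrightarrow> z \<le> y \<Longrightarrow> z \<in> A) \<Longrightarrow> excess A y = excess A x + (y - x)"
    and "(\<And>z. x < z \<Longrightarrow> z \<le> y \<Longrightarrow> z \<notin> A) \<Longrightarrow> excess A y = excess A x - (y - x)"
proof -
  show "excess A y = excess A x + (y - x)" if "\<And>z. x < z \<Longrightarrow> z \<le> y \<Longrightarrow> z \<in> A"
  proof -
    have "A \<inter> {x + 1..y} = {x + 1..y}" using that by auto
    then show ?thesis using excess_diff[of "x + 1" y A] assms by simp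
  qed
  show "excess A y = excess A x - (y - x)" if "\<And>z. x < z \<Longrightarrow> z \<le> y \<Longrightarrow> z \<notin> A"
  proof -
    have "A \<inter> {x + 1..y} = {}" using that by auto
    then show ?thesis using excess_diff[of "x + 1" y A] assms by simp
  qed
qed

text \<open>A discrete intermediate value property. The walk moves by unit steps, so it first
  reaches the lower level by a downward step, that is, at a non-element.\<close>

lemma excess_crossing:
  assumes "- 1 \<le> x" "x \<le> y" "l < excess A x" "excess A y \<le> l"
  obtains z where "x < z" "z \<le> y" "z \<notin> A" "excess A z = l"
proof -
  have "excess A y \<le> l \<longrightarrow> (\<exists>z. x < z \<and> z \<le> y \<and> z \<notin> A \<and> excess A z = l)"
    using assms(2)
  proof (induction y rule: int_ge_induct)
    case base
    show ?case using assms(3) by simp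
  next
    case (step y)
    show ?case
    proof
      assume le: "excess A (y + 1) \<le> l"
      show "\<exists>z>x. z \<le> y + 1 \<and> z \<notin> A \<and> excess A z = l"
      proof (cases "excess A y \<le> l")
        case True
        then obtain z where "x < z" "z \<le> y" "z \<notin> A" "excess A z = l" using step by blast
        then show ?thesis by (intro exI[of _ z]) auto
      next
        case False
        then have "y + 1 \<notin> A" "excess A (y + 1) = l"
          using le excess_step[of "y + 1" A] step assms(1) by (auto split: if_splits)
        then show ?thesis using step by (intro exI[of _ "y + 1"]) auto
      qed
    qed
  qed
  then show ?thesis using assms(4) that by blast
qed

lemma excess_low:
  assumes "0 \<le> x" "x \<notin> A + A"
  shows "excess A x \<le> 0"
    and "- 1 \<le> excess A x \<Longrightarrow> 0 \<le> i \<Longrightarrow> i \<le> x \<Longrightarrow> 2 * i \<noteq> x \<Longrightarrow> i \<in> A \<longleftrightarrow> x - i \<notin> A"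
proof -
  show "excess A x \<le> 0"
    using reflection_pigeonhole(1)[OF assms(2), of 0 x] assms(1) by (simp add: excess_def)
  show "i \<in> A \<longleftrightarrow> x - i \<notin> A" if "- 1 \<le> excess A x" "0 \<le> i" "i \<le> x" "2 * i \<noteq> x"
    by (rule reflection_pigeonhole(2)[OF assms(2), of 0 x]) (use that in \<open>auto simp: excess_def\<close>)
qed

text \<open>The part up to \<^term>\<open>F\<close> of a symmetric numerical semigroup with Frobenius number \<^term>\<open>F\<close>.\<close>

locale sym_semigroup =
  fixes L :: "int set" and F :: int
  assumes F: "1 \<le> F" and L: "L \<subseteq> {0..F}" "0 \<in> L"
    and sym: "\<And>x. 0 \<le> x \<Longrightarrow> x \<le> F \<Longrightarrow> x \<in> L \<longleftrightarrow> F - x \<notin> L"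
    and closed: "\<And>a b. a \<in> L \<Longrightarrow> b \<in> L \<Longrightarrow> a + b \<le> F \<Longrightarrow> a + b \<in> L"
begin

lemma F_notin: "F \<notin> L" using sym[of 0] F L by simp

lemma F_odd: "odd F"
proof
  assume "even F"
  then obtain m where "F = 2 * m" by (auto elim: evenE)
  then show False using sym[of m] F by simp
qed

lemma multiples: "a \<in> L \<Longrightarrow> int j * a \<le> F \<Longrightarrow> int j * a \<in> L"
proof (induction j)
  case (Suc j)
  have "0 \<le> a" using Suc L by auto
  then have "int j * a \<le> F" using Suc by (simp add: algebra_simps)
  then have "a + int j * a \<in> L" using Suc by (intro closed) (auto simp: algebra_simps)
  then show ?case by (simp add: algebra_simps)
qed (use L in simp)

lemma one_notin: "1 \<notin> L"
  using multiples[of 1 "nat F"] F F_notin by auto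

text \<open>For F = 1 the set is {0} and 2 is out of range, yet the conclusion is the same.
  Otherwise 2 generates the even numbers, and symmetry about the odd F excludes the odd
  ones.\<close>

lemma evens_if_two:
  assumes "2 \<in> L \<or> F = 1" "0 \<le> x" "x \<le> F"
  shows "x \<in> L \<longleftrightarrow> even x"
proof -
  have ev: "x \<in> L" if "0 \<le> x" "x \<le> F" "even x" for x
  proof (cases "F = 1")
    case True
    then have "x = 0" using that by (cases "x = 1") auto
    then show ?thesis using L by simp
  next
    case False
    obtain m where "x = 2 * m" using \<open>even x\<close> by (auto elim: evenE)
    then show ?thesis using multiples[of 2 "nat m"] False assms(1) that by (simp add: mult.commute)
  qed
  show ?thesis
  proof (cases "even x")
    case False
    then have "F - x \<in> L" using assms F_odd by (intro ev) auto
    then show ?thesis using sym[of x] assms False by simp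
  qed (use ev assms in simp)
qed

lemma nonmem_not_sum: "x \<le> F \<Longrightarrow> x \<notin> L \<Longrightarrow> x \<notin> L + L"
  using closed by (auto elim!: set_plus_elim)

lemma excess_nonmem_le: "0 \<le> x \<Longrightarrow> x \<le> F \<Longrightarrow> x \<notin> L \<Longrightarrow> excess L x \<le> 0"
  by (rule excess_low(1)[OF _ nonmem_not_sum])

text \<open>A value of 2 or more would have to pass level 1 at a non-element on the way down to F,
  but non-elements have excess at most 0.\<close>

lemma excess_le_1: "- 1 \<le> x \<Longrightarrow> x < F \<Longrightarrow> excess L x \<le> 1"
proof (rule ccontr)
  assume x: "- 1 \<le> x" "x < F" "\<not> excess L x \<le> 1"
  have "excess L F \<le> 0" using excess_nonmem_le[of F] F F_notin by simp
  then obtain z where "x < z" "z \<le> F" "z \<notin> L" "excess L z = 1"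
    using excess_crossing[of x F 1 L] x by auto
  then show False using excess_nonmem_le[of z] x by simp
qed

lemma excess_F: "excess L F = 0"
proof -
  have "{0..F} = L \<union> (\<lambda>x. F - x) ` L" "L \<inter> (\<lambda>x. F - x) ` L = {}"
  proof -
    have "x \<in> L \<union> (\<lambda>x. F - x) ` L" if "0 \<le> x" "x \<le> F" for x
      using sym[OF that] by (auto intro!: image_eqI[of x _ "F - x"])
    moreover have "L \<union> (\<lambda>x. F - x) ` L \<subseteq> {0..F}" using L by auto
    ultimately show "{0..F} = L \<union> (\<lambda>x. F - x) ` L"
      by (meson atLeastAtMost_iff equalityI subsetI)
    have "F - x \<notin> L" if "x \<in> L" for x using sym[of x] that L by auto
    then show "L \<inter> (\<lambda>x. F - x) ` L = {}" by auto
  qed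
  moreover have fL: "finite L" using L finite_subset by blast
  moreover have "card ((\<lambda>x. F - x) ` L) = card L" by (intro card_image) (auto simp: inj_on_def)
  ultimately have "card {0..F} = 2 * card L" using card_Un_disjoint[of L "(\<lambda>x. F - x) ` L"] by simp
  moreover have "L \<inter> {0..F} = L" using L by auto
  ultimately show ?thesis using F by (simp add: excess_def)
qed

text \<open>An excess of 1 at x > 1 is followed by a non-element y of excess 0. Then L is
  anti-symmetric on [0, y], and the gap below the least positive element m is reflected to a run of
  elements before y. Adding m puts y + 1 and y + 2 into L and lifts the excess to 2.\<close>

lemma excess_le_0:
  assumes two: "2 \<notin> L" and x: "1 \<le> x" "x \<le> F - 2"
  shows "excess L x \<le> 0"
proof -
  have no_zero: False if y: "2 \<le> y" "y < F" "y \<notin> L" "excess L y = 0" for y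
  proof -
    have yLL: "y \<notin> L + L" using y by (intro nonmem_not_sum) auto
    have "odd y" using excess_parity[of L y] y by simp
    have tight: "i \<in> L \<longleftrightarrow> y - i \<notin> L" if "0 \<le> i" "i \<le> y" for i
    proof -
      have "2 * i \<noteq> y" using \<open>odd y\<close> by auto
      then show ?thesis using y that by (intro excess_low(2)[OF _ yLL]) auto
    qed
    have "\<exists>m. 0 < m \<and> int m \<le> y \<and> int m \<in> L"
    proof (rule ccontr)
      assume n: "\<nexists>m. 0 < m \<and> int m \<le> y \<and> int m \<in> L"
      have "L \<inter> {0..y} \<subseteq> {0}"
      proof
        fix i assume "i \<in> L \<inter> {0..y}"
        then show "i \<in> {0}" using n[simplified, rule_format, of "nat i"] by (cases "i = 0") auto
      qed
      then have "card (L \<inter> {0..y}) \<le> 1" using card_mono[of "{0::int}"] by fastforce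
      then show False using y by (simp add: excess_def)
    qed
    then obtain m0 where m0: "0 < m0 \<and> int m0 \<le> y \<and> int m0 \<in> L" by blast
    define m where "m = (LEAST m. 0 < m \<and> int m \<in> L)"
    have m: "0 < m" "int m \<in> L" using LeastI[of "\<lambda>m. 0 < m \<and> int m \<in> L" m0] m0 by (auto simp: m_def)
    have mle: "int m \<le> y" using Least_le[of "\<lambda>m. 0 < m \<and> int m \<in> L" m0] m0 by (auto simp: m_def)
    have mleast: "i \<notin> L" if "0 < i" "i < int m" for i
      using not_less_Least[of "nat i" "\<lambda>m. 0 < m \<and> int m \<in> L"] that by (auto simp: m_def)
    have m3: "3 \<le> int m"
    proof -
      have "m \<noteq> 1" "m \<noteq> 2" using m one_notin two by auto
      then show ?thesis using m by linarith
    qed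
    have "y + 2 \<le> F" using \<open>odd y\<close> F_odd y by presburger
    \<comment> \<open>m - i lies below m and is a non-element, so y - (m - i) is an element; adding
      m gives y + i.\<close>
    have shift: "y + i \<in> L" if i: "0 < i" "i < int m" "y + i \<le> F" for i
    proof -
      have "y - (int m - i) \<in> L" using tight[of "int m - i"] mleast[of "int m - i"] i mle m3 by auto
      then have "int m + (y - (int m - i)) \<in> L" using m i by (intro closed) auto
      then show ?thesis by simp
    qed
    have "y + 1 \<in> L" "y + 2 \<in> L" using shift[of 1] shift[of 2] m3 \<open>y + 2 \<le> F\<close> by auto
    then have "excess L (y + 2) = 2" using excess_run(1)[of y "y + 2" L] y
      by (auto simp: le_less_Suc_eq) (smt (verit) add.commute)
    moreover have "y + 2 \<noteq> F" using \<open>y + 2 \<in> L\<close> F_notin by auto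
    ultimately show False using excess_le_1[of "y + 2"] y \<open>y + 2 \<le> F\<close> by simp
  qed
  have e1: "excess L 1 = 0" using excess_step[of 1 L] excess_step[of 0 L] L one_notin
    by (simp add: excess_m1)
  show ?thesis
  proof (rule ccontr)
    assume c: "\<not> ?thesis"
    then have "excess L x = 1" "x \<noteq> 1" using excess_le_1[of x] x e1 by auto
    moreover have "x + 1 \<notin> L"
      using excess_suc(1)[of x L] excess_le_1[of "x + 1"] x \<open>excess L x = 1\<close> by auto
    ultimately show False using no_zero[of "x + 1"] excess_suc(2)[of x L] x by simp
  qed
qed

text \<open>Right density restates that the excess is at most 0 in the interior. Up to F closure
  keeps the sums inside L, and above F density makes the reflection argument produce every sum up to
  2(F - 1).\<close>

lemma additively_minimal:
  assumes two: "2 \<notin> L" and F1: "F \<noteq> 1"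
  shows "right_additively_minimal (L - {0}) 1 (F - 1)" "5 \<le> F"
proof -
  have F3: "3 \<le> F" using F F1 F_odd by presburger
  show F5: "5 \<le> F"
  proof -
    have "F \<noteq> 3" using sym[of 2] two one_notin by auto
    then show ?thesis using F3 F_odd by presburger
  qed
  define C where "C = L - {0}"
  have Csub: "C \<subseteq> {1..F - 1}"
  proof
    fix x assume "x \<in> C"
    then have "0 \<le> x" "x \<le> F" "x \<noteq> 0" "x \<noteq> F" using L F_notin by (auto simp: C_def)
    then show "x \<in> {1..F - 1}" by simp
  qed
  have cnt: "C \<inter> {x..F - 1} = L \<inter> {x..F - 1}" if "1 \<le> x" for x using that by (auto simp: C_def)
  have eF: "excess L (F - 1) = 1" using excess_nonmem[of F L] F F_notin excess_F by simp
  have c: "2 * int (card (C \<inter> {x..F - 1})) = 1 - excess L (x - 1) + (F - x)" if "1 \<le> x"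
      "x \<le> F" for x
    using excess_diff[of x "F - 1" L] cnt that eF by simp
  have e0: "excess L 0 = 1" using excess_step[of 0 L] L by (simp add: excess_m1)
  have "half_dense C 1 (F - 1)"
    unfolding half_dense_def count_in_def using Csub c[of 1] e0 F by simp
  moreover have "2 * int (count_in C x (F - 1)) > F - 1 - x + 1" if "x \<in> {1 + 1..F - 1}" for x
    unfolding count_in_def using c[of x] excess_le_0[OF two, of "x - 1"] that by simp
  ultimately have rd: "right_dense C 1 (F - 1)" unfolding right_dense_def by blast
  have as: "anti_symmetric C 1 (F - 1)"
  proof -
    have r: "F - x \<in> C \<longleftrightarrow> x \<notin> C" if "1 \<le> x" "x \<le> F - 1" for x
      using sym[of x] that by (auto simp: C_def)
    have "C \<inter> (\<lambda>x. F - x) ` C = {}" using r Csub by fastforce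
    moreover have "(\<lambda>x. F - x) ` C \<subseteq> {1..F - 1}" using Csub by auto
    moreover have "x \<in> C \<union> (\<lambda>x. F - x) ` C" if "1 \<le> x" "x \<le> F - 1" for x
      using r[OF that] by (auto intro!: image_eqI[of x _ "F - x"])
    then have "{1..F - 1} \<subseteq> C \<union> (\<lambda>x. F - x) ` C" by (meson atLeastAtMost_iff subsetI)
    ultimately show ?thesis unfolding anti_symmetric_def reflect_def using Csub by auto
  qed
  have CL: "C \<union> {0} = L" using L by (auto simp: C_def)
  have "L + L = {F + 1..2 * (F - 1)} \<union> L"
  proof (intro equalityI subsetI)
    fix z assume "z \<in> L + L"
    then obtain a b where ab: "a \<in> L" "b \<in> L" "z = a + b" by (auto elim: set_plus_elim)
    have "a \<le> F - 1" "b \<le> F - 1" using ab L F_notin by (smt (verit) atLeastAtMost_iff subsetD)+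
    moreover have "z \<noteq> F" using ab closed[of a b] F_notin by auto
    moreover have "z \<in> L" if "z \<le> F" using closed ab that by auto
    ultimately show "z \<in> {F + 1..2 * (F - 1)} \<union> L" using ab by fastforce
  next
    fix z assume "z \<in> {F + 1..2 * (F - 1)} \<union> L"
    then show "z \<in> L + L"
    proof
      assume z: "z \<in> {F + 1..2 * (F - 1)}"
      show ?thesis
      proof (rule ccontr)
        \<comment> \<open>The pairs with sum z inside [z - (F - 1), F - 1] would leave this final
          segment at most half full.\<close>
        assume "z \<notin> L + L"
        then have "2 * int (card (L \<inter> {z - (F - 1)..F - 1})) \<le> (F - 1) - (z - (F - 1)) + 1"
          using z by (intro reflection_pigeonhole(1)) auto
        moreover have "L \<inter> {z - (F - 1)..F - 1} = C \<inter> {z - (F - 1)..F - 1}" using cnt z by auto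
        moreover have "excess L (z - F) \<le> 0" using z by (intro excess_le_0 two) auto
        ultimately show False using c[of "z - (F - 1)"] z by (simp add: algebra_simps)
      qed
    next
      assume "z \<in> L"
      then show ?thesis using set_plus_intro[OF L(2), of z L] by simp
    qed
  qed
  then have "(C \<union> {1 - 1}) + (C \<union> {1 - 1}) = {1 + (F - 1) + 1..2 * (F - 1)} \<union> ((1 - 1) +o (C \<union> {1 - 1}))"
    using CL by (simp add: elt_set_plus_def)
  then show "right_additively_minimal (L - {0}) 1 (F - 1)"
    unfolding right_additively_minimal_def C_def[symmetric] using rd as by blast
qed

end

section \<open>Dense sets\<close>

context normalized
begin

abbreviation f where "f \<equiv> excess A"

lemma f_n: "f n = 2 * int (card A) - n - 1"
proof -
  have "A \<inter> {0..n} = A" using sub by auto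
  then show ?thesis by (simp add: excess_def)
qed

text \<open>The counterpart of \<open>excess_low\<close> on [x, n], pairing i with x + n - i. As x
  is not in A, the count on [x, n] starts from f(x - 1) = f(x) + 1, whence the threshold f(n) -
  1.\<close>

lemma excess_high:
  assumes x: "0 \<le> x" "x \<le> n" "x + n \<notin> S"
  shows "f n - 1 \<le> f x"
    and "f x \<le> f n \<Longrightarrow> x \<le> i \<Longrightarrow> i \<le> n \<Longrightarrow> 2 * i \<noteq> x + n \<Longrightarrow> i \<in> A \<longleftrightarrow> x + n - i \<notin> A"
proof -
  have "x \<notin> A" using x A_S(2) by blast
  then have "f (x - 1) = f x + 1" using excess_nonmem[of x A] x by simp
  then have c: "2 * int (card (A \<inter> {x..n})) = f n - f x - 1 + (n - x + 1)"
    using excess_diff[of x n A] x by simp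
  show "f n - 1 \<le> f x" using reflection_pigeonhole(1)[OF x(3), of x n] x c by simp
  show "i \<in> A \<longleftrightarrow> x + n - i \<notin> A" if "f x \<le> f n" "x \<le> i" "i \<le> n" "2 * i \<noteq> x + n"
    by (rule reflection_pigeonhole(2)[OF x(3), of x n]) (use that x c in auto)
qed

text \<open>A missed class would need f \<le> 0 and f \<ge> f(n) - 1 \<ge> 1 simultaneously.\<close>

lemma dense_setup:
  assumes nk: "n + 3 \<le> 2 * int (card A)" and s: "card S = 3 * card A - 3" and k: "2 \<le> card A"
  shows "missed = {}" "int (card doubled) = f n - 2" "2 \<le> f n"
proof -
  show f2: "2 \<le> f n" using nk f_n by simp
  show m: "missed = {}"
  proof (rule ccontr)
    assume "missed \<noteq> {}"
    then obtain x where "0 \<le> x" "x < n" "x \<notin> S" "x + n \<notin> S" by (auto simp: missed_def)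
    then show False using excess_low(1)[of x A] excess_high(1)[of x] f2 by simp
  qed
  show "int (card doubled) = f n - 2" using card_S m s k f_n by simp
qed

lemma interval_if_separated:
  assumes nk: "n + 3 \<le> 2 * int (card A)"
    and sep: "\<And>y z. y \<in> {0..n} \<Longrightarrow> y \<notin> S \<Longrightarrow> z \<in> {0..n} \<Longrightarrow> z + n \<notin> S \<Longrightarrow> y < z"
  shows "\<exists>x. {x..<x + (2 * int (card A) - 1)} \<subseteq> S"
proof -
  \<comment> \<open>The gaps of 2A up to n and, shifted by n, those above; -1 and n + 1 stand in
    when there are none.\<close>
  define Y where "Y = insert (- 1) {y \<in> {0..n}. y \<notin> S}"
  define Z where "Z = insert (n + 1) {z \<in> {0..n}. z + n \<notin> S}"
  have fin: "finite Y" "finite Z"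
  proof -
    have "finite {y \<in> {0..n}. P y}" for P by (rule finite_subset[of _ "{0..n}"]) auto
    then show "finite Y" "finite Z" unfolding Y_def Z_def by (simp_all only: finite_insert)
  qed
  define y where "y = Max Y"
  define z where "z = Min Z"
  have yY: "y \<in> Y" unfolding y_def using fin by (intro Max_in) (auto simp: Y_def)
  have zZ: "z \<in> Z" unfolding z_def using fin by (intro Min_in) (auto simp: Z_def)
  have yz: "y < z" using yY zZ sep npos by (auto simp: Y_def Z_def)
  have y1: "- 1 \<le> y" using yY by (auto simp: Y_def)
  have fy: "f y \<le> 0" using yY excess_low(1)[of y A] by (auto simp: Y_def excess_m1)
  have fz: "f n \<le> f (z - 1)"
  proof (cases "z = n + 1")
    case False
    then have z: "0 \<le> z" "z \<le> n" "z + n \<notin> S" using zZ by (auto simp: Z_def)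
    then have "z \<notin> A" using A_S(2) by blast
    then show ?thesis using excess_high(1)[OF z] excess_nonmem[of z A] z by simp
  qed simp
  \<comment> \<open>Between the last low gap y and z - 1 the walk climbs from at most 0 to at least
    f(n) by unit steps. The run from y + 1 to z + n - 1 thus has at least n + f(n) = 2|A| - 1
    members.\<close>
  have len: "f n + 1 \<le> z - y" using excess_lipschitz(1)[of y "z - 1" A] y1 yz fy fz by simp
  have "x \<in> S" if "y < x" "x < z + n" for x
  proof (cases "x \<le> n")
    case True
    show ?thesis
    proof (rule ccontr)
      assume "x \<notin> S"
      then have "x \<in> Y" using True that y1 by (simp add: Y_def)
      from Max_ge[OF fin(1) this] show False using that by (simp add: y_def)
    qed
  next
    case False
    show ?thesis
    proof (rule ccontr)
      assume "x \<notin> S"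
      moreover have "x - n \<le> n" using that zZ by (auto simp: Z_def)
      ultimately have "x - n \<in> Z" using False by (simp add: Z_def)
      from Min_le[OF fin(2) this] show False using that by (simp add: z_def)
    qed
  qed
  then have "{y + 1..<y + 1 + (2 * int (card A) - 1)} \<subseteq> S" using len f_n by auto
  then show ?thesis by blast
qed

text \<open>If some class missing above precedes a class missing below, the excess drops between them
  from \<open>f n - 1\<close> to 0 and every step of this descent is a doubled class. Since only \<open>f n - 2\<close>
  classes are doubled, the descent is a single run of consecutive non-elements.\<close>

lemma descent_run:
  assumes nk: "n + 3 \<le> 2 * int (card A)" and s: "card S = 3 * card A - 3" and k: "2 \<le> card A"
    and y: "y \<in> {0..n}" "y \<notin> S" and z: "z \<in> {0..n}" "z + n \<notin> S" "z \<le> y"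
  obtains h q where "0 \<le> h" "q < n" "q = h + f n - 1" "f h = f n - 1" "f q = 0"
    "doubled = {h + 1..q - 1}" "\<And>i. h \<le> i \<Longrightarrow> i \<le> q \<Longrightarrow> i \<notin> A"
proof -
  note ds = dense_setup[OF nk s k]
  define P where "P h q \<longleftrightarrow> 0 \<le> h \<and> h < q \<and> q < n \<and> h \<notin> A \<and> q \<notin> A \<and> f n - 1 \<le> f h \<and> f q \<le> 0" for h q
  have "z \<notin> A" "y \<notin> A" using A_S z y by blast+
  then have "y < n" "z < n" using y z An by (metis atLeastAtMost_iff order_less_le)+
  have "z \<noteq> y" using ds(1) y z \<open>y < n\<close> by (auto simp: missed_def)
  then have Pzy: "P z y"
    using z y \<open>z \<notin> A\<close> \<open>y \<notin> A\<close> \<open>y < n\<close> excess_high(1)[of z] excess_low(1)[of y A]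
    by (auto simp: P_def)
  define d where "d = (LEAST d. \<exists>h. P h (h + int d))"
  have ex: "\<exists>h. P h (h + int (nat (y - z)))" using Pzy z by (intro exI[of _ z]) (simp add: P_def)
  then have "\<exists>h. P h (h + int d)" unfolding d_def by (rule LeastI)
  then obtain h where "P h (h + int d)" by blast
  moreover define q where "q = h + int d"
  ultimately have hq: "P h q" by simp
  have least: "q - h \<le> q' - h'" if "P h' q'" for h' q'
  proof -
    have "\<exists>h. P h (h + int (nat (q' - h')))" using that by (intro exI[of _ h']) (simp add: P_def)
    then have "d \<le> nat (q' - h')" unfolding d_def by (rule Least_le)
    moreover have "h' < q'" using that by (simp add: P_def)
    ultimately show ?thesis unfolding q_def by linarith
  qed
  have p: "0 \<le> h" "h < q" "q < n" "h \<notin> A" "q \<notin> A" "f n - 1 \<le> f h" "f q \<le> 0" using hq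
    by (auto simp: P_def)
  \<comment> \<open>The pair (h, q) is a shortest descent, so no non-element strictly inside reaches
    either threshold; each one is therefore doubled.\<close>
  have mid: "1 \<le> f x \<and> f x \<le> f n - 2" if "h < x" "x < q" "x \<notin> A" for x
  proof -
    have "\<not> P h x" "\<not> P x q" using least[of h x] least[of x q] that by auto
    then show ?thesis using that p by (auto simp: P_def)
  qed
  define N where "N = {h + 1..q - 1} - A"
  have N_doubled: "N \<subseteq> doubled"
  proof
    fix x assume "x \<in> N"
    then have x: "h < x" "x < q" "x \<notin> A" by (auto simp: N_def)
    have "x \<in> S" using excess_low(1)[of x A] mid[OF x] x p by force
    moreover have "x + n \<in> S" using excess_high(1)[of x] mid[OF x] x p by force
    ultimately show "x \<in> doubled" using x p by (simp add: doubled_def)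
  qed
  define c where "c = int (card (A \<inter> {h + 1..q}))"
  have c: "2 * c = f q - f h + (q - h)" using excess_diff[of "h + 1" q A] p by (simp add: c_def)
  have c0: "0 \<le> c" by (simp add: c_def)
  have cN: "int (card N) = q - h - 1 - c"
  proof -
    have "A \<inter> {h + 1..q} = A \<inter> {h + 1..q - 1}"
    proof -
      have "{h + 1..q} = insert q {h + 1..q - 1}" using p by auto
      then show ?thesis using p by auto
    qed
    moreover have "card N = card {h + 1..q - 1} - card ({h + 1..q - 1} \<inter> A)"
      unfolding N_def by (rule card_Diff_subset_Int) simp
    moreover have "card ({h + 1..q - 1} \<inter> A) \<le> card {h + 1..q - 1}" by (intro card_mono) auto
    ultimately show ?thesis using p by (simp add: c_def Int_commute)
  qed
  have le: "int (card N) \<le> f n - 2" using card_mono[OF finite_classes(3) N_doubled] ds(2) by simp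
  \<comment> \<open>Each of the c elements inside the descent must be offset by a further
    non-element, that is, by a further doubled class. The bound f(n) - 2 leaves c = 0.\<close>
  have eqs: "c = 0" "f h = f n - 1" "f q = 0" "q = h + f n - 1" using c c0 cN le p by linarith+
  have "A \<inter> {h + 1..q} = {}" using eqs(1) by (simp add: c_def)
  then have non: "i \<notin> A" if "h \<le> i" "i \<le> q" for i using that p by (cases "i = h") auto
  then have "N = {h + 1..q - 1}" by (auto simp: N_def)
  moreover have "N = doubled"
    using card_seteq[OF finite_classes(3) N_doubled] ds(2) cN eqs by simp
  ultimately show ?thesis using that[of h q] p eqs non by simp
qed

lemma two_intervals:
  assumes "0 < x" "x < b" "b \<le> n" and A: "A = {0..x - 1} \<union> {b..n}" and s: "card S = 3 * card A - 3"
  shows "bi_arith_prog A"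
proof (rule bi_arith_progI[of A 0 1 "nat (x - 1)" b "nat (n - b)"])
  have "(\<lambda>i. b + i) ` {0..n - b} = {b..n}" by (auto intro!: image_eqI[of _ _ "_ - b"])
  then show "A = (\<lambda>i. 0 + i * 1) ` {0..int (nat (x - 1))} \<union> (\<lambda>i. b + i * 1) ` {0..int (nat (n - b))}"
    using assms by simp
  have "card ({0..x - 1} \<union> {b..n}) = card {0..x - 1} + card {b..n}" using assms
    by (intro card_Un_disjoint) auto
  then show "card A = nat (x - 1) + nat (n - b) + 2" using A assms(1-3) by simp
qed (rule s)

lemma least_above:
  fixes P :: "int \<Rightarrow> bool"
  assumes "P y" "x \<le> y"
  obtains z where "x \<le> z" "z \<le> y" "P z" "\<And>i. x \<le> i \<Longrightarrow> i < z \<Longrightarrow> \<not> P i"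
proof -
  define d where "d = (LEAST d. P (x + int d))"
  have ex: "P (x + int (nat (y - x)))" using assms by simp
  have 1: "P (x + int d)" unfolding d_def using ex by (rule LeastI)
  have 2: "d \<le> nat (y - x)" unfolding d_def using ex by (rule Least_le)
  have 3: "\<not> P i" if "x \<le> i" "i < x + int d" for i
    using not_less_Least[of "nat (i - x)" "\<lambda>d. P (x + int d)"] that by (simp add: d_def)
  show ?thesis using that[of "x + int d"] 1 2 3 assms by simp
qed

text \<open>If the gaps are not separated, the doubled classes sit inside one run of non-elements,
  so at the ends of every gap of A the walk obeys a threshold. With a single gap A is two intervals.
  A second gap forces f(n) = 2, and the anti-symmetries then make A the integers congruent to 0 or 1
  modulo 4.\<close>

lemma dense_case:
  assumes nk: "n + 3 \<le> 2 * int (card A)" and s: "card S = 3 * card A - 3" and k: "2 \<le> card A"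
  shows "(\<exists>x. {x..<x + (2 * int (card A) - 1)} \<subseteq> S) \<or> bi_arith_prog A"
proof (cases "\<forall>y z. y \<in> {0..n} \<longrightarrow> y \<notin> S \<longrightarrow> z \<in> {0..n} \<longrightarrow> z + n \<notin> S \<longrightarrow> y < z")
  case True
  then show ?thesis using interval_if_separated[OF nk] by blast
next
  case False
  then obtain y z where "y \<in> {0..n}" "y \<notin> S" "z \<in> {0..n}" "z + n \<notin> S" "z \<le> y" by force
  from descent_run[OF nk s k this] obtain h q where hq: "0 \<le> h" "q < n" "q = h + f n - 1"
      "f h = f n - 1" "f q = 0"
    and dbl: "doubled = {h + 1..q - 1}" and hqA: "\<And>i. h \<le> i \<Longrightarrow> i \<le> q \<Longrightarrow> i \<notin> A" by blast
  note ds = dense_setup[OF nk s k]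
  have inS: "x \<in> S" if "0 \<le> x" "0 < f x" for x using excess_low(1)[of x A] that by force
  have inS': "x + n \<in> S" if "0 \<le> x" "x \<le> n" "f x < f n - 1" for x using excess_high(1)[of x] that
    by force
  have ndbl: "x \<in> doubled" if "0 \<le> x" "x < n" "x \<notin> A" "x \<in> S" "x + n \<in> S" for x
    using that by (simp add: doubled_def)
  have qS: "q \<notin> S" and hS: "h + n \<notin> S"
  proof -
    have "q \<notin> doubled" "h \<notin> doubled" using dbl by auto
    moreover have "q + n \<in> S" "h \<in> S" using inS'[of q] inS[of h] hq ds(3) by auto
    ultimately show "q \<notin> S" "h + n \<notin> S" using ndbl[of q] ndbl[of h] hq hqA[of q] hqA[of h] ds(3)
      by auto
  qed
  have tight_low: "i \<in> A \<longleftrightarrow> q - i \<notin> A" if "0 \<le> i" "i \<le> q" "f q = 0" "q \<notin> S" for i q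
  proof -
    have "odd q" using excess_parity[of A q] that(3) by simp
    then have "2 * i \<noteq> q" by auto
    then show ?thesis using that by (intro excess_low(2)) auto
  qed
  have tight_high: "i \<in> A \<longleftrightarrow> h + n - i \<notin> A" if "0 \<le> h" "h \<le> i" "i \<le> n" "f h = f n - 1"
      "h + n \<notin> S" for i h
  proof -
    have "even (f n - 1 + h + 1 + (f n + n + 1))"
      using excess_parity[of A h] excess_parity[of A n] that(4) by simp
    then have "odd (h + n)" by presburger
    then have "2 * i \<noteq> h + n" by (metis dvd_triv_left)
    then show ?thesis using that by (intro excess_high(2)) auto
  qed
  \<comment> \<open>q - 1 and h + 1 belong to the run; their mirror images in [0, q] and in [h, n]
    are 1 and n - 1.\<close>
  have oneA: "1 \<in> A" using tight_low[of 1 q] hqA[of "q - 1"] hq qS ds(3) by simp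
  have n1A: "n - 1 \<in> A" using tight_high[of h "n - 1"] hqA[of "h + 1"] hq hS ds(3) by simp
  \<comment> \<open>x = (x - 1) + 1 is a sum, so a lower value would make x doubled; but the left
    neighbour of a doubled class is a non-element.\<close>
  have up: "f n - 1 \<le> f x" if x: "0 \<le> x" "x < n" "x \<notin> A" "x - 1 \<in> A" for x
  proof (rule ccontr)
    assume "\<not> f n - 1 \<le> f x"
    then have "x + n \<in> S" using inS' x by simp
    moreover have "x \<in> S" using set_plus_intro[OF x(4) oneA] by simp
    ultimately have "x \<in> doubled" using ndbl x by simp
    then show False using x(4) hqA[of "x - 1"] dbl by auto
  qed
  have down: "f x \<le> 0" if x: "0 \<le> x" "x < n" "x \<notin> A" "x + 1 \<in> A" for x
  proof (rule ccontr)
    assume "\<not> f x \<le> 0"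
    then have "x \<in> S" using inS x by simp
    moreover have "x + n \<in> S" using set_plus_intro[OF x(4) n1A] by simp
    ultimately have "x \<in> doubled" using ndbl x by simp
    then show False using x(4) hqA[of "x + 1"] dbl by auto
  qed
  have h_notin: "h \<notin> A" using hqA[of h] hq ds(3) by simp
  have hn: "h < n" using hq ds(3) by simp
  obtain x where x: "0 \<le> x" "x \<le> h" "x \<notin> A" "\<And>i. 0 \<le> i \<Longrightarrow> i < x \<Longrightarrow> i \<in> A"
    using least_above[of "\<lambda>i. i \<notin> A" h 0] h_notin hq by auto
  have x2: "2 \<le> x"
  proof -
    have "x \<noteq> 0" "x \<noteq> 1" using x(3) A0 oneA by auto
    then show ?thesis using x(1) by simp
  qed
  obtain b where b: "x \<le> b" "b \<le> n" "b \<in> A" "\<And>i. x \<le> i \<Longrightarrow> i < b \<Longrightarrow> i \<notin> A"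
    using least_above[of "\<lambda>i. i \<in> A" n x] An x hn by auto
  have xb: "x < b" using b x by (cases "x = b") auto
  show ?thesis
  proof (cases "\<exists>v. b \<le> v \<and> v \<le> n \<and> v \<notin> A")
    case False
    have "A = {0..x - 1} \<union> {b..n}"
    proof (intro equalityI subsetI)
      fix i assume i: "i \<in> A"
      then have "0 \<le> i" "i \<le> n" using sub by auto
      moreover have "\<not> (x \<le> i \<and> i < b)" using b(4) i by blast
      ultimately show "i \<in> {0..x - 1} \<union> {b..n}" by auto
    next
      fix i assume "i \<in> {0..x - 1} \<union> {b..n}"
      then show "i \<in> A" using x(4)[of i] False by auto
    qed
    then show ?thesis using two_intervals[of x b] x2 xb b s by auto
  next
    case True
    then obtain v0 where "b \<le> v0" "v0 \<le> n" "v0 \<notin> A" by blast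
    then obtain v where v: "b \<le> v" "v \<le> v0" "v \<notin> A" "\<And>i. b \<le> i \<Longrightarrow> i < v \<Longrightarrow> i \<in> A"
      using least_above[of "\<lambda>i. i \<notin> A" v0 b] by auto
    have bv: "b < v" using v b by (cases "b = v") auto
    have vn: "v < n" using v \<open>v0 \<le> n\<close> An by (cases "v = n") auto
    obtain v2 where v2: "v \<le> v2" "v2 \<le> n" "v2 \<in> A" "\<And>i. v \<le> i \<Longrightarrow> i < v2 \<Longrightarrow> i \<notin> A"
      using least_above[of "\<lambda>i. i \<in> A" n v] An vn by auto
    have vv2: "v < v2" using v2 v by (cases "v = v2") auto
    have fx: "f n - 1 \<le> f x" using up[of x] x(4)[of "x - 1"] x x2 hn by simp
    have fv: "f n - 1 \<le> f v" using up[of v] v bv vn b(2) xb x2 by simp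
    have fb: "f (b - 1) \<le> 0" using down[of "b - 1"] b xb x2 by simp
    have fv2: "f (v2 - 1) \<le> 0" using down[of "v2 - 1"] v2 vv2 bv xb x2 by simp
    \<comment> \<open>If f(n) \<ge> 3, each of the two gaps crosses level 1 at a doubled class. Both
      crossings lie in the same run, together with the element b between them.\<close>
    have f2: "f n = 2"
    proof (rule ccontr)
      assume "f n \<noteq> 2"
      then have e: "3 \<le> f n" using ds(3) by simp
      obtain p where p: "x < p" "p \<le> b - 1" "p \<notin> A" "f p = 1"
        using excess_crossing[of x "b - 1" 1 A] fx fb e x2 xb by auto
      obtain p' where p': "v < p'" "p' \<le> v2 - 1" "p' \<notin> A" "f p' = 1"
        using excess_crossing[of v "v2 - 1" 1 A] fv fv2 e vv2 bv xb x2 by auto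
      have "p \<in> doubled" using p e b x2 by (intro ndbl inS inS') auto
      moreover have "p' \<in> doubled" using p' e v2 bv xb x2 by (intro ndbl inS inS') auto
      ultimately have "h \<le> b" "b \<le> q" using dbl p p' bv by auto
      then show False using hqA b by blast
    qed
    have dbl0: "doubled = {}" using dbl hq f2 by simp
    obtain q1 where q1: "x < q1" "q1 \<le> b - 1" "q1 \<notin> A" "f q1 = 0"
      using excess_crossing[of x "b - 1" 0 A] fx fb f2 x2 xb by auto
    obtain q2 where q2: "v < q2" "q2 \<le> v2 - 1" "q2 \<notin> A" "f q2 = 0"
      using excess_crossing[of v "v2 - 1" 0 A] fv fv2 f2 vv2 bv xb x2 by auto
    \<comment> \<open>With f(n) = 2 nothing is doubled and the thresholds are 0 and 1. Two
      neighbouring non-elements at levels 1 and 0 yield a tight reflection on each side.\<close>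
    have step: "q \<notin> S" "q - 1 + n \<notin> S" "f (q - 1) = 1" if "2 \<le> q" "q < n" "q \<notin> A" "q - 1 \<notin> A"
        "f q = 0" for q
    proof -
      show f1: "f (q - 1) = 1" using excess_nonmem[of q A] that by simp
      have "q + n \<in> S" "q - 1 \<in> S" using inS'[of q] inS[of "q - 1"] that f1 f2 by auto
      then show "q \<notin> S" "q - 1 + n \<notin> S" using ndbl[of q] ndbl[of "q - 1"] dbl0 that by auto
    qed
    have s1: "q1 \<notin> S" "q1 - 1 + n \<notin> S" "f (q1 - 1) = 1"
      using step[of q1] q1 x2 b(2) b(4)[of "q1 - 1"] by auto
    have s2: "q2 \<notin> S" "q2 - 1 + n \<notin> S" "f (q2 - 1) = 1"
      using step[of q2] q2 v2(2) v2(4)[of "q2 - 1"] bv xb x2 by auto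
    have low1: "i \<in> A \<longleftrightarrow> q1 - i \<notin> A" if "0 \<le> i" "i \<le> q1" for i using tight_low[OF that q1(4) s1(1)] .
    have low2: "i \<in> A \<longleftrightarrow> q2 - i \<notin> A" if "0 \<le> i" "i \<le> q2" for i using tight_low[OF that q2(4) s2(1)] .
    have high1: "i \<in> A \<longleftrightarrow> q1 - 1 + n - i \<notin> A" if "q1 - 1 \<le> i" "i \<le> n" for i
      using tight_high[of "q1 - 1" i] that s1 f2 q1 x2 by simp
    have high2: "i \<in> A \<longleftrightarrow> q2 - 1 + n - i \<notin> A" if "q2 - 1 \<le> i" "i \<le> n" for i
      using tight_high[of "q2 - 1" i] that s2 f2 q2 bv xb x2 by simp
    \<comment> \<open>The walk climbs to x along [0, x - 1] and then falls to 0 at q1 without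
      interruption.\<close>
    have q1x: "q1 = 2 * x - 1"
    proof -
      have "f (x - 1) = x" using excess_run(1)[of "- 1" "x - 1" A] x x2 by (simp add: excess_m1)
      moreover have "f q1 = f (x - 1) - (q1 - (x - 1))"
        using excess_run(2)[of "x - 1" q1 A] b(4) q1 x2 by simp
      ultimately show ?thesis using q1 by simp
    qed
    \<comment> \<open>Reflection in [0, q2] carries the initial block [0, x - 1] onto the part of
      the second gap that ends at q2.\<close>
    have vq2: "v = q2 - x + 1"
    proof -
      have "q2 - x \<in> A" using low2[of x] x x2 q2 bv xb by auto
      then have "\<not> (v \<le> q2 - x)" using v2(4)[of "q2 - x"] q2 x2 by auto
      moreover have "v - 1 \<in> A" using v(4)[of "v - 1"] bv by simp
      then have "q2 - (v - 1) \<notin> A" using low2[of "v - 1"] q2 bv xb x2 by auto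
      then have "\<not> (q2 - (v - 1) < x)" using x(4)[of "q2 - (v - 1)"] q2 by auto
      ultimately show ?thesis by simp
    qed
    \<comment> \<open>The same reflection maps the boundary between b - 1 and b to itself.\<close>
    have q2b: "q2 = 2 * b - 1"
    proof -
      have 1: "q2 - b \<notin> A" using low2[of b] b q2 bv xb x2 by auto
      then have "\<not> b \<le> q2 - b" using v(4)[of "q2 - b"] vq2 xb by auto
      moreover have "q2 - (b - 1) \<in> A" using low2[of "b - 1"] b(4)[of "b - 1"] xb x2 q2 bv by auto
      then have "\<not> (q2 - (b - 1) < b)" using b(4)[of "q2 - (b - 1)"] vq2 bv by auto
      ultimately show ?thesis by simp
    qed
    have q2n: "q2 < n" using q2 v2 by simp
    \<comment> \<open>For x \<ge> 3 the number q2 - 2 still lies in the gap. Its mirror image in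
      [q1 - 1, n] plus v - 1 is x + n, which would make x doubled.\<close>
    have xeq: "x = 2"
    proof (rule ccontr)
      assume "x \<noteq> 2"
      then have x3: "3 \<le> x" using x2 by simp
      have a: "v - 1 \<in> A" using v(4)[of "v - 1"] bv by simp
      have "q2 - 2 \<notin> A" using v2(4)[of "q2 - 2"] vq2 x3 q2 by simp
      then have c: "q1 - 1 + n - (q2 - 2) \<in> A"
        using high1[of "q1 - 1 + n - (q2 - 2)"] q1x q2b xb q2n by simp
      have "x + n = (v - 1) + (q1 - 1 + n - (q2 - 2))" using vq2 q1x by simp
      then have "x + n \<in> S" using set_plus_intro[OF a c] by (simp only:)
      moreover have "x \<in> S" using inS[of x] x fx f2 by simp
      ultimately show False using ndbl[of x] x hn dbl0 by simp
    qed
    have beq: "b = 4"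
    proof (rule ccontr)
      assume "b \<noteq> 4"
      then have b5: "5 \<le> b" using q1 q1x xeq by simp
      \<comment> \<open>The mirror image of b in [q1 - 1, n]. A gap longer than two would make it a
        doubled class.\<close>
      define y where "y = 2 + n - b"
      have yA: "y \<notin> A" using high1[of b] b q1x xeq xb by (simp add: y_def)
      have top: "i \<in> A" if "y < i" "i \<le> n" for i
        using high1[of i] b(4)[of "q1 - 1 + n - i"] that q1x xeq b by (simp add: y_def)
      have "q2 \<le> y" by (rule ccontr) (use top[of q2] q2 q2n in auto)
      have fy: "f y \<le> 0" using down[of y] yA top[of "y + 1"] b5 b(2) by (simp add: y_def)
      have y1: "y + n \<in> S" using inS'[of y] fy f2 b5 b(2) by (simp add: y_def)
      have "3 * b - 5 \<notin> A" using high2[of "y + 1"] top[of "y + 1"] \<open>q2 \<le> y\<close> b5 q2b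
        by (simp add: y_def algebra_simps)
      then have a: "n + 7 - 3 * b \<in> A" using high1[of "n + 7 - 3 * b"] \<open>q2 \<le> y\<close> b5 q2b q1x xeq
        by (simp add: y_def algebra_simps)
      have c: "2 * b - 5 \<in> A" using v(4)[of "2 * b - 5"] b5 vq2 q2b xeq by simp
      have "n + 7 - 3 * b + (2 * b - 5) = y" by (simp add: y_def)
      then have "y \<in> S" using set_plus_intro[OF a c] by (simp only:)
      then show False using ndbl[of y] y1 yA b5 b(2) dbl0 by (simp add: y_def)
    qed
    \<comment> \<open>The composition of the two reflections of the right-hand segments is
      translation by q2 - q1 = 4.\<close>
    have per: "i \<in> A \<longleftrightarrow> i - 4 \<in> A" if "6 \<le> i" "i \<le> n" for i
      using high2[of i] high1[of "i - 4"] that q2b beq q1x xeq by (simp add: algebra_simps)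
    have base: "2 \<notin> A" "3 \<notin> A" "4 \<in> A" "5 \<in> A"
      using b(4)[of 2] b(4)[of 3] b(3) v(4)[of 5] beq xeq vq2 q2b by auto
    have char: "i \<in> A \<longleftrightarrow> i mod 4 = 0 \<or> i mod 4 = 1" if "0 \<le> i" "i \<le> n" for i
      using that
    proof (induction "nat i" arbitrary: i rule: less_induct)
      case less
      show ?case
      proof (cases "6 \<le> i")
        case True
        then have "i - 4 \<in> A \<longleftrightarrow> (i - 4) mod 4 = 0 \<or> (i - 4) mod 4 = 1" using less by simp
        then show ?thesis using per[of i] True less by simp
      next
        case False
        then have "i \<in> {0, 1, 2, 3, 4, 5}" using less by auto
        then show ?thesis using A0 oneA base by auto
      qed
    qed
    have "n mod 4 = 0 \<or> n mod 4 = 1" "(n - 1) mod 4 = 0 \<or> (n - 1) mod 4 = 1"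
      using char[of n] char[of "n - 1"] An n1A npos by auto
    then have "n mod 4 = 1" by presburger
    then obtain t where t: "n = 4 * t + 1" by (metis mult_div_mod_eq)
    have t0: "0 \<le> t" using t npos by simp
    have "bi_arith_prog A"
    proof (rule bi_arith_progI[of A 0 4 "nat t" 1 "nat t"])
      show "A = (\<lambda>i. 0 + i * 4) ` {0..int (nat t)} \<union> (\<lambda>i. 1 + i * 4) ` {0..int (nat t)}"
      proof (intro equalityI subsetI)
        fix i assume i: "i \<in> A"
        then have i2: "0 \<le> i" "i \<le> n" using sub by auto
        then consider "i mod 4 = 0" | "i mod 4 = 1" using char i by blast
        then show "i \<in> (\<lambda>i. 0 + i * 4) ` {0..int (nat t)} \<union> (\<lambda>i. 1 + i * 4) ` {0..int (nat t)}"
        proof cases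
          case 1
          then have "i = 0 + (i div 4) * 4" "i div 4 \<le> t" "0 \<le> i div 4" using i2 t by presburger+
          then show ?thesis using t0 by (intro UnI1 image_eqI[of _ _ "i div 4"]) auto
        next
          case 2
          then have "i = 1 + (i div 4) * 4" "i div 4 \<le> t" "0 \<le> i div 4" using i2 t by presburger+
          then show ?thesis using t0 by (intro UnI2 image_eqI[of _ _ "i div 4"]) auto
        qed
      next
        fix i assume "i \<in> (\<lambda>i. 0 + i * 4) ` {0..int (nat t)} \<union> (\<lambda>i. 1 + i * 4) ` {0..int (nat t)}"
        then obtain j where j: "0 \<le> j" "j \<le> int (nat t)" "i = j * 4 \<or> i = 1 + j * 4" by force
        then have "j \<le> t" using t0 by simp
        then have "0 \<le> i" "i \<le> n" using j(1,3) t by linarith+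
        moreover have "i mod 4 = 0 \<or> i mod 4 = 1" using j(3) by auto
        ultimately show "i \<in> A" using char[of i] by simp
      qed
      show "card A = nat t + nat t + 2" using f_n f2 t t0 by linarith
    qed (rule s)
    then show ?thesis by simp
  qed
qed

end

section \<open>The extremal case\<close>

lemma mem_reflect: "x \<in> reflect m X \<longleftrightarrow> m - x \<in> X"
  by (force simp: reflect_def)

lemma reflect_reflect: "reflect m (reflect m X) = X"
  by (auto simp: mem_reflect)

lemma card_reflect: "card (reflect m X) = card X"
  unfolding reflect_def by (intro card_image) (auto simp: inj_on_def)

lemma reflect_sum: "x \<in> reflect m X + reflect m Y \<longleftrightarrow> 2 * m - x \<in> X + Y"
proof
  assume "x \<in> reflect m X + reflect m Y"
  then obtain a b where "a \<in> X" "b \<in> Y" "x = (m - a) + (m - b)"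
    by (auto simp: reflect_def elim!: set_plus_elim)
  then show "2 * m - x \<in> X + Y" using set_plus_intro[of a X b Y] by simp
next
  assume "2 * m - x \<in> X + Y"
  then obtain a b where ab: "a \<in> X" "b \<in> Y" "2 * m - x = a + b" by (auto elim: set_plus_elim)
  then have "m - a \<in> reflect m X" "m - b \<in> reflect m Y" by (auto simp: mem_reflect)
  then have "(m - a) + (m - b) \<in> reflect m X + reflect m Y" by (rule set_plus_intro)
  moreover have "(m - a) + (m - b) = x" using ab by simp
  ultimately show "x \<in> reflect m X + reflect m Y" by simp
qed

lemma count_in_reflect: "count_in (reflect m X) (m - y) (m - x) = count_in X x y"
proof -
  have "reflect m X \<inter> {m - y..m - x} = reflect m (X \<inter> {x..y})" by (auto simp: mem_reflect)
  then show ?thesis by (simp add: count_in_def card_reflect)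
qed

lemma left_additively_minimal_reflect:
  assumes "right_additively_minimal C u v"
  shows "left_additively_minimal (reflect m C) (m - v) (m - u)"
proof -
  have rd: "right_dense C u v" and as: "anti_symmetric C u v"
    and sm: "(C \<union> {u - 1}) + (C \<union> {u - 1}) = {u + v + 1..2 * v} \<union> ((u - 1) +o (C \<union> {u - 1}))"
    using assms by (auto simp: right_additively_minimal_def)
  have Csub: "C \<subseteq> {u..v}" using as by (simp add: anti_symmetric_def)
  have sub: "reflect m C \<subseteq> {m - v..m - u}" using Csub by (force simp: reflect_def)
  have "half_dense C u v" using rd by (simp add: right_dense_def)
  then have "half_dense (reflect m C) (m - v) (m - u)"
    using sub by (simp add: half_dense_def count_in_reflect)
  moreover have "2 * int (count_in (reflect m C) (m - v) x) > x - (m - v) + 1"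
    if "x \<in> {m - v..m - u - 1}" for x
  proof -
    have "2 * int (count_in C (m - x) v) > v - (m - x) + 1"
      using rd that by (auto simp: right_dense_def)
    then show ?thesis using count_in_reflect[of m C v "m - x"] by simp
  qed
  ultimately have ld: "left_dense (reflect m C) (m - v) (m - u)" by (simp add: left_dense_def)
  have as': "anti_symmetric (reflect m C) (m - v) (m - u)"
  proof -
    have r: "reflect (m - v + (m - u)) (reflect m C) = reflect m (reflect (u + v) C)"
      by (auto simp: mem_reflect algebra_simps)
    have 1: "C \<inter> reflect (u + v) C = {}" "C \<union> reflect (u + v) C = {u..v}"
      using as by (auto simp: anti_symmetric_def)
    have "reflect m C \<inter> reflect m (reflect (u + v) C) = reflect m (C \<inter> reflect (u + v) C)"
      "reflect m C \<union> reflect m (reflect (u + v) C) = reflect m (C \<union> reflect (u + v) C)"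
      by (auto simp: mem_reflect)
    moreover have "reflect m {u..v} = {m - v..m - u}" by (auto simp: mem_reflect)
    ultimately show ?thesis unfolding anti_symmetric_def r using 1 sub by (simp add: reflect_def)
  qed
  have e: "reflect m C \<union> {m - u + 1} = reflect m (C \<union> {u - 1})" by (auto simp: mem_reflect)
  have "x \<in> reflect m (C \<union> {u - 1}) + reflect m (C \<union> {u - 1}) \<longleftrightarrow>
      x \<in> {2 * (m - v)..m - v + (m - u) - 1} \<union> ((m - u + 1) +o reflect m (C \<union> {u - 1}))" for x
  proof -
    have "2 * m - x \<in> (u - 1) +o (C \<union> {u - 1}) \<longleftrightarrow> x \<in> (m - u + 1) +o reflect m (C \<union> {u - 1})"
    proof -
      have *: "z \<in> c +o X \<longleftrightarrow> z - c \<in> X" for z c :: int and X by (force simp: elt_set_plus_def)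
      show ?thesis unfolding * mem_reflect by (simp add: algebra_simps)
    qed
    then show ?thesis unfolding reflect_sum sm by auto
  qed
  then show ?thesis unfolding left_additively_minimal_def e using ld as' by blast
qed

lemma bi_arith_prog_reflect:
  assumes "bi_arith_prog (reflect m A)"
  shows "bi_arith_prog A"
proof -
  obtain n0 n1 \<phi> where c: "n0 + n1 + 2 = card (reflect m A)" and iso: "freiman_iso \<phi> (two_rows n0 n1) (reflect m A)"
    and fin: "finite (reflect m A)"
    using assms by (auto simp: bi_arith_prog_def freiman_image_def)
  have "bij_betw (\<lambda>x. m - x) (reflect m A) A"
    by (rule bij_betw_byWitness[where f' = "\<lambda>x. m - x"]) (auto simp: mem_reflect)
  moreover have "bij_betw \<phi> (two_rows n0 n1) (reflect m A)" using iso by (simp add: freiman_iso_def)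
  ultimately have "bij_betw (\<lambda>x. m - \<phi> x) (two_rows n0 n1) A"
    using bij_betw_trans by (force simp: comp_def)
  moreover have "m - \<phi> a + (m - \<phi> b) = m - \<phi> c + (m - \<phi> d) \<longleftrightarrow> \<phi> a + \<phi> b = \<phi> c + \<phi> d" for a b c d
    by auto
  ultimately have "freiman_iso (\<lambda>x. m - \<phi> x) (two_rows n0 n1) A" using iso unfolding freiman_iso_def
    by simp
  moreover have "finite (reflect m (reflect m A))" unfolding reflect_def[of m "reflect m A"]
    using fin by (rule finite_imageI)
  then have "finite A" by (simp only: reflect_reflect)
  ultimately show ?thesis using c unfolding bi_arith_prog_def freiman_image_def card_reflect
    by blast
qed

context normalized
begin

lemma normalized_reflect: "normalized (reflect n A) n"
  using fin A0 An sub npos by unfold_locales (auto simp: mem_reflect reflect_def)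

lemma missed_reflect: "normalized.missed (reflect n A) n = reflect n missed"
  and doubled_reflect: "normalized.doubled (reflect n A) n = reflect n doubled"
proof -
  interpret r: normalized "reflect n A" n by (rule normalized_reflect)
  have S0: "0 \<in> S" "2 * n \<in> S" using A_S[OF A0] A_S(2)[OF An] by simp_all
  have S': "x \<in> r.S \<longleftrightarrow> (n - x) + n \<in> S" "x + n \<in> r.S \<longleftrightarrow> n - x \<in> S" for x
    unfolding reflect_sum by (simp_all add: algebra_simps)
  have m: "x \<in> r.missed \<longleftrightarrow> n - x \<in> missed" and d: "x \<in> r.doubled \<longleftrightarrow> n - x \<in> doubled" for x
  proof -
    \<comment> \<open>Reflection sends 0 to n, outside the range of representatives; class 0 is
      neither missed nor doubled on either side.\<close>
    have "x \<notin> r.missed \<and> n - x \<notin> missed \<and> x \<notin> r.doubled \<and> n - x \<notin> doubled" if "\<not> (0 < x \<and> x < n)"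
    proof -
      have "0 \<notin> missed" "0 \<notin> r.missed" "0 \<notin> doubled" "0 \<notin> r.doubled"
        using A_S(1)[OF A0] r.A_S(1)[OF r.A0] A0 r.A0
          by (simp_all add: missed_def r.missed_def doubled_def r.doubled_def)
      moreover have "y \<notin> missed" "y \<notin> r.missed" "y \<notin> doubled"
          "y \<notin> r.doubled" if "\<not> (0 \<le> y \<and> y < n)" for y
        using that by (auto simp: missed_def r.missed_def doubled_def r.doubled_def)
      ultimately show ?thesis
        using \<open>\<not> (0 < x \<and> x < n)\<close> by (cases "x = 0"; cases "x = n") auto
    qed
    moreover have "(x \<in> r.missed \<longleftrightarrow> n - x \<in> missed) \<and> (x \<in> r.doubled \<longleftrightarrow> n - x \<in> doubled)" if "0 < x"
        "x < n"
    proof -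
      have "x \<in> r.missed \<longleftrightarrow> x \<notin> r.S \<and> x + n \<notin> r.S" "n - x \<in> missed \<longleftrightarrow> n - x \<notin> S \<and> (n - x) + n \<notin> S"
        "x \<in> r.doubled \<longleftrightarrow> n - x \<notin> A \<and> x \<in> r.S \<and> x + n \<in> r.S"
        "n - x \<in> doubled \<longleftrightarrow> n - x \<notin> A \<and> n - x \<in> S \<and> (n - x) + n \<in> S"
        unfolding missed_def r.missed_def doubled_def r.doubled_def mem_reflect using that by auto
      then show ?thesis using S'[of x] by blast
    qed
    ultimately show "x \<in> r.missed \<longleftrightarrow> n - x \<in> missed" "x \<in> r.doubled \<longleftrightarrow> n - x \<in> doubled" by blast+
  qed
  show "r.missed = reflect n missed" using m by (intro set_eqI) (simp only: mem_reflect)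
  show "r.doubled = reflect n doubled" using d by (intro set_eqI) (simp only: mem_reflect)
qed

end

section \<open>Missed classes when n = 2|A| - 2\<close>

context normalized
begin

text \<open>With f(n) = 1 the bounds f(x) \<le> 0 and f(x) \<ge> f(n) - 1 meet, so both reflections
  are tight. Parity makes x odd and n even, so neither reflection has a fixed point.\<close>

lemma missed_antisymmetric:
  assumes nk: "2 * int (card A) = n + 2" and x: "x \<in> missed"
  shows "f x = 0" "odd x" "even n"
    and "0 \<le> i \<Longrightarrow> i \<le> x \<Longrightarrow> i \<in> A \<longleftrightarrow> x - i \<notin> A"
    and "x \<le> i \<Longrightarrow> i \<le> n \<Longrightarrow> i \<in> A \<longleftrightarrow> x + n - i \<notin> A"
proof -
  have x': "0 \<le> x" "x < n" "x \<notin> S" "x + n \<notin> S" using x by (auto simp: missed_def)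
  have fn: "f n = 1" using f_n nk by simp
  show f0: "f x = 0" using excess_low(1)[OF x'(1,3)] excess_high(1)[of x] x' fn by simp
  show ox: "odd x" using excess_parity[of A x] f0 by simp
  show en: "even n" using nk by presburger
  show "i \<in> A \<longleftrightarrow> x - i \<notin> A" if "0 \<le> i" "i \<le> x"
  proof -
    have "2 * i \<noteq> x" using ox by auto
    then show ?thesis using that f0 by (intro excess_low(2)[OF x'(1,3)]) auto
  qed
  show "i \<in> A \<longleftrightarrow> x + n - i \<notin> A" if "x \<le> i" "i \<le> n"
  proof -
    have "odd (x + n)" using ox en by simp
    then have "2 * i \<noteq> x + n" by (metis dvd_triv_left)
    then show ?thesis using that f0 fn x' by (intro excess_high(2)) auto
  qed
qed

text \<open>Each missed x makes c \<mapsto> x - c exchange the residues K with their complement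
  modulo n. Two such reflections compose to a translation that preserves K, so K is a union of full
  classes modulo some h.\<close>

lemma periodic_if_two_missed:
  assumes gcd1: "Gcd A = 1" and nk: "2 * int (card A) = n + 2" and s: "card S = 3 * card A - 3"
    and x: "x1 \<in> missed" "x2 \<in> missed" "x1 \<noteq> x2"
  shows "bi_arith_prog A \<or> card A = 6 \<and> freiman_image K6 A"
proof -
  define K where "K = A - {n}"
  have K: "residues n A = K" using card_res_n(2) by (simp add: K_def)
  have anti: "c mod n \<in> K \<longleftrightarrow> (x - c) mod n \<notin> K" if x: "x \<in> missed" for x c
  proof -
    define d where "d = c mod n"
    have d: "0 \<le> d" "d < n" using npos by (auto simp: d_def)
    have x': "0 \<le> x" "x < n" using x by (auto simp: missed_def)
    have e: "(x - c) mod n = (x - d) mod n" by (simp add: d_def mod_diff_right_eq)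
    show ?thesis
    proof (cases "d \<le> x")
      case True
      then have "(x - d) mod n = x - d" using d x' by simp
      then show ?thesis using missed_antisymmetric(4)[OF nk x d(1) True] d x' e
        by (auto simp: K_def d_def[symmetric])
    next
      case False
      have "(x - d) mod n = (x + n - d) mod n"
        by (metis add_diff_eq add.commute diff_add_eq mod_add_self1)
      then have "(x - d) mod n = x + n - d" using False d x' by simp
      then show ?thesis using missed_antisymmetric(5)[OF nk x, of d] False d e
        by (auto simp: K_def d_def[symmetric])
    qed
  qed
  define D where "D = {d. \<forall>c. c mod n \<in> K \<longleftrightarrow> (c + d) mod n \<in> K}"
  have D: "is_subgroup D"
    unfolding is_subgroup_def
  proof (intro conjI ballI)
    show "0 \<in> D" by (simp add: D_def)
    fix d e assume d: "d \<in> D" and e: "e \<in> D"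
    have "c mod n \<in> K \<longleftrightarrow> (c + (d - e)) mod n \<in> K" for c
    proof -
      have "c mod n \<in> K \<longleftrightarrow> (c + d) mod n \<in> K" using d by (simp add: D_def)
      moreover have "(c + (d - e)) mod n \<in> K \<longleftrightarrow> ((c + (d - e)) + e) mod n \<in> K" using e
        unfolding D_def by blast
      ultimately show ?thesis by (simp add: algebra_simps)
    qed
    then show "d - e \<in> D" by (simp add: D_def)
  qed
  have nD: "n \<in> D" by (simp add: D_def)
  have dD: "x2 - x1 \<in> D"
  proof -
    have "c mod n \<in> K \<longleftrightarrow> (c + (x2 - x1)) mod n \<in> K" for c
      using anti[OF x(1), of c] anti[OF x(2), of "c + (x2 - x1)"] by (simp add: algebra_simps)
    then show ?thesis by (simp add: D_def)
  qed
  obtain h where h: "0 < h" "h dvd n" "\<And>d. d \<in> D \<longleftrightarrow> h dvd d" using int_subgroup_cyclic[OF D nD npos]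
    by blast
  have h1: "h \<noteq> 1"
  proof
    assume "h = 1"
    then have "x1 \<in> D" using h by simp
    then have "0 mod n \<in> K \<longleftrightarrow> (0 + x1) mod n \<in> K" unfolding D_def by blast
    moreover have "(0 + x1) mod n = x1" "x1 \<notin> A" using x(1) A_S(1) by (auto simp: missed_def)
    ultimately show False using A0 npos by (simp add: K_def)
  qed
  have hn: "h < n"
  proof -
    have "\<bar>x2 - x1\<bar> < n" "x2 - x1 \<noteq> 0" using x by (auto simp: missed_def)
    moreover have "h dvd \<bar>x2 - x1\<bar>" using dD h(3) by simp
    ultimately show ?thesis using zdvd_imp_le[of h "\<bar>x2 - x1\<bar>"] by simp
  qed
  have Kh: "K = {c \<in> {0..<n}. c mod h \<in> residues h A}"
  proof (intro equalityI subsetI)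
    fix c assume "c \<in> K"
    then show "c \<in> {c \<in> {0..<n}. c mod h \<in> residues h A}" using sub
      by (auto simp: K_def residues_def order_less_le)
  next
    fix c assume "c \<in> {c \<in> {0..<n}. c mod h \<in> residues h A}"
    then obtain a where a: "0 \<le> c" "c < n" "a \<in> A" "c mod h = a mod h" by (auto simp: residues_def)
    then have "h dvd c - a" by (simp only: mod_eq_dvd_iff)
    then have "a mod n \<in> K \<longleftrightarrow> (a + (c - a)) mod n \<in> K" using h(3) unfolding D_def by blast
    moreover have "a mod n \<in> K" using a K by (auto simp: residues_def)
    ultimately show "c \<in> K" using a by simp
  qed
  have "int (card K) = int (card (residues h A)) * (n div h)"
    unfolding Kh by (rule card_residue_classes[OF h(1,2) npos residues_subset[OF h(1)]])
  moreover have "card K + 1 = card A" using card_res_n(1) K by simp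
  moreover have "1 \<le> n div h" using hn h
    by (simp add: pos_imp_zdiv_pos_iff int_one_le_iff_zero_less)
  ultimately have "int (card (residues h A)) * (n div h) + 2 \<le> int (card A) + n div h" by linarith
  then show ?thesis using periodic_case[OF gcd1 _ s h(2)] h1 hn h(1) nk by simp
qed

end

locale critical = normalized +
  fixes x0 :: int
  assumes nk: "2 * int (card A) = n + 2" and x0: "missed = {x0}" and nd: "doubled = {}"
    and s: "card S = 3 * card A - 3"
begin

lemma x0m: "x0 \<in> missed" using x0 by simp

lemma fn: "f n = 1" using f_n nk by simp

lemma x0_facts: "0 < x0" "x0 < n" "x0 \<notin> S" "x0 + n \<notin> S" "x0 \<notin> A" "f x0 = 0" "odd x0" "even n"
proof -
  show *: "x0 < n" "x0 \<notin> S" "x0 + n \<notin> S" using x0m by (auto simp: missed_def)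
  show "x0 \<notin> A" using * A_S by blast
  then show "0 < x0" using x0m A0 by (cases "x0 = 0") (auto simp: missed_def)
qed (use missed_antisymmetric[OF nk x0m] in auto)

lemmas left_sym = missed_antisymmetric(4)[OF nk x0m]
lemmas right_sym = missed_antisymmetric(5)[OF nk x0m]

text \<open>Away from \<open>x0\<close> every class outside A contains exactly one sum, and the sign
  of f tells whether it lies below n or above.\<close>

lemma one_side:
  assumes "0 \<le> p" "p < n" "p \<notin> A" "p \<noteq> x0"
  shows "p \<in> S \<longleftrightarrow> p + n \<notin> S" "0 < f p \<Longrightarrow> p + n \<notin> S" "f p < 0 \<Longrightarrow> p \<notin> S"
proof -
  have "p \<notin> missed" "p \<notin> doubled" using assms x0 nd by auto
  then show *: "p \<in> S \<longleftrightarrow> p + n \<notin> S" using assms by (auto simp: missed_def doubled_def)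
  show "p + n \<notin> S" if "0 < f p" using excess_low(1)[of p A] that assms * by force
  show "p \<notin> S" if "f p < 0" using excess_high(1)[of p] that assms * fn by force
qed

text \<open>Neither x0 - 1 + n nor x0 + 1 is a sum. If a is in A and its neighbour away from 0
  (right half) or towards 0 (left half) is not, anti-symmetry supplies a partner of a with that
  forbidden sum. So A is upward closed right of \<open>x0\<close> and downward closed left of
  it.\<close>

lemma interval_case:
  assumes one: "1 \<in> A" and x0n: "x0 \<le> n - 2"
  shows "bi_arith_prog A"
proof -
  note x = x0_facts
  have x02: "2 \<le> x0" using x one by (cases "x0 = 1") auto
  have p: "x0 - 1 \<notin> A" using left_sym[of 1] one x by auto
  have fp: "f (x0 - 1) = 1" using excess_nonmem[of x0 A] x by simp
  have pS: "x0 - 1 + n \<notin> S" using one_side(2)[of "x0 - 1"] p fp x02 x by simp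
  have up: "a + 1 \<in> A" if a: "a \<in> A" "x0 \<le> a" "a < n" for a
  proof (rule ccontr)
    assume "a + 1 \<notin> A"
    then have c: "x0 + n - (a + 1) \<in> A" using right_sym[of "a + 1"] a by auto
    have "a + (x0 + n - (a + 1)) = x0 - 1 + n" by simp
    then show False using set_plus_intro[OF a(1) c] pS by (simp only:)
  qed
  have up': "i \<in> A" if "a \<in> A" "x0 \<le> a" "a \<le> i" "i \<le> n" for a i
  proof -
    have "i \<le> n \<longrightarrow> i \<in> A" using that(3)
      by (induction i rule: int_ge_induct) (use that up in auto)
    then show ?thesis using that by simp
  qed
  have q: "x0 + 1 \<notin> A"
  proof
    assume a: "x0 + 1 \<in> A"
    then have "n - 1 \<in> A" using up'[of "x0 + 1" "n - 1"] x0n by simp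
    then show False using right_sym[of "x0 + 1"] a x0n by simp
  qed
  have "f (x0 + 1) = - 1" using excess_suc(2)[of x0 A] q x by simp
  then have qS: "x0 + 1 \<notin> S" using one_side(3)[of "x0 + 1"] q x x0n by simp
  have down: "a - 1 \<in> A" if a: "a \<in> A" "1 \<le> a" "a \<le> x0" for a
  proof (rule ccontr)
    assume "a - 1 \<notin> A"
    then have c: "x0 - (a - 1) \<in> A" using left_sym[of "a - 1"] a by auto
    have "a + (x0 - (a - 1)) = x0 + 1" by simp
    then show False using set_plus_intro[OF a(1) c] qS by (simp only:)
  qed
  have down': "i \<in> A" if "a \<in> A" "a \<le> x0" "0 \<le> i" "i \<le> a" for a i
  proof -
    have "0 \<le> i \<longrightarrow> i \<in> A" using that(4)
      by (induction i rule: int_le_induct) (use that down in auto)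
    then show ?thesis using that by simp
  qed
  obtain v where v: "0 \<le> v" "v \<le> x0" "v \<notin> A" "\<And>i. 0 \<le> i \<Longrightarrow> i < v \<Longrightarrow> i \<in> A"
    using least_above[of "\<lambda>i. i \<notin> A" x0 0] x by auto
  obtain b where b: "x0 \<le> b" "b \<le> n" "b \<in> A" "\<And>i. x0 \<le> i \<Longrightarrow> i < b \<Longrightarrow> i \<notin> A"
    using least_above[of "\<lambda>i. i \<in> A" n x0] x An by auto
  have "A = {0..v - 1} \<union> {b..n}"
  proof (intro equalityI subsetI)
    fix i assume i: "i \<in> A"
    then have i2: "0 \<le> i" "i \<le> n" using sub by auto
    have "\<not> (v \<le> i \<and> i \<le> x0)" using down'[of i v] i v by auto
    moreover have "\<not> (x0 \<le> i \<and> i < b)" using b(4)[of i] i by auto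
    ultimately show "i \<in> {0..v - 1} \<union> {b..n}" using i2 by auto
  next
    fix i assume "i \<in> {0..v - 1} \<union> {b..n}"
    then show "i \<in> A" using v(4)[of i] up'[of b i] b by auto
  qed
  moreover have "0 < v" using v A0 by (cases "v = 0") auto
  moreover have "v < b" using v b x by (cases "v = b") auto
  ultimately show ?thesis using two_intervals[of v b] b s by simp
qed

text \<open>Here nothing of A lies strictly between \<open>x0\<close> and n. Every non-element p
  below \<open>x0\<close> is a sum, so p + n is none; read from n, this says that A is closed under
  addition.\<close>

lemma T0_case:
  assumes one: "1 \<in> A" and x0n: "x0 = n - 1"
  shows "T_form 0 n A"
proof -
  note x = x0_facts
  \<comment> \<open>Let p be the least counterexample. Then p - 1 is a sum outside A, so p - 1 + n
    is not a sum. Anti-symmetry on [p - 1, n] pairs p with n - 1 = x0, yet neither is an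
    element.\<close>
  have above: "p \<in> S" if p: "0 \<le> p" "p < x0" "p \<notin> A" for p
  proof (rule ccontr)
    assume pS: "p \<notin> S"
    obtain p where p: "0 \<le> p" "p < x0" "p \<notin> A" "p \<notin> S" "\<And>i. 0 \<le> i \<Longrightarrow> i < p \<Longrightarrow> \<not> (i \<notin> A \<and> i \<notin> S)"
      using least_above[of "\<lambda>i. i \<notin> A \<and> i \<notin> S" p 0] p pS by (smt (verit))
    have p1: "p - 1 \<notin> A" using set_plus_intro[OF _ one, of "p - 1" A] p(4) by auto
    have p0: "1 \<le> p" using p A0 by (cases "p = 0") auto
    have p1S: "p - 1 \<in> S" using p(5)[of "p - 1"] p1 p0 by simp
    have nS: "p - 1 + n \<notin> S" using one_side(1)[of "p - 1"] p1 p1S p0 p(2) x by simp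
    have "f p \<le> 0" using excess_low(1)[of p A] p by simp
    then have "f (p - 1) \<le> f n" using excess_nonmem[of p A] p fn by simp
    then have "n - 1 \<in> A \<longleftrightarrow> p - 1 + n - (n - 1) \<notin> A"
      using p0 p(2) x0n nS by (intro excess_high(2)) auto
    then show False using p(3) x(5) x0n by simp
  qed
  let ?L = "reflect n A"
  \<comment> \<open>Read from the right end, the reflection i \<mapsto> n - 1 - i becomes y
    \<mapsto> n + 1 - y, whence the Frobenius number n + 1.\<close>
  interpret L: sym_semigroup ?L "n + 1"
  proof
    show "1 \<le> n + 1" using npos by simp
    show "?L \<subseteq> {0..n + 1}" using sub by (auto simp: reflect_def)
    show "0 \<in> ?L" using An by (simp add: mem_reflect)
    show "y \<in> ?L \<longleftrightarrow> n + 1 - y \<notin> ?L" if y: "0 \<le> y" "y \<le> n + 1" for y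
    proof -
      consider "y = 0" | "y = n + 1" | "1 \<le> y" "y \<le> n" using y by linarith
      then show ?thesis
      proof cases
        case 1
        have "- 1 \<notin> A" using sub by auto
        then show ?thesis using 1 An by (simp add: mem_reflect)
      next
        case 2
        have "- 1 \<notin> A" using sub by auto
        then show ?thesis using 2 An by (simp add: mem_reflect)
      next
        case 3
        then show ?thesis using left_sym[of "n - y"] x0n by (simp add: mem_reflect)
      qed
    qed
    show "a + b \<in> ?L" if ab: "a \<in> ?L" "b \<in> ?L" "a + b \<le> n + 1" for a b
    proof (rule ccontr)
      assume c: "a + b \<notin> ?L"
      define p where "p = n - (a + b)"
      have pA: "p \<notin> A" using c by (simp add: p_def mem_reflect)
      have m: "n - a \<in> A" "n - b \<in> A" using ab by (auto simp: mem_reflect)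
      have "(n - a) + (n - b) = p + n" by (simp add: p_def)
      then have pS: "p + n \<in> S" using set_plus_intro[OF m] by (simp only:)
      have "0 \<le> a" "0 \<le> b" using m sub by auto
      have "p \<noteq> - 1"
      proof
        assume "p = - 1"
        then have "(n - a) + (n - b) = n - 1" by (simp add: p_def)
        then have "n - 1 \<in> S" using set_plus_intro[OF m] by (simp only:)
        then show False using x(3) x0n by simp
      qed
      then have "0 \<le> p" using ab by (simp add: p_def)
      moreover have "p \<noteq> n" using pA An by auto
      moreover have "p \<le> n" using \<open>0 \<le> a\<close> \<open>0 \<le> b\<close> by (simp add: p_def)
      moreover have "p \<noteq> x0" using pS x(4) by auto
      ultimately show False using above[of p] one_side(1)[of p] pA pS x0n by simp
    qed
  qed
  have "2 \<notin> ?L"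
  proof
    assume "2 \<in> ?L"
    then have "n - 1 \<in> ?L \<longleftrightarrow> even (n - 1)" using npos by (intro L.evens_if_two) auto
    then show False using one x(8) by (simp add: mem_reflect)
  qed
  then have am: "right_additively_minimal (?L - {0}) 1 n" "4 \<le> n"
    using L.additively_minimal npos by auto
  have "left_additively_minimal (reflect n (?L - {0})) (n - n) (n - 1)"
    by (rule left_additively_minimal_reflect[OF am(1)])
  moreover have "reflect n (?L - {0}) = A - {n}" by (auto simp: mem_reflect)
  ultimately have "left_additively_minimal (A - {n}) (2 * 0) (n - 1)" by simp
  moreover have "A = (\<lambda>i. 2 * i) ` {0..0} \<union> (A - {n}) \<union> {n}" using A0 An by auto
  ultimately show ?thesis unfolding T_form_def using am(2) by (intro conjI exI[of _ "A - {n}"]) auto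
qed

text \<open>Closure amounts to no non-element up to \<open>x0\<close> being a sum. A negative excess
  excludes a sum at once; since the excess is never positive there, only level 0 remains.\<close>

lemma left_semigroup:
  assumes one: "1 \<notin> A" "n - 1 \<notin> A"
  shows "sym_semigroup (A \<inter> {0..x0}) x0"
proof -
  note x = x0_facts
  have x1: "x0 - 1 \<in> A" using left_sym[of 1] one x by auto
  \<comment> \<open>At the largest non-element m of positive excess the value is 1 and m + 1 is a
    non-element as well. Then m + n is not a sum, and anti-symmetry on [m, n] pairs m + 1 with n -
    1, although both are outside A.\<close>
  have np: "f p \<le> 0" if p: "0 \<le> p" "p \<le> x0" "p \<notin> A" for p
  proof (rule ccontr)
    assume c: "\<not> ?thesis"
    define B where "B = {p \<in> {0..x0}. p \<notin> A \<and> 0 < f p}"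
    have fB: "finite B" unfolding B_def by (rule finite_subset[of _ "{0..x0}"]) auto
    have "p \<in> B" using p c by (simp add: B_def)
    define m where "m = Max B"
    have "m \<in> B" unfolding m_def using fB \<open>p \<in> B\<close> by (intro Max_in) auto
    then have m: "0 \<le> m" "m \<le> x0" "m \<notin> A" "0 < f m" by (auto simp: B_def)
    have mmax: "i \<le> m" if "0 \<le> i" "i \<le> x0" "i \<notin> A" "0 < f i" for i
      unfolding m_def using that by (intro Max_ge fB) (simp add: B_def)
    have mx: "m \<noteq> x0" "m \<noteq> x0 - 1" using m x x1 by auto
    have "m + 1 \<notin> A"
    proof
      assume "m + 1 \<in> A"
      then have "f (m + 1) = f m + 1" using excess_suc(1)[of m A] m by simp
      then obtain z where "m + 1 < z" "z \<le> x0" "z \<notin> A" "f z = f m"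
        using excess_crossing[of "m + 1" x0 "f m" A] m mx x by auto
      then show False using mmax[of z] m by simp
    qed
    have "f (m + 1) = f m - 1" using excess_suc(2)[of m A] m \<open>m + 1 \<notin> A\<close> by simp
    moreover have "f (m + 1) \<le> 0" using mmax[of "m + 1"] \<open>m + 1 \<notin> A\<close> m mx by force
    ultimately have fm: "f m = 1" using m by simp
    have "m + n \<notin> S" using one_side(2)[of m] m mx x by simp
    then have "n - 1 \<in> A \<longleftrightarrow> m + n - (n - 1) \<notin> A" using m mx x fm fn by (intro excess_high(2)) auto
    then show False using one(2) \<open>m + 1 \<notin> A\<close> by simp
  qed
  have notS: "w \<notin> S" if w: "0 \<le> w" "w \<le> x0" "w \<notin> A" for w
  proof
    assume wS: "w \<in> S"
    then have wx: "w \<noteq> x0" using x by auto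
    then have "f w = 0" using np[OF w] one_side(3)[of w] wS w x by force
    then have "odd w" using excess_parity[of A w] by simp
    obtain a b where ab: "a \<in> A" "b \<in> A" "w = a + b" using wS by (auto elim: set_plus_elim)
    \<comment> \<open>Level 0 makes w odd, so one summand a is odd and p = x0 - a is an even
      non-element. Parity gives f(p) \<noteq> 0, hence f(p) < 0 and p is no sum; but p = (x0 - w) +
      b.\<close>
    have contra: False if ab: "a \<in> A" "b \<in> A" "w = a + b" "odd a" for a b
    proof -
      have "0 \<le> a" "0 \<le> b" using ab sub by auto
      define p where "p = x0 - a"
      have pA: "p \<notin> A" using left_sym[of a] ab \<open>0 \<le> b\<close> \<open>0 \<le> a\<close> w by (auto simp: p_def)
      have p: "0 \<le> p" "p < x0" using ab w \<open>0 \<le> b\<close> \<open>0 \<le> a\<close> \<open>odd a\<close>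
        by (auto simp: p_def) (cases "a = 0", auto)
      have "even p" using ab(4) x(7) by (simp add: p_def)
      then have "f p \<noteq> 0" using excess_parity[of A p] by auto
      then have "f p < 0" using np[of p] pA p by simp
      then have "p \<notin> S" using one_side(3)[of p] p pA x by simp
      moreover have "x0 - w \<in> A" using left_sym[of w] w by auto
      moreover have "(x0 - w) + b = p" using ab by (simp add: p_def)
      ultimately show False using set_plus_intro[OF \<open>x0 - w \<in> A\<close> ab(2)] by (simp only:)
    qed
    show False
    proof (cases "odd a")
      case True then show ?thesis using contra[of a b] ab by simp
    next
      case False
      then have "odd b" using \<open>odd w\<close> ab(3) by simp
      then show ?thesis using contra[of b a] ab by simp
    qed
  qed
  show ?thesis
  proof
    show "1 \<le> x0" using x by simp
    show "A \<inter> {0..x0} \<subseteq> {0..x0}" "0 \<in> A \<inter> {0..x0}" using A0 x by auto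
    show "y \<in> A \<inter> {0..x0} \<longleftrightarrow> x0 - y \<notin> A \<inter> {0..x0}" if "0 \<le> y" "y \<le> x0" for y
      using left_sym[OF that] that by simp
    show "a + b \<in> A \<inter> {0..x0}" if ab: "a \<in> A \<inter> {0..x0}" "b \<in> A \<inter> {0..x0}" "a + b \<le> x0" for a b
    proof -
      have "a + b \<in> S" using ab by (intro set_plus_intro) auto
      then show ?thesis using notS[of "a + b"] ab by auto
    qed
  qed
qed

end

context critical
begin

lemma critical_reflect: "critical (reflect n A) n (n - x0)"
proof -
  interpret r: normalized "reflect n A" n by (rule normalized_reflect)
  show ?thesis
  proof
    show "2 * int (card (reflect n A)) = n + 2" using nk by (simp add: card_reflect)
    show "r.missed = {n - x0}" unfolding missed_reflect x0 by (auto simp: mem_reflect)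
    show "r.doubled = {}" unfolding doubled_reflect nd by (simp add: reflect_def)
    have "r.S = reflect (2 * n) S" by (auto simp: reflect_sum mem_reflect)
    then show "card r.S = 3 * card (reflect n A) - 3" using s by (simp add: card_reflect)
  qed
qed

lemma right_part:
  assumes "right_additively_minimal (reflect n A \<inter> {0..n - x0} - {0}) 1 (n - x0 - 1)"
  shows "left_additively_minimal (A \<inter> {x0 + 1..n - 1}) (x0 + 1) (n - 1)"
proof -
  have "left_additively_minimal (reflect n (reflect n A \<inter> {0..n - x0} - {0})) (n - (n - x0 - 1)) (n - 1)"
    by (rule left_additively_minimal_reflect[OF assms])
  moreover have "reflect n (reflect n A \<inter> {0..n - x0} - {0}) = A \<inter> {x0 + 1..n - 1}"
  proof -
    have "x \<noteq> x0" if "x \<in> A" for x using that x0_facts(5) by auto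
    then show ?thesis using sub by (force simp: mem_reflect)
  qed
  ultimately show ?thesis by simp
qed

text \<open>The even numbers run up to 2k = x0 + 1, which is in A as the mirror image of the
  non-element n - 1. The additively minimal part starts at this same point.\<close>

lemma T_case:
  assumes ev: "\<And>i. 0 \<le> i \<Longrightarrow> i \<le> x0 \<Longrightarrow> i \<in> A \<longleftrightarrow> even i" and n1: "n - 1 \<notin> A"
    and am: "right_additively_minimal (reflect n A \<inter> {0..n - x0} - {0}) 1 (n - x0 - 1)" and x5: "5 \<le> n - x0"
  shows "T_form ((x0 + 1) div 2) n A"
proof -
  note x = x0_facts
  define k where "k = (x0 + 1) div 2"
  have k: "2 * k = x0 + 1" unfolding k_def using x(7) by presburger
  have k0: "0 \<le> k" using k x(1) by simp
  have xA: "x0 + 1 \<in> A" using right_sym[of "x0 + 1"] n1 x by auto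
  have "A = (\<lambda>i. 2 * i) ` {0..k} \<union> (A \<inter> {x0 + 1..n - 1}) \<union> {n}"
  proof (intro equalityI subsetI)
    fix i assume i: "i \<in> A"
    then have i2: "0 \<le> i" "i \<le> n" "i \<noteq> x0" using sub x by auto
    consider "i < x0" | "x0 < i" "i < n" | "i = n" using i2 by linarith
    then show "i \<in> (\<lambda>i. 2 * i) ` {0..k} \<union> (A \<inter> {x0 + 1..n - 1}) \<union> {n}"
    proof cases
      case 1
      then obtain j where j: "i = 2 * j" using ev i i2 by (auto elim: evenE)
      then have "0 \<le> j" "j \<le> k" using 1 i2 k by auto
      then show ?thesis using j by auto
    qed (use i in auto)
  next
    fix i assume "i \<in> (\<lambda>i. 2 * i) ` {0..k} \<union> (A \<inter> {x0 + 1..n - 1}) \<union> {n}"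
    then consider j where "0 \<le> j" "j \<le> k" "i = 2 * j" | "i \<in> A" using An by auto
    then show "i \<in> A"
    proof cases
      case 1
      show ?thesis
      proof (cases "j = k")
        case True then show ?thesis using 1 k xA by simp
      next
        case False then show ?thesis using ev[of i] 1 k by auto
      qed
    qed
  qed
  moreover have "left_additively_minimal (A \<inter> {x0 + 1..n - 1}) (2 * k) (n - 1)"
    using right_part[OF am] k by simp
  ultimately show ?thesis
    unfolding T_form_def k_def[symmetric] using k k0 x5
      by (intro conjI exI[of _ "A \<inter> {x0 + 1..n - 1}"]) auto
qed

lemma one_in_case:
  assumes "1 \<in> A"
  shows "bi_arith_prog A \<or> T_form 0 n A"
  using interval_case[OF assms] T0_case[OF assms] x0_facts(2) by (cases "x0 = n - 1") auto

text \<open>Seen from its own end, each side of \<open>x0\<close> is even or additively minimal. One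
  side of each kind gives the T-form or its reflection, two minimal sides give the S-form.\<close>

lemma critical_forms:
  assumes gcd1: "Gcd A = 1"
  shows "bi_arith_prog A \<or> (\<exists>k. T_form k n A) \<or> (\<exists>k T. T_form k n T \<and> A = reflect n T) \<or> (\<exists>u. S_form u n A)"
proof -
  interpret r: critical "reflect n A" n "n - x0" by (rule critical_reflect)
  note x = x0_facts
  have rr: "A = reflect n (reflect n A)" by (simp add: reflect_reflect)
  consider "1 \<in> A" | "n - 1 \<in> A" | "1 \<notin> A" "n - 1 \<notin> A" by blast
  then show ?thesis
  proof cases
    case 1 then show ?thesis using one_in_case by blast
  next
    case 2
    then have "bi_arith_prog (reflect n A) \<or> T_form 0 n (reflect n A)"
      by (intro r.one_in_case) (simp add: mem_reflect)
    then show ?thesis using bi_arith_prog_reflect rr by blast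
  next
    case 3
    interpret L: sym_semigroup "A \<inter> {0..x0}" x0 by (rule left_semigroup[OF 3])
    have nin: "1 \<notin> reflect n A" "n - 1 \<notin> reflect n A" using 3 by (auto simp: mem_reflect)
    interpret R: sym_semigroup "reflect n A \<inter> {0..n - x0}" "n - x0"
      by (rule r.left_semigroup[OF nin])
    have evL: "i \<in> A \<longleftrightarrow> even i" if "2 \<in> A \<inter> {0..x0} \<or> x0 = 1" "0 \<le> i" "i \<le> x0" for i
      using L.evens_if_two[OF that] that by simp
    have evR: "i \<in> reflect n A \<longleftrightarrow> even i"
      if "2 \<in> reflect n A \<inter> {0..n - x0} \<or> n - x0 = 1" "0 \<le> i" "i \<le> n - x0" for i
      using R.evens_if_two[OF that] that by simp
    show ?thesis
    proof (cases "2 \<in> A \<inter> {0..x0} \<or> x0 = 1")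
      case el: True
      show ?thesis
      proof (cases "2 \<in> reflect n A \<inter> {0..n - x0} \<or> n - x0 = 1")
        case er: True
        \<comment> \<open>n is even, so evenness measured from the right end is ordinary evenness;
          two even sides contradict gcd 1.\<close>
        have "2 dvd i" if i: "i \<in> A" for i
        proof (cases "i \<le> x0")
          case True
          then show ?thesis using evL[OF el, of i] i sub by auto
        next
          case False
          have "i \<le> n" using i sub by auto
          then have "n - i \<in> reflect n A \<longleftrightarrow> even (n - i)" using False by (intro evR[OF er]) auto
          then show ?thesis using i x(8) by (simp add: mem_reflect)
        qed
        then have "2 dvd Gcd A" by (rule Gcd_greatest)
        then show ?thesis using gcd1 by simp
      next
        case False
        then have "right_additively_minimal (reflect n A \<inter> {0..n - x0} - {0}) 1 (n - x0 - 1)"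
            "5 \<le> n - x0"
          using R.additively_minimal by blast+
        then have "T_form ((x0 + 1) div 2) n A" using T_case evL[OF el] 3 by blast
        then show ?thesis by blast
      qed
    next
      case el: False
      then have amL: "right_additively_minimal (A \<inter> {0..x0} - {0}) 1 (x0 - 1)" "5 \<le> x0"
        using L.additively_minimal by blast+
      show ?thesis
      proof (cases "2 \<in> reflect n A \<inter> {0..n - x0} \<or> n - x0 = 1")
        case er: True
        have "right_additively_minimal (reflect n (reflect n A) \<inter> {0..n - (n - x0)} - {0}) 1 (n - (n - x0) - 1)"
          using amL(1) by (simp add: reflect_reflect)
        then have "T_form ((n - x0 + 1) div 2) n (reflect n A)"
          using r.T_case evR[OF er] nin(2) amL(2) by simp
        then show ?thesis using rr by blast
      next
        case False
        then have amR: "right_additively_minimal (reflect n A \<inter> {0..n - x0} - {0}) 1 (n - x0 - 1)"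
            "5 \<le> n - x0"
          using R.additively_minimal by blast+
        define C where "C = A \<inter> {0..x0} - {0}"
        define D where "D = A \<inter> {x0 + 1..n - 1}"
        have "A = {0} \<union> C \<union> D \<union> {n}"
        proof (intro equalityI subsetI)
          fix i assume i: "i \<in> A"
          then have "0 \<le> i" "i \<le> n" using sub by auto
          then show "i \<in> {0} \<union> C \<union> D \<union> {n}" using i by (auto simp: C_def D_def)
        qed (use A0 An in \<open>auto simp: C_def D_def\<close>)
        moreover have "right_additively_minimal C 1 (x0 - 1)" using amL(1) by (simp add: C_def)
        moreover have "left_additively_minimal D (x0 - 1 + 2) (n - 1)"
          using right_part[OF amR(1)] by (simp add: D_def add.commute)
        \<comment> \<open>u = x0 - 1, and its bounds 4 and n - 6 express that both Frobenius numbers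
          x0 and n - x0 are at least 5.\<close>
        ultimately have "S_form (x0 - 1) n A"
          unfolding S_form_def using amL(2) amR(2) by (intro conjI exI[of _ C] exI[of _ D]) auto
        then show ?thesis by blast
      qed
    qed
  qed
qed

end

theorem theorem2p1:
  fixes A :: "int set" and n :: int
  assumes "finite A" and "card A \<ge> 2"
    and "Min A = 0" and "Gcd A = 1" and "Max A = n"
    and "card (A + A) = 3 * card A - 3"
  shows "bi_arith_prog A
    \<or> (\<exists>x. {x..<x + (2 * int (card A) - 1)} \<subseteq> A + A)
    \<or> (card A = 6 \<and> freiman_image K6 A)
    \<or> (2 * int (card A) = n + 2 \<and>
        ((\<exists>k. T_form k n A)
         \<or> (\<exists>k T. T_form k n T \<and> A = reflect n T)
         \<or> (\<exists>u. S_form u n A)))"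
proof -
  have ne: "A \<noteq> {}" using assms(2) by auto
  have A0: "0 \<in> A" and An: "n \<in> A" using Min_in[OF assms(1) ne] Max_in[OF assms(1) ne] assms(3,5)
    by simp_all
  have sub: "A \<subseteq> {0..n}" using Min_le[OF assms(1)] Max_ge[OF assms(1)] assms(3,5) by fastforce
  have "n \<noteq> 0"
  proof
    assume "n = 0"
    then have "A \<subseteq> {0}" using sub by simp
    then have "card A \<le> 1" using card_mono[of "{0::int}" A] by simp
    then show False using assms(2) by simp
  qed
  moreover have "0 \<le> n" using A0 sub by auto
  ultimately have npos: "0 < n" by simp
  interpret normalized A n using assms(1) A0 An sub npos by unfold_locales
  note gcd1 = assms(4) and k = assms(2) and s = assms(6)
  consider "n + 3 \<le> 2 * int (card A)" | "2 * int (card A) = n + 2" | "2 * int (card A) \<le> n + 1"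
    by linarith
  then show ?thesis
  proof cases
    case 1
    then show ?thesis using dense_case[OF _ s k] by blast
  next
    case 2
    have "int (card S) = 3 * int (card A) - 3" using s k by simp
    then have cm: "card missed = card doubled + 1" using card_S 2 by linarith
    then obtain x0 where x0: "x0 \<in> missed" by (cases "missed = {}") auto
    show ?thesis
    proof (cases "missed = {x0}")
      case True
      then have "doubled = {}" using cm finite_classes(3) by simp
      then interpret critical A n x0 using 2 True s by unfold_locales
      show ?thesis using critical_forms[OF gcd1] 2 by blast
    next
      case False
      then obtain x1 where "x1 \<in> missed" "x0 \<noteq> x1" using x0 by blast
      then show ?thesis using periodic_if_two_missed[OF gcd1 2 s x0] by blast
    qed
  next
    case 3
    have "3 \<le> card A"
    proof (rule ccontr)
      assume "\<not> 3 \<le> card A"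
      then have c2: "card A = 2" using k by simp
      moreover have "card {0, n} = 2" using npos by simp
      ultimately have "A = {0, n}" using A0 An assms(1) card_subset_eq[of A "{0, n}"] by auto
      then have "n dvd Gcd A" by (intro Gcd_greatest) auto
      then have "n = 1" using gcd1 npos by simp
      then show False using 3 c2 by simp
    qed
    then show ?thesis using sparse_case[OF gcd1 3 s] by blast
  qed
qed

end
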